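(* Let $N\ge1$ be an integer, $N^2<\lambda<(N+1)^2$, and let $\beta:\mathbb{R}\to\mathbb{R}$ be continuously differentiable with $0<\beta_1\le\beta(t)\le\beta_2$ for all $t\in\mathbb{R}$, where $\beta_1,\beta_2$ are constants. For each $1\le j\le N$ there are global solutions $\zeta_j^{+},\zeta_j^{-}:\mathbb{R}\to H^1_0(0,\pi)$ of $$u_t=u_{xx}+\lambda u-\beta(t)u^3,\quad x\in(0,\pi),\qquad u(0,t)=u(\pi,t)=0,$$ such that $\zeta_j^{\pm}(t)\to0$ in $H^1_0(0,\pi)$ as $t\to-\infty$ and $\zeta_j^{\pm}(t)-\xi_j^{\pm}(t)\to0$ in $H^1_0(0,\pi)$ as $t\to+\infty$, where $\xi_j^{\pm}$ are the non-autonomous equilibria.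
   Context: $T_\beta(t,s)u_0$ denotes the value at time $t\ge s$ of the unique mild solution in $H^1_0(0,\pi)$ with value $u_0$ at time $s$. A global solution is a continuous $\xi:\mathbb{R}\to H^1_0(0,\pi)$ with $T_\beta(t,s)\xi(s)=\xi(t)$ for all $t\ge s$. For $b>0$ and an integer $j\ge1$ with $j^2<\lambda$, $\phi_{j,b}^+$ is the unique solution of $\phi''+\lambda\phi-b\phi^3=0$ on $(0,\pi)$, $\phi(0)=\phi(\pi)=0$, whose zeros in $[0,\pi]$ are exactly $i\pi/j$, $0\le i\le j$, and which is positive on $(0,\pi/j)$; $\phi_{j,b}^-=-\phi_{j,b}^+$. The non-autonomous equilibria are the global bounded solutions $\xi_j^{\pm}(t)=\lim_{s\to-\infty}T_\beta(t,s)\phi_{j,\beta_1}^{\pm}$, $t\in\mathbb{R}$, $1\le j\le N$ (the limits exist). *)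

theory Defs
  imports "HOL-Analysis.Analysis"
begin

section \<open>Square-integrable functions and weak derivatives on the interval from 0 to pi\<close>

definition L2_fun :: "(real \<Rightarrow> real) \<Rightarrow> bool" where
  "L2_fun g \<longleftrightarrow> set_borel_measurable lborel {0..pi} g \<and> set_integrable lborel {0..pi} (\<lambda>x. (g x)\<^sup>2)"

text \<open>In one space dimension the weak derivative is the derivative of the absolutely continuous
  representative. It is determined almost everywhere, see \<open>has_weak_deriv_unique\<close>.\<close>

definition has_weak_deriv :: "(real \<Rightarrow> real) \<Rightarrow> (real \<Rightarrow> real) \<Rightarrow> bool" where
  "has_weak_deriv u g \<longleftrightarrow>
     L2_fun g \<and> (\<forall>x\<in>{0..pi}. u x = u 0 + (LINT y:{0..x}|lborel. g y))"

definition weak_deriv :: "(real \<Rightarrow> real) \<Rightarrow> real \<Rightarrow> real" where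
  "weak_deriv u = (SOME g. has_weak_deriv u g)"

lemma L2_fun_mult_integrable:
  assumes "L2_fun f" "L2_fun g"
  shows "set_integrable lborel {0..pi} (\<lambda>x. f x * g x)"
proof -
  have m: "(\<lambda>x. indicator {0..pi} x * f x) \<in> borel_measurable lborel"
          "(\<lambda>x. indicator {0..pi} x * g x) \<in> borel_measurable lborel"
    using assms by (simp_all add: L2_fun_def set_borel_measurable_def)
  have i: "integrable lborel (\<lambda>x. indicator {0..pi} x * (f x)\<^sup>2 + indicator {0..pi} x * (g x)\<^sup>2)"
    using assms by (intro Bochner_Integration.integrable_add) (simp_all add: L2_fun_def set_integrable_def)
  have "integrable lborel (\<lambda>x. (indicator {0..pi} x * f x) * (indicator {0..pi} x * g x))"
  proof (rule Bochner_Integration.integrable_bound[OF i])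
    show "(\<lambda>x. (indicator {0..pi} x * f x) * (indicator {0..pi} x * g x)) \<in> borel_measurable lborel"
      using m by (rule borel_measurable_times)
    have b: "\<bar>a * b\<bar> \<le> \<bar>a\<^sup>2 + b\<^sup>2\<bar>" for a b :: real
    proof -
      have "0 \<le> (\<bar>a\<bar> - \<bar>b\<bar>)\<^sup>2" by simp
      then have "2 * (\<bar>a\<bar> * \<bar>b\<bar>) \<le> a\<^sup>2 + b\<^sup>2" by (simp add: power2_diff)
      moreover have "0 \<le> \<bar>a\<bar> * \<bar>b\<bar>" by simp
      ultimately show ?thesis unfolding abs_mult by linarith
    qed
    show "AE x in lborel. norm ((indicator {0..pi} x * f x) * (indicator {0..pi} x * g x))
        \<le> norm (indicator {0..pi} x * (f x)\<^sup>2 + indicator {0..pi} x * (g x)\<^sup>2)"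
      using b by (auto simp: indicator_def)
  qed
  moreover have "(\<lambda>x. (indicator {0..pi} x * f x) * (indicator {0..pi} x * g x))
      = (\<lambda>x. indicator {0..pi} x *\<^sub>R (f x * g x))"
    by (auto simp: indicator_def)
  ultimately show ?thesis by (simp add: set_integrable_def)
qed

lemma L2_fun_one: "L2_fun (\<lambda>x. 1)"
  by (simp add: L2_fun_def set_borel_measurable_def set_integrable_def)

lemma L2_fun_integrable: "L2_fun g \<Longrightarrow> set_integrable lborel {0..pi} g"
  using L2_fun_mult_integrable[OF L2_fun_one] by simp

lemma L2_fun_integrable_upto:
  assumes "L2_fun g" "x \<le> pi"
  shows "set_integrable lborel {0..x} g"
  using assms(2) by (intro set_integrable_subset[OF L2_fun_integrable[OF assms(1)]]) auto

lemma L2_fun_scale: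
  assumes "L2_fun g"
  shows "L2_fun (\<lambda>x. c * g x)"
proof -
  have "(\<lambda>x. c * (indicator {0..pi} x * g x)) \<in> borel_measurable lborel"
    using assms
    by (intro borel_measurable_times[OF borel_measurable_const])
       (simp add: L2_fun_def set_borel_measurable_def)
  moreover have "set_integrable lborel {0..pi} (\<lambda>x. c\<^sup>2 * (g x)\<^sup>2)"
    using assms by (intro set_integrable_mult_right) (simp add: L2_fun_def)
  ultimately show ?thesis
    by (simp add: L2_fun_def set_borel_measurable_def power_mult_distrib mult.left_commute)
qed

lemma L2_fun_add:
  assumes "L2_fun f" "L2_fun g"
  shows "L2_fun (\<lambda>x. f x + g x)"
proof -
  have "set_borel_measurable lborel {0..pi} (\<lambda>x. f x + g x)"
    using assms by (auto simp: L2_fun_def set_borel_measurable_def distrib_left)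
  moreover have "set_integrable lborel {0..pi} (\<lambda>x. (f x)\<^sup>2 + (g x)\<^sup>2 + 2 * (f x * g x))"
    using assms L2_fun_mult_integrable[OF assms]
    by (intro set_integral_add(1) set_integrable_mult_right) (simp_all add: L2_fun_def)
  ultimately show ?thesis
    by (simp add: L2_fun_def power2_sum mult.assoc)
qed

lemma has_weak_deriv_L2: "has_weak_deriv u g \<Longrightarrow> L2_fun g"
  by (simp add: has_weak_deriv_def)

lemma has_weak_deriv_add:
  assumes "has_weak_deriv u f" "has_weak_deriv v g"
  shows "has_weak_deriv (\<lambda>x. u x + v x) (\<lambda>x. f x + g x)"
  unfolding has_weak_deriv_def
proof (intro conjI ballI)
  show "L2_fun (\<lambda>x. f x + g x)"
    using assms by (intro L2_fun_add has_weak_deriv_L2)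
  fix x assume x: "x \<in> {0..pi}"
  have "(LINT y:{0..x}|lborel. f y + g y) = (LINT y:{0..x}|lborel. f y) + (LINT y:{0..x}|lborel. g y)"
    using assms x by (intro set_integral_add(2) L2_fun_integrable_upto has_weak_deriv_L2) auto
  moreover have "u x = u 0 + (LINT y:{0..x}|lborel. f y)" "v x = v 0 + (LINT y:{0..x}|lborel. g y)"
    using assms x unfolding has_weak_deriv_def by blast+
  ultimately show "u x + v x = u 0 + v 0 + (LINT y:{0..x}|lborel. f y + g y)"
    by linarith
qed

lemma has_weak_deriv_scale:
  assumes "has_weak_deriv u f"
  shows "has_weak_deriv (\<lambda>x. c * u x) (\<lambda>x. c * f x)"
  unfolding has_weak_deriv_def
proof (intro conjI ballI)
  show "L2_fun (\<lambda>x. c * f x)"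
    using assms by (intro L2_fun_scale has_weak_deriv_L2)
  fix x assume x: "x \<in> {0..pi}"
  have "u x = u 0 + (LINT y:{0..x}|lborel. f y)"
    using assms x unfolding has_weak_deriv_def by blast
  then show "c * u x = c * u 0 + (LINT y:{0..x}|lborel. c * f y)"
    by (simp add: distrib_left)
qed

lemma L2_fun_primitive_zero:
  assumes g: "L2_fun g" and z: "\<And>x. x \<in> {0..pi} \<Longrightarrow> (LINT y:{0..x}|lborel. g y) = 0"
  shows "AE x in lborel. x \<in> {0..pi} \<longrightarrow> g x = 0"
proof -
  define h where "h = (\<lambda>x. indicator {0..pi} x * g x)"
  have h: "integrable lborel h"
    using L2_fun_integrable[OF g] by (simp add: h_def set_integrable_def)
  have Iic: "(LINT y:{..x}|lborel. h y) = 0" for x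
  proof -
    have "(\<lambda>y. indicator {..x} y *\<^sub>R h y) = (\<lambda>y. indicator {0..min x pi} y *\<^sub>R g y)"
      by (auto simp: h_def indicator_def)
    then have "(LINT y:{..x}|lborel. h y) = (LINT y:{0..min x pi}|lborel. g y)"
      by (simp add: set_lebesgue_integral_def)
    also have "\<dots> = 0"
    proof (cases "0 \<le> x")
      case True
      then show ?thesis by (intro z) auto
    next
      case False
      then show ?thesis by (simp add: set_lebesgue_integral_def)
    qed
    finally show ?thesis .
  qed
  have si: "set_integrable lborel A h" if "A \<in> sets borel" for A
    using integrable_mult_indicator[of A lborel h] h that by (simp add: set_integrable_def)
  have tot: "integral\<^sup>L lborel h = 0"
  proof -
    have "(\<lambda>y. indicator {..pi} y *\<^sub>R h y) = h"
      by (auto simp: h_def indicator_def)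
    then show ?thesis
      using Iic[of pi] by (simp add: set_lebesgue_integral_def)
  qed
  have "(LINT y:A|lborel. h y) = 0" if A: "A \<in> sets borel" for A
  proof -
    have stable: "Int_stable (range (\<lambda>a::real. {..a}))"
      by (auto simp: Int_stable_def Int_atMost)
    have subset_UNIV_range: "range (\<lambda>a::real. {..a}) \<subseteq> Pow UNIV" by auto
    have bor: "sigma_sets UNIV (range (\<lambda>a::real. {..a})) = sets borel"
      by (subst borel_eq_atMost) simp
    from A have "A \<in> sigma_sets UNIV (range (\<lambda>a::real. {..a}))" by (simp add: bor)
    with stable subset_UNIV_range show ?thesis
    proof (induction rule: sigma_sets_induct_disjoint)
      case (basic A)
      then show ?case using Iic by auto
    next
      case empty
      then show ?case by (simp add: set_lebesgue_integral_def)
    next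
      case (compl A)
      then have A: "A \<in> sets borel" by (simp add: bor)
      have "integral\<^sup>L lborel h = (LINT y:UNIV|lborel. h y)"
        by (simp add: set_lebesgue_integral_def)
      also have "\<dots> = (LINT y:A \<union> (UNIV - A)|lborel. h y)" by simp
      also have "\<dots> = (LINT y:A|lborel. h y) + (LINT y:UNIV - A|lborel. h y)"
        using A by (intro set_integral_Un si) auto
      finally show ?case using compl tot by simp
    next
      case (union A)
      then have A: "range A \<subseteq> sets borel" by (simp add: bor)
      have "(LINT y:(\<Union>i. A i)|lborel. h y) = (\<Sum>i. (LINT y:A i|lborel. h y))"
        using A union(1)
        by (intro lebesgue_integral_countable_add si) (auto simp: disjoint_family_on_def)
      then show ?case using union by simp
    qed
  qed
  then have "AE x in lborel. h x = 0"
    using h by (intro density_unique_real) (auto simp: set_lebesgue_integral_def)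
  then show ?thesis
    by eventually_elim (auto simp: h_def)
qed

lemma has_weak_deriv_unique:
  assumes "has_weak_deriv u f" "has_weak_deriv u g"
  shows "AE x in lborel. x \<in> {0..pi} \<longrightarrow> f x = g x"
proof -
  have d: "has_weak_deriv (\<lambda>x. u x + (-1) * u x) (\<lambda>x. f x + (-1) * g x)"
    using assms by (intro has_weak_deriv_add has_weak_deriv_scale)
  have "AE x in lborel. x \<in> {0..pi} \<longrightarrow> f x + (-1) * g x = 0"
  proof (rule L2_fun_primitive_zero)
    show "L2_fun (\<lambda>x. f x + (-1) * g x)"
      using d by (rule has_weak_deriv_L2)
    show "(LINT y:{0..x}|lborel. f y + (-1) * g y) = 0" if "x \<in> {0..pi}" for x
    proof -
      have "\<forall>x\<in>{0..pi}. u x + (-1) * u x = u 0 + (-1) * u 0 + (LINT y:{0..x}|lborel. f y + (-1) * g y)"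
        using d unfolding has_weak_deriv_def by blast
      then show ?thesis using that by auto
    qed
  qed
  then show ?thesis by eventually_elim auto
qed

lemma has_weak_deriv_some: "has_weak_deriv u g \<Longrightarrow> has_weak_deriv u (weak_deriv u)"
  unfolding weak_deriv_def by (rule someI[of "has_weak_deriv u"])

section \<open>The Hilbert space of Sobolev functions vanishing at the endpoints\<close>

text \<open>Elements are represented by total functions, extended by zero outside the interval, so
  that equality in the type is equality on the interval. The norm is the \<open>L\<^sup>2\<close> norm of the
  derivative, which by Poincare's inequality is equivalent to the full Sobolev norm.\<close>

definition H10_set :: "(real \<Rightarrow> real) set" where
  "H10_set = {u. (\<exists>g. has_weak_deriv u g) \<and> u 0 = 0 \<and> u pi = 0 \<and> (\<forall>x. x \<notin> {0..pi} \<longrightarrow> u x = 0)}"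

lemma has_weak_deriv_zero: "has_weak_deriv (\<lambda>x. 0) (\<lambda>x. 0)"
  by (simp add: has_weak_deriv_def L2_fun_def set_borel_measurable_def set_integrable_def
      set_lebesgue_integral_def)

typedef h10 = H10_set
  morphisms h10_fun Abs_h10
  using has_weak_deriv_zero by (auto simp: H10_set_def intro!: exI[of _ "\<lambda>x. 0"])

setup_lifting type_definition_h10

instantiation h10 :: real_vector
begin

lift_definition zero_h10 :: h10 is "\<lambda>x. 0"
  using has_weak_deriv_zero by (auto simp: H10_set_def)

lift_definition plus_h10 :: "h10 \<Rightarrow> h10 \<Rightarrow> h10" is "\<lambda>u v x. u x + v x"
  using has_weak_deriv_add by (fastforce simp: H10_set_def)

lift_definition scaleR_h10 :: "real \<Rightarrow> h10 \<Rightarrow> h10" is "\<lambda>c u x. c * u x"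
  using has_weak_deriv_scale by (fastforce simp: H10_set_def)

definition uminus_h10 :: "h10 \<Rightarrow> h10" where "- u = (-1) *\<^sub>R (u::h10)"

definition minus_h10 :: "h10 \<Rightarrow> h10 \<Rightarrow> h10" where "u - v = u + - (v::h10)"

instance
  by standard
    (simp_all add: uminus_h10_def minus_h10_def, (transfer, auto simp: algebra_simps fun_eq_iff)+)

end

lemma weak_deriv_h10: "has_weak_deriv (h10_fun u) (weak_deriv (h10_fun u))"
  using h10_fun[of u] has_weak_deriv_some by (auto simp: H10_set_def)

instantiation h10 :: real_inner
begin

definition inner_h10 :: "h10 \<Rightarrow> h10 \<Rightarrow> real" where
  "inner u v = (LINT x:{0..pi}|lborel. weak_deriv (h10_fun u) x * weak_deriv (h10_fun v) x)"

definition norm_h10 :: "h10 \<Rightarrow> real" where "norm u = sqrt (inner u (u::h10))"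

definition sgn_h10 :: "h10 \<Rightarrow> h10" where "sgn u = u /\<^sub>R norm (u::h10)"

definition dist_h10 :: "h10 \<Rightarrow> h10 \<Rightarrow> real" where "dist u v = norm (u - (v::h10))"

definition uniformity_h10 :: "(h10 \<times> h10) filter" where
  "uniformity_h10 = (INF e\<in>{0 <..}. principal {(u, v). dist u v < e})"

definition open_h10 :: "h10 set \<Rightarrow> bool" where
  "open_h10 U \<longleftrightarrow> (\<forall>x\<in>U. eventually (\<lambda>(x', y). x' = x \<longrightarrow> y \<in> U) uniformity)"

lemma inner_h10_eq:
  assumes "has_weak_deriv (h10_fun u) f" "has_weak_deriv (h10_fun v) g"
  shows "inner u v = (LINT x:{0..pi}|lborel. f x * g x)"
proof -
  let ?f = "weak_deriv (h10_fun u)" and ?g = "weak_deriv (h10_fun v)"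
  have ae: "AE x in lborel. x \<in> {0..pi} \<longrightarrow> ?f x = f x" "AE x in lborel. x \<in> {0..pi} \<longrightarrow> ?g x = g x"
    using assms weak_deriv_h10 has_weak_deriv_unique by blast+
  have L: "L2_fun f" "L2_fun g" "L2_fun ?f" "L2_fun ?g"
    using assms weak_deriv_h10 has_weak_deriv_L2 by blast+
  show ?thesis
    unfolding inner_h10_def set_lebesgue_integral_def
  proof (rule integral_cong_AE)
    show "(\<lambda>x. indicat_real {0..pi} x *\<^sub>R (?f x * ?g x)) \<in> borel_measurable lborel"
         "(\<lambda>x. indicat_real {0..pi} x *\<^sub>R (f x * g x)) \<in> borel_measurable lborel"
      using L2_fun_mult_integrable L unfolding set_integrable_def by blast+
    show "AE x in lborel. indicat_real {0..pi} x *\<^sub>R (?f x * ?g x) = indicat_real {0..pi} x *\<^sub>R (f x * g x)"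
      using ae by eventually_elim (auto simp: indicator_def)
  qed
qed

instance
proof
  fix u v w :: h10 and c :: real and U :: "h10 set"
  let ?d = "\<lambda>u. weak_deriv (h10_fun u)"
  have L: "L2_fun (?d u)" for u
    by (rule has_weak_deriv_L2[OF weak_deriv_h10])
  show "sgn u = u /\<^sub>R norm u" by (rule sgn_h10_def)
  show "dist u v = norm (u - v)" by (rule dist_h10_def)
  show "uniformity = (INF e\<in>{0 <..}. principal {(u, v :: h10). dist u v < e})"
    by (rule uniformity_h10_def)
  show "open U \<longleftrightarrow> (\<forall>x\<in>U. \<forall>\<^sub>F (x', y) in uniformity. x' = x \<longrightarrow> y \<in> U)"
    by (rule open_h10_def)
  show "norm u = sqrt (inner u u)" by (rule norm_h10_def)
  show "inner u v = inner v u" by (simp add: inner_h10_def mult.commute)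
  have "has_weak_deriv (h10_fun (u + v)) (\<lambda>x. ?d u x + ?d v x)"
    using has_weak_deriv_add[OF weak_deriv_h10[of u] weak_deriv_h10[of v]] by (simp add: plus_h10.rep_eq)
  from inner_h10_eq[OF this weak_deriv_h10[of w]]
  show "inner (u + v) w = inner u w + inner v w"
    using set_integral_add(2)[OF L2_fun_mult_integrable[OF L L] L2_fun_mult_integrable[OF L L]]
    by (simp add: inner_h10_def distrib_right)
  have "has_weak_deriv (h10_fun (c *\<^sub>R u)) (\<lambda>x. c * ?d u x)"
    using has_weak_deriv_scale[OF weak_deriv_h10[of u]] by (simp add: scaleR_h10.rep_eq)
  from inner_h10_eq[OF this weak_deriv_h10[of v]]
  show "inner (c *\<^sub>R u) v = c * inner u v"
    by (simp add: inner_h10_def mult.assoc)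
  show ge: "0 \<le> inner u u"
    unfolding inner_h10_def set_lebesgue_integral_def by (intro integral_nonneg_AE) auto
  show "inner u u = 0 \<longleftrightarrow> u = 0"
  proof
    assume "u = 0"
    moreover have "has_weak_deriv (h10_fun 0) (\<lambda>x. 0)"
      using has_weak_deriv_zero by (simp add: zero_h10.rep_eq)
    ultimately show "inner u u = 0"
      using inner_h10_eq[of u "\<lambda>x. 0" u "\<lambda>x. 0"] by (simp add: set_lebesgue_integral_def)
  next
    assume "inner u u = 0"
    then have "AE x in lborel. indicat_real {0..pi} x *\<^sub>R (?d u x * ?d u x) = 0"
      using L2_fun_mult_integrable[OF L L, of u u]
      by (subst integral_nonneg_eq_0_iff_AE[symmetric])
         (auto simp: inner_h10_def set_lebesgue_integral_def set_integrable_def)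
    then have ae: "AE x in lborel. x \<in> {0..pi} \<longrightarrow> ?d u x = 0"
      by eventually_elim auto
    have "h10_fun u x = 0" for x
    proof (cases "x \<in> {0..pi}")
      case True
      have "(LINT y:{0..x}|lborel. ?d u y) = (LINT y:{0..x}|lborel. 0)"
        unfolding set_lebesgue_integral_def
      proof (rule integral_cong_AE)
        show "(\<lambda>y. indicat_real {0..x} y *\<^sub>R ?d u y) \<in> borel_measurable lborel"
          using L2_fun_integrable_upto[OF L[of u], of x] True unfolding set_integrable_def by auto
        show "AE y in lborel. indicat_real {0..x} y *\<^sub>R ?d u y = indicat_real {0..x} y *\<^sub>R 0"
          using ae by eventually_elim (use True in \<open>auto simp: indicator_def\<close>)
      qed simp
      moreover have "h10_fun u x = h10_fun u 0 + (LINT y:{0..x}|lborel. ?d u y)"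
        using weak_deriv_h10[of u] True unfolding has_weak_deriv_def by blast
      moreover have "h10_fun u 0 = 0" using h10_fun[of u] by (simp add: H10_set_def)
      ultimately show ?thesis by (simp add: set_lebesgue_integral_def)
    next
      case False
      then show ?thesis using h10_fun[of u] by (auto simp: H10_set_def)
    qed
    then show "u = 0"
      by (simp add: h10_fun_inject[symmetric] zero_h10.rep_eq fun_eq_iff)
  qed
qed

end

section \<open>The evolution process\<close>

lift_definition sine_mode :: "nat \<Rightarrow> h10" is
  "\<lambda>n x. if x \<in> {0..pi} then sin (real n * x) else 0"
proof -
  fix n :: nat
  let ?e = "\<lambda>x. if x \<in> {0..pi} then sin (real n * x) else 0"
  let ?g = "\<lambda>x. real n * cos (real n * x)"
  have "L2_fun ?g"
    unfolding L2_fun_def set_borel_measurable_def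
  proof
    show "set_integrable lborel {0..pi} (\<lambda>x. (?g x)\<^sup>2)"
      by (intro borel_integrable_atLeastAtMost' continuous_intros)
  qed simp
  moreover have "(LINT y:{0..x}|lborel. ?g y) = sin (real n * x)" if "0 \<le> x" for x
  proof -
    have "(\<integral>y. indicator {0..x} y *\<^sub>R ?g y \<partial>lborel) = sin (real n * x) - sin (real n * 0)"
      using that
      by (intro integral_FTC_atLeastAtMost)
         (auto intro!: derivative_eq_intros continuous_intros
               simp: has_real_derivative_iff_has_vector_derivative[symmetric])
    then show ?thesis unfolding set_lebesgue_integral_def by simp
  qed
  ultimately have "has_weak_deriv ?e ?g"
    by (simp add: has_weak_deriv_def)
  then show "?e \<in> H10_set"
    by (auto simp: H10_set_def)
qed

definition sine_coeff :: "(real \<Rightarrow> real) \<Rightarrow> nat \<Rightarrow> real" where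
  "sine_coeff f n = 2 / pi * (LINT x:{0..pi}|lborel. f x * sin (real n * x))"

text \<open>The analytic semigroup generated by the Dirichlet Laplacian on \<open>L\<^sup>2(0,\<pi>)\<close>, whose eigenvalues are
  \<open>-n\<^sup>2\<close> with eigenfunctions \<open>sin (n x)\<close>, \<open>n \<ge> 1\<close> (the term \<open>n = 0\<close> vanishes). The series
  converges in the space \<open>h10\<close> for every square-integrable \<open>f\<close> when \<open>t > 0\<close>, and for
  \<open>t = 0\<close> when \<open>f\<close> is itself an element of that space.\<close>

definition heat_semigroup :: "real \<Rightarrow> (real \<Rightarrow> real) \<Rightarrow> h10" where
  "heat_semigroup t f = (\<Sum>n. (exp (- (real n)\<^sup>2 * t) * sine_coeff f n) *\<^sub>R sine_mode n)"

definition reaction :: "real \<Rightarrow> real \<Rightarrow> (real \<Rightarrow> real) \<Rightarrow> real \<Rightarrow> real" where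
  "reaction lam b u = (\<lambda>x. lam * u x - b * (u x) ^ 3)"

text \<open>Mild solutions on \<open>[s,\<infinity>)\<close>; the values of \<open>u\<close> before time \<open>s\<close> are irrelevant.\<close>

definition mild_solution ::
  "real \<Rightarrow> (real \<Rightarrow> real) \<Rightarrow> real \<Rightarrow> h10 \<Rightarrow> (real \<Rightarrow> h10) \<Rightarrow> bool" where
  "mild_solution lam \<beta> s u0 u \<longleftrightarrow>
     continuous_on {s..} u \<and>
     (\<forall>t\<ge>s. ((\<lambda>r. heat_semigroup (t - r) (reaction lam (\<beta> r) (h10_fun (u r))))
               has_integral (u t - heat_semigroup (t - s) (h10_fun u0))) {s..t})"

definition evolution :: "real \<Rightarrow> (real \<Rightarrow> real) \<Rightarrow> real \<Rightarrow> real \<Rightarrow> h10 \<Rightarrow> h10" where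
  "evolution lam \<beta> t s u0 = (THE w. \<exists>u. mild_solution lam \<beta> s u0 u \<and> u t = w)"

definition global_solution :: "real \<Rightarrow> (real \<Rightarrow> real) \<Rightarrow> (real \<Rightarrow> h10) \<Rightarrow> bool" where
  "global_solution lam \<beta> \<xi> \<longleftrightarrow>
     continuous_on UNIV \<xi> \<and> (\<forall>s t. s \<le> t \<longrightarrow> evolution lam \<beta> t s (\<xi> s) = \<xi> t)"

section \<open>Autonomous and non-autonomous equilibria\<close>

text \<open>Continuity on the closed interval and the boundary conditions are part of the type \<open>h10\<close>.\<close>

definition stationary_solution :: "real \<Rightarrow> real \<Rightarrow> h10 \<Rightarrow> bool" where
  "stationary_solution lam b \<phi> \<longleftrightarrow>
     (\<exists>\<phi>' \<phi>''. \<forall>x\<in>{0<..<pi}.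
        (h10_fun \<phi> has_real_derivative \<phi>' x) (at x) \<and>
        (\<phi>' has_real_derivative \<phi>'' x) (at x) \<and>
        \<phi>'' x + lam * h10_fun \<phi> x - b * (h10_fun \<phi> x) ^ 3 = 0)"

definition phi_plus :: "real \<Rightarrow> real \<Rightarrow> nat \<Rightarrow> h10" where
  "phi_plus lam b j = (THE \<phi>. stationary_solution lam b \<phi> \<and>
     {x\<in>{0..pi}. h10_fun \<phi> x = 0} = {real i * pi / real j | i. i \<le> j} \<and>
     (\<forall>x\<in>{0<..<pi / real j}. h10_fun \<phi> x > 0))"

definition phi_minus :: "real \<Rightarrow> real \<Rightarrow> nat \<Rightarrow> h10" where
  "phi_minus lam b j = - phi_plus lam b j"

text \<open>The argument \<open>b\<close> is the positive lower bound of \<open>\<beta>\<close>.\<close>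

definition xi_plus :: "real \<Rightarrow> (real \<Rightarrow> real) \<Rightarrow> real \<Rightarrow> nat \<Rightarrow> real \<Rightarrow> h10" where
  "xi_plus lam \<beta> b j t = Lim at_bot (\<lambda>s. evolution lam \<beta> t s (phi_plus lam b j))"

definition xi_minus :: "real \<Rightarrow> (real \<Rightarrow> real) \<Rightarrow> real \<Rightarrow> nat \<Rightarrow> real \<Rightarrow> h10" where
  "xi_minus lam \<beta> b j t = Lim at_bot (\<lambda>s. evolution lam \<beta> t s (phi_minus lam b j))"

end

theory Submission
  imports Defs
begin

text \<open>The odd \<open>2\<pi>\<close>-periodic extension commutes with the odd nonlinearity, so the dilation
  \<open>u(x, t) = v(j x, j\<^sup>2 t)\<close> turns positive solutions \<open>v\<close> for \<open>\<lambda> / j\<^sup>2\<close> and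
  \<open>\<beta>(t / j\<^sup>2) / j\<^sup>2\<close> into solutions with the zeros of the \<open>j\<close>-th mode. This leaves the case
  \<open>j = 1\<close>, \<open>\<lambda> > 1\<close>, where the comparison principle is available. There the positive stationary
  solution \<open>\<phi>\<close> for the constant coefficient \<open>\<beta>\<^sub>1\<close> is a supersolution, which gives \<open>\<xi>\<close> as a decreasing pullback limit, and
  \<open>a(t) sin x\<close> with \<open>a\<close> a logistic function vanishing at \<open>-\<infinity>\<close> is a subsolution, which gives
  \<open>\<zeta>\<close> as an increasing pullback limit with \<open>a(t) sin x \<le> \<zeta>(t) \<le> exp((\<lambda> - 1) t) sin x\<close>.
  Forward in time the largest \<open>\<theta>\<close> with \<open>\<theta> \<xi> \<le> \<zeta> \<le> \<xi>\<close> increases to 1 geometrically, since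
  \<open>\<theta> \<xi>\<close> is a strict subsolution for \<open>0 < \<theta> < 1\<close>. The same contraction gives the uniqueness
  of the positive stationary solution.\<close>

section \<open>Products and pointwise bounds\<close>

text \<open>Evolution is defined by mild solutions, whereas sub- and supersolutions are differential
  objects. The bridge is \<open>lin_sol\<close>: an inhomogeneous heat equation is stated as one
  scalar ODE per sine coefficient, Duhamel's formula recovers the mild form, and the maximum
  principle is inherited from finite sine sums. Monotone families are controlled only in mean or
  uniformly, but every limit in the statement is taken in the norm of \<open>h10\<close>. Parabolic
  smoothing closes this gap: one unit of time turns a mean bound into a uniform bound, another one
  turns that into a norm bound. The lower barrier rests on \<open>sin^3 x \<le> sin x\<close>, which
  reduces the subsolution condition to an ODE for the amplitude. The contraction rate comes from an
  exact two-mode solution, as \<open>sin^3 x\<close> is a combination of \<open>sin x\<close> and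
  \<open>sin 3x\<close>. Since \<open>phi_plus\<close> is a definite description, existence and
  uniqueness of the positive stationary solution are both required. Existence is a pullback limit
  for constant \<open>\<beta>\<close>, where translation in time makes the limit constant.\<close>

text \<open>Fubini on the square with side \<open>{0..x}\<close>, cut along its diagonal. This is
  integration by parts for absolutely continuous functions, the source of both the product rule and
  \<open>inner_sine_mode\<close>.\<close>

lemma primitive_product:
  fixes f g :: "real \<Rightarrow> real"
  assumes f: "set_integrable lborel {0..x} f" and g: "set_integrable lborel {0..x} g"
  shows "(LINT y:{0..x}|lborel. f y * (LINT z:{0..y}|lborel. g z)) +
         (LINT z:{0..x}|lborel. (LINT y:{0..z}|lborel. f y) * g z) =
         (LINT y:{0..x}|lborel. f y) * (LINT z:{0..x}|lborel. g z)"
proof -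
  define F where "F = (\<lambda>y. indicator {0..x} y * f y)"
  define G where "G = (\<lambda>y. indicator {0..x} y * g y)"
  have F: "integrable lborel F" and G: "integrable lborel G"
    using f g by (simp_all add: F_def G_def set_integrable_def)
  have Fm [measurable]: "F \<in> borel_measurable borel" and Gm [measurable]: "G \<in> borel_measurable borel"
    using F G borel_measurable_integrable by fastforce+
  let ?P = "lborel \<Otimes>\<^sub>M lborel :: (real \<times> real) measure"
  let ?A = "{p. snd p \<le> fst p} :: (real \<times> real) set"
  have A [measurable]: "?A \<in> sets (borel \<Otimes>\<^sub>M borel)"
    by (simp only: borel_prod) (intro borel_closed closed_Collect_le continuous_intros)
  have prod: "integrable ?P (\<lambda>(y, z). F y * G z)"
  proof (rule lborel_pair.Fubini_integrable)
    show "integrable lborel (\<lambda>x. LINT y|lborel. norm (case (x, y) of (y, z) \<Rightarrow> F y * G z))"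
      using F by (simp add: abs_mult)
    show "AE x in lborel. integrable lborel (\<lambda>y. case (x, y) of (y, z) \<Rightarrow> F y * G z)"
      using G by simp
  qed simp
  have H1: "integrable ?P (\<lambda>(y, z). indicator ?A (y, z) * (F y * G z))"
    using integrable_mult_indicator[OF _ prod, of ?A] A by (simp add: case_prod_beta')
  have H2: "integrable ?P (\<lambda>(y, z). indicator (- ?A) (y, z) * (F y * G z))"
    using integrable_mult_indicator[OF _ prod, of "- ?A"] A
    sets.compl_sets[OF A] by (simp add: case_prod_beta' Compl_eq_Diff_UNIV space_pair_measure)
  have 1: "(LINT y|lborel. LINT z|lborel. indicator ?A (y, z) * (F y * G z)) =
    (LINT y:{0..x}|lborel. f y * (LINT z:{0..y}|lborel. g z))"
    unfolding set_lebesgue_integral_def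
  proof (intro Bochner_Integration.integral_cong refl)
    fix y :: real
    have "(LINT z|lborel. indicator ?A (y, z) * (F y * G z)) =
       (LINT z|lborel. indicator {0..x} y * f y * (indicator {0..y} z *\<^sub>R g z))"
      by (intro Bochner_Integration.integral_cong) (auto simp: F_def G_def indicator_def)
    then show "(LINT z|lborel. indicator ?A (y, z) * (F y * G z)) =
      indicat_real {0..x} y *\<^sub>R (f y * (LINT z|lborel. indicat_real {0..y} z *\<^sub>R g z))"
      by simp
  qed
  have 2: "(LINT z|lborel. LINT y|lborel. indicator (- ?A) (y, z) * (F y * G z)) =
    (LINT z:{0..x}|lborel. (LINT y:{0..z}|lborel. f y) * g z)"
    unfolding set_lebesgue_integral_def
  proof (intro Bochner_Integration.integral_cong refl)
    fix z :: real
    have "(LINT y|lborel. indicator (- ?A) (y, z) * (F y * G z)) =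
       (LINT y|lborel. indicator {0..x} z * g z * (indicator {0..z} y *\<^sub>R F y))"
    \<comment> \<open>The complement of \<open>?A\<close> is \<open>y < z\<close>, whereas
      \<open>{0..z}\<close> contains \<open>z\<close>; the integrands differ only on the null set
      \<open>y = z\<close>.\<close>
    proof (rule integral_cong_AE)
      show "AE y in lborel. indicator (- ?A) (y, z) * (F y * G z) =
        indicator {0..x} z * g z * (indicator {0..z} y *\<^sub>R F y)"
        using AE_lborel_singleton[of z]
        by eventually_elim (auto simp: F_def G_def indicator_def)
    qed simp_all
    also have "\<dots> = (LINT y|lborel. indicator {0..x} z * g z * (indicator {0..z} y *\<^sub>R f y))"
      by (intro Bochner_Integration.integral_cong) (auto simp: F_def indicator_def)
    finally show "(LINT y|lborel. indicator (- ?A) (y, z) * (F y * G z)) =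
      indicat_real {0..x} z *\<^sub>R ((LINT y|lborel. indicat_real {0..z} y *\<^sub>R f y) * g z)"
      by simp
  qed
  have "(LINT y:{0..x}|lborel. f y) * (LINT z:{0..x}|lborel. g z) =
    (LINT y|lborel. F y) * (LINT z|lborel. G z)"
    by (simp add: F_def G_def set_lebesgue_integral_def)
  also have "\<dots> = (LINT p|?P. (\<lambda>(y, z). F y * G z) p)"
    using lborel_pair.integral_fst[of "\<lambda>y z. F y * G z"] prod by simp
  also have "\<dots> = (LINT p|?P. (\<lambda>(y, z). indicator ?A (y, z) * (F y * G z)) p +
      (\<lambda>(y, z). indicator (- ?A) (y, z) * (F y * G z)) p)"
    by (intro Bochner_Integration.integral_cong) (auto simp: indicator_def)
  also have "\<dots> = (LINT p|?P. (\<lambda>(y, z). indicator ?A (y, z) * (F y * G z)) p) +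
      (LINT p|?P. (\<lambda>(y, z). indicator (- ?A) (y, z) * (F y * G z)) p)"
    by (rule Bochner_Integration.integral_add[OF H1 H2])
  finally show ?thesis
    using lborel_pair.integral_fst[OF H1] lborel_pair.integral_snd[OF H2] 1 2 by simp
qed

lemma h10_fun_outside: "x \<notin> {0..pi} \<Longrightarrow> h10_fun u x = 0"
  using h10_fun[of u] by (auto simp: H10_set_def)

lemma h10_fun_0 [simp]: "h10_fun u 0 = 0" and h10_fun_pi [simp]: "h10_fun u pi = 0"
  using h10_fun[of u] by (auto simp: H10_set_def)

lemma h10_fun_add [simp]: "h10_fun (u + v) x = h10_fun u x + h10_fun v x"
  by (simp add: plus_h10.rep_eq)

lemma h10_fun_scale [simp]: "h10_fun (c *\<^sub>R u) x = c * h10_fun u x"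
  by (simp add: scaleR_h10.rep_eq)

lemma h10_fun_zero [simp]: "h10_fun 0 x = 0"
  by (simp add: zero_h10.rep_eq)

lemma h10_fun_minus [simp]: "h10_fun (- u) x = - h10_fun u x"
  using h10_fun_scale[of "-1" u x] by simp

lemma h10_fun_diff [simp]: "h10_fun (u - v) x = h10_fun u x - h10_fun v x"
  using h10_fun_add[of u "- v" x] by simp

lemma h10_eqI: "(\<And>x. x \<in> {0<..<pi} \<Longrightarrow> h10_fun u x = h10_fun v x) \<Longrightarrow> u = v"
proof -
  assume *: "\<And>x. x \<in> {0<..<pi} \<Longrightarrow> h10_fun u x = h10_fun v x"
  have "h10_fun u x = h10_fun v x" for x
  proof (cases "x \<in> {0<..<pi}")
    case False
    then have "x = 0 \<or> x = pi \<or> x \<notin> {0..pi}" by auto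
    then show ?thesis using h10_fun_outside by auto
  qed (use * in auto)
  then show ?thesis by (simp add: h10_fun_inject[symmetric] fun_eq_iff)
qed

lemma h10_fun_primitive:
  assumes "has_weak_deriv (h10_fun u) g" "x \<in> {0..pi}"
  shows "h10_fun u x = (LINT y:{0..x}|lborel. g y)"
  using assms unfolding has_weak_deriv_def by (metis add_0 h10_fun_0)

lemma L2_fun_square_integrable: "L2_fun g \<Longrightarrow> set_integrable lborel {0..pi} (\<lambda>x. (g x)\<^sup>2)"
  by (simp add: L2_fun_def)

lemma h10_norm_square: "has_weak_deriv (h10_fun u) g \<Longrightarrow> (norm u)\<^sup>2 = (LINT x:{0..pi}|lborel. (g x)\<^sup>2)"
  using inner_h10_eq[of u g u g] by (simp only: power2_norm_eq_inner) (simp add: power2_eq_square)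

lemma continuous_on_h10_fun: "continuous_on {0..pi} (h10_fun u)"
proof -
  let ?g = "weak_deriv (h10_fun u)"
  have g: "has_weak_deriv (h10_fun u) ?g" by (rule weak_deriv_h10)
  have L: "L2_fun ?g" using g by (rule has_weak_deriv_L2)
  have i: "?g integrable_on {0..pi}"
    using set_borel_integral_eq_integral(1)[OF L2_fun_integrable[OF L]] .
  have "continuous_on {0..pi} (\<lambda>x. integral {0..x} ?g)"
    by (rule indefinite_integral_continuous_1[OF i])
  moreover have "h10_fun u x = integral {0..x} ?g" if "x \<in> {0..pi}" for x
    using h10_fun_primitive[OF g that] set_borel_integral_eq_integral(2)[OF L2_fun_integrable_upto[OF L]] that
    by simp
  moreover have "continuous_on {0..pi} (h10_fun u) = continuous_on {0..pi} (\<lambda>x. integral {0..x} ?g)"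
    using calculation(2) by (intro continuous_on_cong refl)
  ultimately show ?thesis by blast
qed

lemma continuous_set_integrable:
  fixes f :: "real \<Rightarrow> real"
  shows "continuous_on {a..b} f \<Longrightarrow> set_integrable lborel {a..b} f"
  by (rule borel_integrable_atLeastAtMost')

lemma continuous_L2_fun:
  assumes "continuous_on {0..pi} f" shows "L2_fun f"
proof -
  have "set_integrable lborel {0..pi} f" "set_integrable lborel {0..pi} (\<lambda>x. (f x)\<^sup>2)"
    using assms by (auto intro!: continuous_set_integrable continuous_intros)
  then show ?thesis
    unfolding L2_fun_def set_borel_measurable_def set_integrable_def by auto
qed

text \<open>Young's inequality \<open>|g| \<le> (1 + g^2) / 2\<close> replaces Cauchy-Schwarz: for
  norm 1 it gives \<open>(pi + 1) / 2 < 3\<close>, and homogeneity does the rest. Evaluation at a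
  point is thereby a bounded functional.\<close>

lemma h10_fun_bound: "\<bar>h10_fun u x\<bar> \<le> 3 * norm u"
proof -
  have *: "\<bar>h10_fun v x\<bar> \<le> 3" if v: "norm v = 1" for v
  proof (cases "x \<in> {0..pi}")
    case True
    let ?g = "weak_deriv (h10_fun v)"
    have g: "has_weak_deriv (h10_fun v) ?g" by (rule weak_deriv_h10)
    have L: "L2_fun ?g" using g by (rule has_weak_deriv_L2)
    have i: "set_integrable lborel {0..pi} (\<lambda>y. (1 + (?g y)\<^sup>2) / 2)"
      using L2_fun_square_integrable[OF L] L2_fun_integrable[OF L2_fun_one]
      by (intro set_integrable_divide set_integral_add(1)) auto
    have ix: "set_integrable lborel {0..x} ?g"
      using True by (intro L2_fun_integrable_upto[OF L]) auto
    have "\<bar>h10_fun v x\<bar> = norm (LINT y:{0..x}|lborel. ?g y)"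
      using h10_fun_primitive[OF g True] by simp
    also have "\<dots> \<le> (LINT y:{0..x}|lborel. norm (?g y))"
      by (rule set_integral_norm_bound[OF ix])
    also have "\<dots> \<le> (LINT y:{0..pi}|lborel. (1 + (?g y)\<^sup>2) / 2)"
      unfolding set_lebesgue_integral_def
    proof (rule integral_mono)
      show "integrable lborel (\<lambda>y. indicat_real {0..x} y *\<^sub>R norm (?g y))"
        using set_integrable_norm[OF ix] by (simp add: set_integrable_def)
      show "integrable lborel (\<lambda>y. indicat_real {0..pi} y *\<^sub>R ((1 + (?g y)\<^sup>2) / 2))"
        using i by (simp add: set_integrable_def)
      fix y
      have "0 \<le> (\<bar>?g y\<bar> - 1)\<^sup>2" by simp
      then have "\<bar>?g y\<bar> \<le> (1 + (?g y)\<^sup>2) / 2" by (simp add: power2_diff)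
      then show "indicat_real {0..x} y *\<^sub>R norm (?g y) \<le> indicat_real {0..pi} y *\<^sub>R ((1 + (?g y)\<^sup>2) / 2)"
        using True by (auto simp: indicator_def)
    qed
    also have "\<dots> = (LINT y:{0..pi}|lborel. (1 + (?g y)\<^sup>2)) / 2"
      by simp
    also have "(LINT y:{0..pi}|lborel. (1 + (?g y)\<^sup>2)) = pi + (norm v)\<^sup>2"
      unfolding h10_norm_square[OF g]
      using L2_fun_square_integrable[OF L] L2_fun_integrable[OF L2_fun_one]
      by (subst set_integral_add(2)) (auto simp: set_lebesgue_integral_def)
    finally show ?thesis using v pi_less_4 by simp
  next
    case False
    then show ?thesis by (simp add: h10_fun_outside)
  qed
  show ?thesis
  proof (cases "u = 0")
    case False
    have "\<bar>h10_fun ((1 / norm u) *\<^sub>R u) x\<bar> \<le> 3"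
      using False by (intro *) simp
    then have "\<bar>h10_fun u x\<bar> / norm u \<le> 3" by (simp add: abs_mult)
    then show ?thesis using False by (simp add: pos_divide_le_eq)
  qed simp
qed

lemma bounded_linear_h10_fun: "bounded_linear (\<lambda>u. h10_fun u x)"
  by (rule bounded_linear_intro[where K = 3]) (use h10_fun_bound in \<open>auto simp: mult.commute\<close>)

lemmas tendsto_h10_fun = bounded_linear.tendsto[OF bounded_linear_h10_fun]
lemmas h10_fun_sum = linear_sum[OF bounded_linear.linear[OF bounded_linear_h10_fun]]

lemma L2_fun_mult_continuous:
  assumes g: "L2_fun g" and v: "continuous_on {0..pi} v" and b: "\<And>x. x \<in> {0..pi} \<Longrightarrow> \<bar>v x\<bar> \<le> B"
  shows "L2_fun (\<lambda>x. g x * v x)"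
    and "(LINT x:{0..pi}|lborel. (g x * v x)\<^sup>2) \<le> B\<^sup>2 * (LINT x:{0..pi}|lborel. (g x)\<^sup>2)"
proof -
  have m: "set_borel_measurable lborel {0..pi} (\<lambda>x. g x * v x)"
    using L2_fun_mult_integrable[OF g continuous_L2_fun[OF v]]
    unfolding set_borel_measurable_def set_integrable_def by auto
  have m2: "set_borel_measurable lborel {0..pi} (\<lambda>x. (g x * v x)\<^sup>2)"
  proof -
    have "(\<lambda>x. (indicat_real {0..pi} x *\<^sub>R (g x * v x))\<^sup>2) \<in> borel_measurable lborel"
      using m unfolding set_borel_measurable_def by (intro borel_measurable_power)
    moreover have "(\<lambda>x. (indicat_real {0..pi} x *\<^sub>R (g x * v x))\<^sup>2) = (\<lambda>x. indicat_real {0..pi} x *\<^sub>R (g x * v x)\<^sup>2)"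
      by (auto simp: indicator_def)
    ultimately show ?thesis unfolding set_borel_measurable_def by simp
  qed
  have le: "(g x * v x)\<^sup>2 \<le> B\<^sup>2 * (g x)\<^sup>2" if "x \<in> {0..pi}" for x
  proof -
    have "(v x)\<^sup>2 \<le> B\<^sup>2" using b[OF that] by (intro power2_le_iff_abs_le[THEN iffD2]) auto
    then show ?thesis by (simp add: power_mult_distrib mult.commute[of "B\<^sup>2"] mult_left_mono)
  qed
  have i: "set_integrable lborel {0..pi} (\<lambda>x. B\<^sup>2 * (g x)\<^sup>2)"
    using L2_fun_square_integrable[OF g] by simp
  have i2: "set_integrable lborel {0..pi} (\<lambda>x. (g x * v x)\<^sup>2)"
    using le by (intro set_integrable_bound[OF i m2]) auto
  show "L2_fun (\<lambda>x. g x * v x)" using m i2 by (simp add: L2_fun_def)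
  have "(LINT x:{0..pi}|lborel. (g x * v x)\<^sup>2) \<le> (LINT x:{0..pi}|lborel. B\<^sup>2 * (g x)\<^sup>2)"
    using le by (intro set_integral_mono i i2)
  then show "(LINT x:{0..pi}|lborel. (g x * v x)\<^sup>2) \<le> B\<^sup>2 * (LINT x:{0..pi}|lborel. (g x)\<^sup>2)"
    by simp
qed

section \<open>Products of elements of \<open>h10\<close>\<close>

text \<open>Both factors are primitives that vanish at 0, so \<open>primitive_product\<close> is
  exactly the product rule.\<close>

lemma has_weak_deriv_mult:
  assumes u: "has_weak_deriv (h10_fun u) f" and v: "has_weak_deriv (h10_fun v) g"
  shows "has_weak_deriv (\<lambda>x. h10_fun u x * h10_fun v x) (\<lambda>x. f x * h10_fun v x + g x * h10_fun u x)"
  unfolding has_weak_deriv_def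
proof (intro conjI ballI)
  note L = has_weak_deriv_L2[OF u] has_weak_deriv_L2[OF v]
  have L1: "L2_fun (\<lambda>x. f x * h10_fun v x)" and L2: "L2_fun (\<lambda>x. g x * h10_fun u x)"
    using L h10_fun_bound by (auto intro!: L2_fun_mult_continuous(1) continuous_on_h10_fun)
  then show "L2_fun (\<lambda>x. f x * h10_fun v x + g x * h10_fun u x)" by (rule L2_fun_add)
  fix x :: real assume x: "x \<in> {0..pi}"
  have "(LINT y:{0..x}|lborel. f y * h10_fun v y + g y * h10_fun u y) =
     (LINT y:{0..x}|lborel. f y * h10_fun v y) + (LINT y:{0..x}|lborel. g y * h10_fun u y)"
    using L1 L2 x by (intro set_integral_add(2) L2_fun_integrable_upto) auto
  also have "(LINT y:{0..x}|lborel. f y * h10_fun v y) = (LINT y:{0..x}|lborel. f y * (LINT z:{0..y}|lborel. g z))"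
    by (intro set_lebesgue_integral_cong) (use x h10_fun_primitive[OF v] in auto)
  also have "(LINT y:{0..x}|lborel. g y * h10_fun u y) = (LINT z:{0..x}|lborel. (LINT y:{0..z}|lborel. f y) * g z)"
    by (intro set_lebesgue_integral_cong) (use x h10_fun_primitive[OF u] in \<open>auto simp: mult.commute\<close>)
  also have "(LINT y:{0..x}|lborel. f y * (LINT z:{0..y}|lborel. g z)) + \<dots> = h10_fun u x * h10_fun v x"
    unfolding h10_fun_primitive[OF u x] h10_fun_primitive[OF v x]
    using x L by (intro primitive_product L2_fun_integrable_upto) auto
  finally show "h10_fun u x * h10_fun v x = h10_fun u 0 * h10_fun v 0 + (LINT y:{0..x}|lborel. f y * h10_fun v y + g y * h10_fun u y)"
    by simp
qed

text \<open>In one dimension the space is an algebra. This keeps the cubic term inside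
  \<open>h10\<close>, where it depends continuously on its argument and the semigroup acts on
  it.\<close>

lift_definition h10_mult :: "h10 \<Rightarrow> h10 \<Rightarrow> h10" is "\<lambda>u v x. u x * v x"
proof -
  fix u v :: "real \<Rightarrow> real" assume "u \<in> H10_set" "v \<in> H10_set"
  then obtain U V where UV: "u = h10_fun U" "v = h10_fun V" by (metis Abs_h10_inverse)
  have "has_weak_deriv (\<lambda>x. u x * v x) (\<lambda>x. weak_deriv u x * v x + weak_deriv v x * u x)"
    unfolding UV by (intro has_weak_deriv_mult weak_deriv_h10)
  then show "(\<lambda>x. u x * v x) \<in> H10_set"
    unfolding H10_set_def by (auto simp: UV h10_fun_outside)
qed

lemma h10_fun_mult [simp]: "h10_fun (h10_mult u v) x = h10_fun u x * h10_fun v x"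
  by (simp add: h10_mult.rep_eq)

text \<open>The constant 6: the square of a sum is at most twice the sum of the squares, and each
  term carries the factor \<open>3^2\<close> from \<open>h10_fun_bound\<close>, so
  \<open>2 * 9 + 2 * 9 = 6^2\<close>.\<close>

lemma norm_h10_mult: "norm (h10_mult u v) \<le> norm u * norm v * 6"
proof -
  let ?f = "weak_deriv (h10_fun u)" and ?g = "weak_deriv (h10_fun v)"
  have u: "has_weak_deriv (h10_fun u) ?f" and v: "has_weak_deriv (h10_fun v) ?g"
    by (rule weak_deriv_h10)+
  note L = has_weak_deriv_L2[OF u] has_weak_deriv_L2[OF v]
  have b: "\<bar>h10_fun w x\<bar> \<le> 3 * norm w" for w x by (rule h10_fun_bound)
  note L1 = L2_fun_mult_continuous[OF L(1) continuous_on_h10_fun[of v] b]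
  note L2 = L2_fun_mult_continuous[OF L(2) continuous_on_h10_fun[of u] b]
  have w: "has_weak_deriv (h10_fun (h10_mult u v)) (\<lambda>x. ?f x * h10_fun v x + ?g x * h10_fun u x)"
    using has_weak_deriv_mult[OF u v] by (simp add: h10_mult.rep_eq)
  have aux: "(a + b)\<^sup>2 \<le> 2 * a\<^sup>2 + 2 * b\<^sup>2" for a b :: real
  proof -
    have "0 \<le> (a - b)\<^sup>2" by simp
    then show ?thesis unfolding power2_sum power2_diff by linarith
  qed
  have "(norm (h10_mult u v))\<^sup>2 = (LINT x:{0..pi}|lborel. (?f x * h10_fun v x + ?g x * h10_fun u x)\<^sup>2)"
    by (rule h10_norm_square[OF w])
  also have "\<dots> \<le> (LINT x:{0..pi}|lborel. 2 * (?f x * h10_fun v x)\<^sup>2 + 2 * (?g x * h10_fun u x)\<^sup>2)"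
  proof (rule set_integral_mono)
    show "set_integrable lborel {0..pi} (\<lambda>x. (?f x * h10_fun v x + ?g x * h10_fun u x)\<^sup>2)"
      by (rule L2_fun_square_integrable[OF has_weak_deriv_L2[OF w]])
    show "set_integrable lborel {0..pi} (\<lambda>x. 2 * (?f x * h10_fun v x)\<^sup>2 + 2 * (?g x * h10_fun u x)\<^sup>2)"
      using L1(1) L2(1) by (intro set_integral_add(1) set_integrable_mult_right L2_fun_square_integrable)
    show "(?f x * h10_fun v x + ?g x * h10_fun u x)\<^sup>2 \<le> 2 * (?f x * h10_fun v x)\<^sup>2 + 2 * (?g x * h10_fun u x)\<^sup>2" for x
      by (rule aux)
  qed
  also have "\<dots> = 2 * (LINT x:{0..pi}|lborel. (?f x * h10_fun v x)\<^sup>2) + 2 * (LINT x:{0..pi}|lborel. (?g x * h10_fun u x)\<^sup>2)"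
    using L1(1) L2(1)
    by (subst set_integral_add(2)) (auto intro!: L2_fun_square_integrable)
  also have "\<dots> \<le> 2 * ((3 * norm v)\<^sup>2 * (norm u)\<^sup>2) + 2 * ((3 * norm u)\<^sup>2 * (norm v)\<^sup>2)"
    using L1(2) L2(2) unfolding h10_norm_square[OF u, symmetric] h10_norm_square[OF v, symmetric]
    by (intro add_mono mult_left_mono) auto
  also have "\<dots> \<le> (norm u * norm v * 6)\<^sup>2"
    by (simp add: power_mult_distrib)
  finally show ?thesis
    by (rule power2_le_imp_le) simp
qed

lemma bounded_bilinear_h10_mult: "bounded_bilinear h10_mult"
proof
  show "\<exists>K. \<forall>a b. norm (h10_mult a b) \<le> norm a * norm b * K"
    using norm_h10_mult by blast
qed (auto intro!: h10_eqI simp: algebra_simps)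

lemmas continuous_on_h10_mult = bounded_bilinear.continuous_on[OF bounded_bilinear_h10_mult]

lemma C1_has_weak_deriv:
  assumes d: "\<And>x. x \<in> {0..pi} \<Longrightarrow> (f has_real_derivative g x) (at x within {0..pi})"
    and g: "continuous_on {0..pi} g"
  shows "has_weak_deriv (\<lambda>x. if x \<in> {0..pi} then f x else 0) g"
  unfolding has_weak_deriv_def
proof (intro conjI ballI)
  show "L2_fun g" using g by (rule continuous_L2_fun)
  fix x :: real assume x: "x \<in> {0..pi}"
  have "(g has_integral (f x - f 0)) {0..x}"
  proof (rule fundamental_theorem_of_calculus)
    show "(f has_vector_derivative g y) (at y within {0..x})" if "y \<in> {0..x}" for y
      using d[of y] that x
      by (auto simp: has_real_derivative_iff_has_vector_derivative[symmetric] intro: DERIV_subset)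
  qed (use x in auto)
  moreover have "set_integrable lborel {0..x} g"
    using x by (intro continuous_set_integrable continuous_on_subset[OF g]) auto
  ultimately have "(LINT y:{0..x}|lborel. g y) = f x - f 0"
    using set_borel_integral_eq_integral(2) integral_unique by metis
  then show "(if x \<in> {0..pi} then f x else 0) = (if 0 \<in> {0..pi} then f 0 else 0) + (LINT y:{0..x}|lborel. g y)"
    using x by simp
qed

lemma C1_h10:
  assumes "\<And>x. x \<in> {0..pi} \<Longrightarrow> (f has_real_derivative g x) (at x within {0..pi})"
    and "continuous_on {0..pi} g" "f 0 = 0" "f pi = 0"
  obtains u where "\<And>x. x \<in> {0..pi} \<Longrightarrow> h10_fun u x = f x" "has_weak_deriv (h10_fun u) g"
proof -
  let ?f = "\<lambda>x. if x \<in> {0..pi} then f x else 0"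
  have w: "has_weak_deriv ?f g" using assms by (intro C1_has_weak_deriv)
  have "?f \<in> H10_set" using w assms unfolding H10_set_def by auto
  then have "h10_fun (Abs_h10 ?f) = ?f" by (rule Abs_h10_inverse)
  then show ?thesis using w by (intro that[of "Abs_h10 ?f"]) auto
qed

section \<open>Completeness\<close>

lemma L2_fun_diff: "L2_fun f \<Longrightarrow> L2_fun g \<Longrightarrow> L2_fun (\<lambda>x. f x - g x)"
  using L2_fun_add[of f "\<lambda>x. (-1) * g x"] L2_fun_scale[of g "-1"] by simp

lemma has_weak_deriv_diff:
  "has_weak_deriv (h10_fun u) f \<Longrightarrow> has_weak_deriv (h10_fun v) g \<Longrightarrow>
    has_weak_deriv (h10_fun (u - v)) (\<lambda>x. f x - g x)"
  using has_weak_deriv_add[of "h10_fun u" f "\<lambda>x. (-1) * h10_fun v x" "\<lambda>x. (-1) * g x"]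
    has_weak_deriv_scale[of "h10_fun v" g "-1"]
  by (simp add: fun_eq_iff[symmetric] has_weak_deriv_def)

text \<open>Young's inequality with a free weight \<open>c\<close>; each use tunes \<open>c\<close>
  to balance the two terms.\<close>

lemma L1_le_L2:
  assumes g: "L2_fun g" and c: "0 < c"
  shows "(LINT x:{0..pi}|lborel. \<bar>g x\<bar>) \<le> (c * (LINT x:{0..pi}|lborel. (g x)\<^sup>2) + pi / c) / 2"
proof -
  have "(LINT x:{0..pi}|lborel. \<bar>g x\<bar>) \<le> (LINT x:{0..pi}|lborel. (c / 2 * (g x)\<^sup>2 + 1 / (2 * c) * 1))"
  proof (rule set_integral_mono)
    show "set_integrable lborel {0..pi} (\<lambda>x. \<bar>g x\<bar>)"
      using L2_fun_integrable[OF g] by (rule set_integrable_abs)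
    show "set_integrable lborel {0..pi} (\<lambda>x. c / 2 * (g x)\<^sup>2 + 1 / (2 * c) * 1)"
      using L2_fun_square_integrable[OF g] L2_fun_integrable[OF L2_fun_one]
      by (intro set_integral_add(1) set_integrable_mult_right)
    fix x
    have "0 \<le> (c * \<bar>g x\<bar> - 1)\<^sup>2 / c" using c by simp
    then show "\<bar>g x\<bar> \<le> c / 2 * (g x)\<^sup>2 + 1 / (2 * c) * 1"
      using c by (simp add: power2_diff power_mult_distrib field_simps power2_eq_square)
  qed
  also have "\<dots> = c / 2 * (LINT x:{0..pi}|lborel. (g x)\<^sup>2) + 1 / (2 * c) * (LINT x:{0..pi}|lborel. 1)"
    using L2_fun_square_integrable[OF g] L2_fun_integrable[OF L2_fun_one]
    by (subst set_integral_add(2)) auto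
  finally show ?thesis using c by (simp add: set_lebesgue_integral_def field_simps)
qed

text \<open>The Riesz-Fischer argument: a rapidly convergent subsequence converges almost everywhere
  because its \<open>L^1\<close> increments are summable, and Fatou's lemma carries the Cauchy
  estimate over to the limit.\<close>

lemma L2_fun_limit:
  fixes g :: "nat \<Rightarrow> real \<Rightarrow> real"
  assumes L: "\<And>k. L2_fun (g k)"
    and cauchy: "\<And>e. 0 < e \<Longrightarrow> \<exists>N. \<forall>m\<ge>N. \<forall>n\<ge>N. (LINT x:{0..pi}|lborel. (g m x - g n x)\<^sup>2) < e"
  obtains G where "L2_fun G" "(\<lambda>k. LINT x:{0..pi}|lborel. (G x - g k x)\<^sup>2) \<longlonglongrightarrow> 0"
proof -
  let ?E = "\<lambda>m n. LINT x:{0..pi}|lborel. (g m x - g n x)\<^sup>2"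
  have "\<exists>N. \<forall>m\<ge>N. \<forall>n\<ge>N. ?E m n < (1 / 4) ^ k" for k
    using cauchy[of "(1 / 4) ^ k"] by simp
  then obtain N where N: "\<And>k m n. N k \<le> m \<Longrightarrow> N k \<le> n \<Longrightarrow> ?E m n < (1 / 4) ^ k"
    by metis
  \<comment> \<open>Summing the thresholds makes \<open>r\<close> strictly increasing while still
    \<open>N k \<le> r k\<close>.\<close>
  define r where "r k = (\<Sum>i\<le>k. N i + 1)" for k
  have rN: "N k \<le> r k" for k
    unfolding r_def by (rule order_trans[OF _ member_le_sum[of k]]) auto
  have rS: "r k < r (Suc k)" for k by (simp add: r_def)
  have rmono: "strict_mono r" using rS by (rule strict_monoI_Suc)
  define d where "d k = (\<lambda>x. indicator {0..pi} x * (g (r (Suc k)) x - g (r k) x))" for k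
  have Ld: "L2_fun (\<lambda>x. g (r (Suc k)) x - g (r k) x)" for k
    by (intro L2_fun_diff L)
  have di: "integrable lborel (d k)" for k
    using L2_fun_integrable[OF Ld[of k]] by (simp add: d_def set_integrable_def)
  have gm [measurable]: "(\<lambda>x. indicator {0..pi} x * g k x) \<in> borel_measurable lborel" for k
    using L2_fun_integrable[OF L[of k]] unfolding set_integrable_def by auto
  have dn: "(LINT x|lborel. norm (d k x)) \<le> 3 * (1 / 2) ^ k" for k
  proof -
    have "(LINT x|lborel. norm (d k x)) = (LINT x:{0..pi}|lborel. \<bar>g (r (Suc k)) x - g (r k) x\<bar>)"
      unfolding set_lebesgue_integral_def d_def
      by (intro Bochner_Integration.integral_cong) (auto simp: indicator_def)
    \<comment> \<open>The weight \<open>2 ^ k\<close> matches the bound \<open>(1 / 4) ^ k\<close>: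
      both terms become of order \<open>(1 / 2) ^ k\<close>.\<close>
    also have "\<dots> \<le> (2 ^ k * ?E (r (Suc k)) (r k) + pi / 2 ^ k) / 2"
      by (rule L1_le_L2[OF Ld]) simp
    also have "\<dots> \<le> (2 ^ k * (1 / 4) ^ k + 4 / 2 ^ k) / 2"
      using N[of k "r (Suc k)" "r k"] rN[of k] rS[of k] pi_less_4
      by (intro divide_right_mono add_mono mult_left_mono) auto
    also have "(2::real) ^ k * (1 / 4) ^ k = (1 / 2) ^ k"
      by (simp flip: power_mult_distrib)
    also have "((1 / 2) ^ k + 4 / 2 ^ k) / 2 \<le> 3 * (1 / 2 :: real) ^ k"
      by (simp add: power_divide field_simps)
    finally show ?thesis .
  qed
  have AEs: "AE x in lborel. summable (\<lambda>k. norm (d k x))"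
  proof -
    have "(\<integral>\<^sup>+x. (\<Sum>k. ennreal (norm (d k x))) \<partial>lborel) = (\<Sum>k. \<integral>\<^sup>+x. ennreal (norm (d k x)) \<partial>lborel)"
      using di by (intro nn_integral_suminf) auto
    also have "\<dots> = (\<Sum>k. ennreal (LINT x|lborel. norm (d k x)))"
      using di by (intro suminf_cong nn_integral_eq_integral) auto
    also have "\<dots> \<le> (\<Sum>k. ennreal (3 * (1 / 2) ^ k))"
      using dn by (intro suminf_le ennreal_leI) auto
    also have "\<dots> = ennreal (\<Sum>k. 3 * (1 / 2) ^ k)"
      by (intro suminf_ennreal2 summable_mult summable_geometric) auto
    also have "\<dots> < \<infinity>" by simp
    finally have fin: "(\<integral>\<^sup>+x. (\<Sum>k. ennreal (norm (d k x))) \<partial>lborel) \<noteq> \<infinity>" by simp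
    have "AE x in lborel. (\<Sum>k. ennreal (norm (d k x))) \<noteq> \<infinity>"
      using di by (intro nn_integral_PInf_AE fin) auto
    then show ?thesis
      by eventually_elim (auto intro!: summable_suminf_not_top)
  qed
  define G where "G x = indicator {0..pi} x * g (r 0) x + (\<Sum>k. d k x)" for x
  have Gm [measurable]: "G \<in> borel_measurable lborel"
  proof -
    have "(\<lambda>x. \<Sum>k. d k x) \<in> borel_measurable lborel"
      using di by (intro borel_measurable_suminf) auto
    then show ?thesis unfolding G_def by measurable
  qed
  have tele: "indicator {0..pi} x * g (r 0) x + (\<Sum>k<m. d k x) = indicator {0..pi} x * g (r m) x" for m x
  proof (induction m)
    case (Suc m)
    have "d m x = indicator {0..pi} x * g (r (Suc m)) x - indicator {0..pi} x * g (r m) x"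
      unfolding d_def by (rule right_diff_distrib)
    then show ?case unfolding sum.lessThan_Suc using Suc by linarith
  qed simp
  have lim: "AE x in lborel. (\<lambda>m. indicator {0..pi} x * g (r m) x) \<longlonglongrightarrow> G x"
    using AEs
  proof eventually_elim
    fix x assume "summable (\<lambda>k. norm (d k x))"
    then have "(\<lambda>m. \<Sum>k<m. d k x) \<longlonglongrightarrow> (\<Sum>k. d k x)"
      by (rule summable_LIMSEQ[OF summable_norm_cancel])
    then have "(\<lambda>m. indicator {0..pi} x * g (r 0) x + (\<Sum>k<m. d k x)) \<longlonglongrightarrow> G x"
      unfolding G_def by (intro tendsto_add tendsto_const)
    then show "(\<lambda>m. indicator {0..pi} x * g (r m) x) \<longlonglongrightarrow> G x"
      by (simp add: tele)
  qed
  have G0: "AE x in lborel. G x = indicator {0..pi} x * G x"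
    using lim
  proof eventually_elim
    fix x assume "(\<lambda>m. indicator {0..pi} x * g (r m) x) \<longlonglongrightarrow> G x"
    then show "G x = indicator {0..pi} x * G x"
      by (cases "x \<in> {0..pi}") (auto simp: LIMSEQ_const_iff)
  qed
  \<comment> \<open>Fatou is applied with \<open>k\<close> fixed and \<open>m\<close> running along
    the subsequence \<open>r\<close>.\<close>
  have fatou: "(\<integral>\<^sup>+x. ennreal (indicator {0..pi} x * (G x - g k x)\<^sup>2) \<partial>lborel) \<le> ennreal e"
    if e: "0 \<le> e" and le: "\<forall>\<^sub>F m in sequentially. ?E m k \<le> e" for k e
  proof -
    let ?u = "\<lambda>m x. ennreal ((indicator {0..pi} x * g (r m) x - indicator {0..pi} x * g k x)\<^sup>2)"
    have u: "integral\<^sup>N lborel (?u m) = ennreal (?E (r m) k)" for m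
    proof -
      have i: "set_integrable lborel {0..pi} (\<lambda>x. (g (r m) x - g k x)\<^sup>2)"
        by (intro L2_fun_square_integrable L2_fun_diff L)
      have eq: "(indicator {0..pi} x * g (r m) x - indicator {0..pi} x * g k x)\<^sup>2 =
          indicator {0..pi} x *\<^sub>R (g (r m) x - g k x)\<^sup>2" for x
        by (auto simp: indicator_def)
      show ?thesis
        unfolding eq set_lebesgue_integral_def
        using i by (intro nn_integral_eq_integral) (auto simp: set_integrable_def)
    qed
    have "(\<integral>\<^sup>+x. ennreal (indicator {0..pi} x * (G x - g k x)\<^sup>2) \<partial>lborel) = (\<integral>\<^sup>+x. liminf (\<lambda>m. ?u m x) \<partial>lborel)"
    proof (rule nn_integral_cong_AE)
      show "AE x in lborel. ennreal (indicator {0..pi} x * (G x - g k x)\<^sup>2) = liminf (\<lambda>m. ?u m x)"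
        using lim G0
      proof eventually_elim
        fix x assume l: "(\<lambda>m. indicator {0..pi} x * g (r m) x) \<longlonglongrightarrow> G x" and G: "G x = indicator {0..pi} x * G x"
        have l2: "(\<lambda>m. ?u m x) \<longlonglongrightarrow> ennreal ((G x - indicator {0..pi} x * g k x)\<^sup>2)"
          by (intro tendsto_ennrealI tendsto_power tendsto_diff tendsto_const l)
        have e: "(G x - indicator {0..pi} x * g k x)\<^sup>2 = indicator {0..pi} x * (G x - g k x)\<^sup>2"
          using G by (auto simp: indicator_def split: if_splits)
        show "ennreal (indicator {0..pi} x * (G x - g k x)\<^sup>2) = liminf (\<lambda>m. ?u m x)"
          unfolding e[symmetric] by (rule lim_imp_Liminf[OF trivial_limit_sequentially l2, symmetric])
      qed
    qed
    also have "\<dots> \<le> liminf (\<lambda>m. integral\<^sup>N lborel (?u m))"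
      by (intro nn_integral_liminf) measurable
    also have "\<dots> = liminf (\<lambda>m. ennreal (?E (r m) k))" by (simp only: u)
    also have "\<dots> \<le> ennreal e"
    proof -
      have "\<forall>\<^sub>F m in sequentially. ennreal (?E (r m) k) \<le> ennreal e"
        using eventually_subseq[OF rmono le] by eventually_elim (rule ennreal_leI)
      then have "liminf (\<lambda>m. ennreal (?E (r m) k)) \<le> limsup (\<lambda>m. ennreal (?E (r m) k)) \<and>
          limsup (\<lambda>m. ennreal (?E (r m) k)) \<le> ennreal e"
        by (auto intro: Liminf_le_Limsup Limsup_bounded)
      then show ?thesis by auto
    qed
    finally show ?thesis .
  qed
  have diffL: "L2_fun (\<lambda>x. G x - g k x)" and diffE: "(LINT x:{0..pi}|lborel. (G x - g k x)\<^sup>2) \<le> e"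
    if e: "0 \<le> e" and le: "\<forall>\<^sub>F m in sequentially. ?E m k \<le> e" for k e
  proof -
    have m: "(\<lambda>x. indicator {0..pi} x * (G x - g k x)) \<in> borel_measurable lborel"
      unfolding right_diff_distrib by measurable
    have "(\<lambda>x. (indicator {0..pi} x * (G x - g k x))\<^sup>2) \<in> borel_measurable lborel"
      using m by (rule borel_measurable_power)
    moreover have "(\<lambda>x. (indicator {0..pi} x * (G x - g k x))\<^sup>2) = (\<lambda>x. indicator {0..pi} x * (G x - g k x)\<^sup>2)"
      by (auto simp: indicator_def)
    ultimately have m2: "(\<lambda>x. indicator {0..pi} x * (G x - g k x)\<^sup>2) \<in> borel_measurable lborel" by simp
    have fin: "(\<integral>\<^sup>+x. ennreal (indicator {0..pi} x * (G x - g k x)\<^sup>2) \<partial>lborel) \<le> ennreal e"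
      by (rule fatou[OF e le])
    have i: "integrable lborel (\<lambda>x. indicator {0..pi} x * (G x - g k x)\<^sup>2)"
      using fin m2 by (intro integrableI_bounded) (auto simp: abs_mult order_le_less_trans[OF _ ennreal_less_top])
    show "L2_fun (\<lambda>x. G x - g k x)"
      using m i by (simp add: L2_fun_def set_borel_measurable_def set_integrable_def)
    show "(LINT x:{0..pi}|lborel. (G x - g k x)\<^sup>2) \<le> e"
      using fin nn_integral_eq_integral[OF i] e by (simp add: set_lebesgue_integral_def)
  qed
  have ev: "\<exists>K. \<forall>k\<ge>K. \<forall>\<^sub>F m in sequentially. ?E m k \<le> e" if e: "0 < e" for e
  proof -
    obtain K where K: "\<forall>m\<ge>K. \<forall>n\<ge>K. ?E m n < e" using cauchy[OF e] by blast
    then have "\<forall>k\<ge>K. \<forall>\<^sub>F m in sequentially. ?E m k \<le> e"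
      by (auto intro!: eventually_sequentiallyI[of K] less_imp_le)
    then show ?thesis by blast
  qed
  obtain K where K: "\<forall>\<^sub>F m in sequentially. ?E m K \<le> 1" using ev[of 1] by auto
  have "L2_fun (\<lambda>x. (G x - g K x) + g K x)"
    using diffL[OF _ K] L by (intro L2_fun_add) auto
  then have LG: "L2_fun G" by simp
  have "(\<lambda>k. LINT x:{0..pi}|lborel. (G x - g k x)\<^sup>2) \<longlonglongrightarrow> 0"
  proof (rule LIMSEQ_I)
    fix e :: real assume e: "0 < e"
    then obtain K where K: "\<And>k. k \<ge> K \<Longrightarrow> \<forall>\<^sub>F m in sequentially. ?E m k \<le> e / 2" using ev[of "e / 2"] by auto
    have "norm ((LINT x:{0..pi}|lborel. (G x - g k x)\<^sup>2) - 0) < e" if "k \<ge> K" for k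
    proof -
      have "0 \<le> (LINT x:{0..pi}|lborel. (G x - g k x)\<^sup>2)"
        unfolding set_lebesgue_integral_def by (intro integral_nonneg_AE) auto
      then show ?thesis using diffE[OF _ K[OF that]] e by simp
    qed
    then show "\<exists>K. \<forall>k\<ge>K. norm ((LINT x:{0..pi}|lborel. (G x - g k x)\<^sup>2) - 0) < e" by blast
  qed
  with LG show ?thesis by (rule that)
qed

text \<open>The derivatives converge in \<open>L^2\<close> and their limit is integrated back. The
  boundary value at \<open>pi\<close> survives because convergence of the derivatives forces
  pointwise convergence of the primitives. Completeness is what makes vector-valued series and
  integrals of continuous curves available.\<close>

lemma h10_Cauchy_convergent:
  fixes X :: "nat \<Rightarrow> h10"
  assumes X: "Cauchy X" shows "convergent X"
proof -
  define g where "g k = weak_deriv (h10_fun (X k))" for k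
  have g: "has_weak_deriv (h10_fun (X k)) (g k)" for k
    unfolding g_def by (rule weak_deriv_h10)
  have L: "L2_fun (g k)" for k using g by (rule has_weak_deriv_L2)
  have dist: "(norm (X m - X n))\<^sup>2 = (LINT x:{0..pi}|lborel. (g m x - g n x)\<^sup>2)" for m n
    by (intro h10_norm_square has_weak_deriv_diff g)
  have "\<exists>N. \<forall>m\<ge>N. \<forall>n\<ge>N. (LINT x:{0..pi}|lborel. (g m x - g n x)\<^sup>2) < e" if e: "0 < e" for e
  proof -
    obtain N where N: "\<forall>m\<ge>N. \<forall>n\<ge>N. norm (X m - X n) < sqrt e"
      using CauchyD[OF X, of "sqrt e"] e by auto
    have "(norm (X m - X n))\<^sup>2 < e" if "m \<ge> N" "n \<ge> N" for m n
      using N that e by (metis norm_ge_zero power_strict_mono real_sqrt_pow2 less_imp_le zero_less_numeral)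
    then show ?thesis unfolding dist by blast
  qed
  then obtain G where G: "L2_fun G" and lim: "(\<lambda>k. LINT x:{0..pi}|lborel. (G x - g k x)\<^sup>2) \<longlonglongrightarrow> 0"
    using L2_fun_limit[of g, OF L] by blast
  have prim: "(\<lambda>k. h10_fun (X k) x) \<longlonglongrightarrow> (LINT y:{0..x}|lborel. G y)" if x: "x \<in> {0..pi}" for x
  proof (rule LIMSEQ_I)
    fix e :: real assume e: "0 < e"
    \<comment> \<open>With this weight, \<open>L1_le_L2\<close> gives less than
      \<open>(e + e / 2) / 2\<close> once the squared distance is below
      \<open>e / c\<close>.\<close>
    define c where "c = 8 / e"
    have c: "0 < c" using e by (simp add: c_def)
    obtain K where K: "\<And>k. k \<ge> K \<Longrightarrow> (LINT x:{0..pi}|lborel. (G x - g k x)\<^sup>2) < e / c"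
      using LIMSEQ_D[OF lim, of "e / c"] e c by (auto simp: abs_less_iff)
    have "norm (h10_fun (X k) x - (LINT y:{0..x}|lborel. G y)) < e" if k: "k \<ge> K" for k
    proof -
      have Ld: "L2_fun (\<lambda>y. G y - g k y)" by (intro L2_fun_diff G L)
      have i: "set_integrable lborel {0..x} (\<lambda>y. G y - g k y)"
        using x by (intro L2_fun_integrable_upto[OF Ld]) auto
      have "(LINT y:{0..x}|lborel. G y) - h10_fun (X k) x = (LINT y:{0..x}|lborel. G y - g k y)"
        unfolding h10_fun_primitive[OF g x]
        using x by (intro set_integral_diff(2)[symmetric] L2_fun_integrable_upto G L) auto
      also have "norm \<dots> \<le> (LINT y:{0..x}|lborel. norm (G y - g k y))"
        by (rule set_integral_norm_bound[OF i])
      also have "\<dots> \<le> (LINT y:{0..pi}|lborel. \<bar>G y - g k y\<bar>)"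
        unfolding set_lebesgue_integral_def
        using set_integrable_abs[OF i] set_integrable_abs[OF L2_fun_integrable[OF Ld]] x
        by (intro integral_mono) (auto simp: set_integrable_def indicator_def)
      also have "\<dots> \<le> (c * (LINT x:{0..pi}|lborel. (G x - g k x)\<^sup>2) + pi / c) / 2"
        by (rule L1_le_L2[OF Ld c])
      also have "\<dots> < (c * (e / c) + 4 / c) / 2"
        using K[OF k] c pi_less_4
        by (intro divide_strict_right_mono add_strict_mono mult_strict_left_mono) auto
      also have "\<dots> \<le> e" using c e by (simp add: c_def)
      finally show ?thesis by (simp add: abs_minus_commute)
    qed
    then show "\<exists>K. \<forall>k\<ge>K. norm (h10_fun (X k) x - (LINT y:{0..x}|lborel. G y)) < e" by blast
  qed
  define U where "U x = (if x \<in> {0..pi} then LINT y:{0..x}|lborel. G y else 0)" for x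
  have U0: "U 0 = 0"
    using prim[of 0] by (simp add: U_def LIMSEQ_const_iff)
  have "U pi = 0"
    using prim[of pi] by (simp add: U_def LIMSEQ_const_iff)
  moreover have wU: "has_weak_deriv U G"
    using G U0 by (auto simp: has_weak_deriv_def U_def)
  ultimately have "U \<in> H10_set"
    using U0 by (auto simp: H10_set_def U_def)
  then have "h10_fun (Abs_h10 U) = U" by (rule Abs_h10_inverse)
  then have w: "has_weak_deriv (h10_fun (Abs_h10 U)) G" using wU by simp
  have "(norm (Abs_h10 U - X k))\<^sup>2 = (LINT x:{0..pi}|lborel. (G x - g k x)\<^sup>2)" for k
    by (intro h10_norm_square has_weak_deriv_diff g w)
  then have "(\<lambda>k. (norm (Abs_h10 U - X k))\<^sup>2) \<longlonglongrightarrow> 0" using lim by simp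
  then have "(\<lambda>k. sqrt ((norm (Abs_h10 U - X k))\<^sup>2)) \<longlonglongrightarrow> sqrt 0" by (rule tendsto_real_sqrt)
  then have "(\<lambda>k. norm (X k - Abs_h10 U)) \<longlonglongrightarrow> 0" by (simp add: norm_minus_commute)
  then have "X \<longlonglongrightarrow> Abs_h10 U" by (simp add: LIM_zero_iff tendsto_norm_zero_iff)
  then show ?thesis by (rule convergentI)
qed

instance h10 :: banach
  by standard (rule h10_Cauchy_convergent)

section \<open>Sine series\<close>

lemma set_lint_continuous:
  fixes f :: "real \<Rightarrow> real"
  shows "continuous_on {a..b} f \<Longrightarrow> (LINT x:{a..b}|lborel. f x) = integral {a..b} f"
  by (intro set_borel_integral_eq_integral(2) continuous_set_integrable)

definition sc :: "nat \<Rightarrow> h10 \<Rightarrow> real" where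
  "sc n u = sine_coeff (h10_fun u) n"

lemma sc_eq_integral: "sc n u = 2 / pi * integral {0..pi} (\<lambda>x. h10_fun u x * sin (real n * x))"
  unfolding sc_def sine_coeff_def
  by (subst set_lint_continuous) (auto intro!: continuous_intros continuous_on_h10_fun)

lemma h10_fun_sine_mode: "x \<in> {0..pi} \<Longrightarrow> h10_fun (sine_mode n) x = sin (real n * x)"
  by (simp add: sine_mode.rep_eq)

lemma has_weak_deriv_sine_mode: "has_weak_deriv (h10_fun (sine_mode n)) (\<lambda>x. real n * cos (real n * x))"
  unfolding sine_mode.rep_eq
  by (rule C1_has_weak_deriv) (auto intro!: derivative_eq_intros continuous_intros)

text \<open>Integration by parts against \<open>cos (n x) - 1\<close>, a primitive of
  \<open>- n sin (n x)\<close>; the constant drops out because the derivative of \<open>u\<close>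
  has integral 0. The identity makes \<open>sc n\<close> a bounded functional and the modes
  orthogonal in \<open>h10\<close>.\<close>

lemma inner_sine_mode: "inner u (sine_mode n) = (real n)\<^sup>2 * (pi / 2) * sc n u"
proof -
  let ?g = "weak_deriv (h10_fun u)"
  have g: "has_weak_deriv (h10_fun u) ?g" by (rule weak_deriv_h10)
  have L: "L2_fun ?g" using g by (rule has_weak_deriv_L2)
  have gi: "set_integrable lborel {0..pi} ?g" by (rule L2_fun_integrable[OF L])
  define s where "s z = - real n * sin (real n * z)" for z
  have si: "set_lebesgue_integral lborel {0..y} s = cos (real n * y) - 1" if "0 \<le> y" for y
  proof -
    have "((\<lambda>z. s z) has_integral (cos (real n * y) - cos (real n * 0))) {0..y}"
      using that
      by (intro fundamental_theorem_of_calculus)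
        (auto intro!: derivative_eq_intros simp: s_def has_real_derivative_iff_has_vector_derivative[symmetric])
    moreover have "continuous_on {0..y} s" unfolding s_def by (intro continuous_intros)
    ultimately show ?thesis
      by (simp add: set_lint_continuous integral_unique)
  qed
  have sii: "set_integrable lborel {0..pi} s"
    unfolding s_def by (intro continuous_set_integrable continuous_intros)
  have ci: "set_integrable lborel {0..pi} (\<lambda>y. ?g y * cos (real n * y))"
    by (intro L2_fun_mult_integrable L continuous_L2_fun continuous_intros)
  have g0: "(LINT y:{0..pi}|lborel. ?g y) = 0"
    using h10_fun_primitive[OF g, of pi] by simp
  have "(LINT y:{0..pi}|lborel. ?g y * (LINT z:{0..y}|lborel. s z)) +
      (LINT z:{0..pi}|lborel. (LINT y:{0..z}|lborel. ?g y) * (s z)) = 0"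
    using primitive_product[OF gi sii] g0 by simp
  also have "(LINT y:{0..pi}|lborel. ?g y * (LINT z:{0..y}|lborel. s z)) =
      (LINT y:{0..pi}|lborel. ?g y * cos (real n * y) - ?g y)"
    by (intro set_lebesgue_integral_cong) (auto simp: si right_diff_distrib)
  also have "\<dots> = (LINT y:{0..pi}|lborel. ?g y * cos (real n * y))"
    using ci gi g0 by simp
  also have "(LINT z:{0..pi}|lborel. (LINT y:{0..z}|lborel. ?g y) * (s z)) =
      (LINT z:{0..pi}|lborel. - real n * (h10_fun u z * sin (real n * z)))"
    by (intro set_lebesgue_integral_cong) (auto simp: h10_fun_primitive[OF g] s_def)
  also have "\<dots> = - real n * (pi / 2 * sc n u)"
    unfolding set_integral_mult_right by (simp add: sc_def sine_coeff_def)
  finally have "(LINT y:{0..pi}|lborel. ?g y * cos (real n * y)) = real n * (pi / 2 * sc n u)" by simp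
  moreover have "inner u (sine_mode n) = (LINT y:{0..pi}|lborel. real n * (?g y * cos (real n * y)))"
    unfolding inner_h10_eq[OF g has_weak_deriv_sine_mode] by (simp add: mult_ac)
  ultimately show ?thesis by (simp add: power2_eq_square)
qed

lemma sc_0 [simp]: "sc 0 u = 0"
  by (simp add: sc_eq_integral)

lemma sc_eq_inner: "sc n u = inner u (sine_mode n) * (2 / (pi * (real n)\<^sup>2))"
  by (cases "n = 0") (auto simp: inner_sine_mode)

lemma bounded_linear_sc: "bounded_linear (sc n)"
  unfolding sc_eq_inner
  by (intro bounded_linear_compose[OF bounded_linear_mult_left bounded_linear_inner_left])

lemmas sc_add [simp] = linear_add[OF bounded_linear.linear[OF bounded_linear_sc]]
lemmas sc_diff [simp] = linear_diff[OF bounded_linear.linear[OF bounded_linear_sc]]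
lemmas sc_scale [simp] = linear_scale[OF bounded_linear.linear[OF bounded_linear_sc], simplified]
lemmas sc_minus [simp] = linear_neg[OF bounded_linear.linear[OF bounded_linear_sc]]
lemmas sc_zero [simp] = linear_0[OF bounded_linear.linear[OF bounded_linear_sc]]
lemmas continuous_on_sc = bounded_linear.continuous_on[OF bounded_linear_sc]

text \<open>Off the diagonal no integral is computed: symmetry of the inner product yields
  \<open>(m^2 - n^2) * sc n (sine_mode m) = 0\<close>.\<close>

lemma sc_sine_mode: "sc n (sine_mode m) = (if n = m \<and> 0 < n then 1 else 0)"
proof -
  have eq: "sc n (sine_mode m) = 2 / pi * integral {0..pi} (\<lambda>x. sin (real m * x) * sin (real n * x))" for n m
    unfolding sc_eq_integral
    by (intro arg_cong[where f = "\<lambda>x. 2 / pi * x"] integral_cong) (auto simp: h10_fun_sine_mode)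
  have "(real m)\<^sup>2 * sc m (sine_mode n) = (real n)\<^sup>2 * sc n (sine_mode m)"
    using inner_sine_mode[of "sine_mode n" m] inner_sine_mode[of "sine_mode m" n]
    by (simp add: inner_commute)
  moreover have "sc m (sine_mode n) = sc n (sine_mode m)"
    unfolding eq by (simp add: mult.commute)
  ultimately have "((real m)\<^sup>2 - (real n)\<^sup>2) * sc n (sine_mode m) = 0"
    by (simp add: algebra_simps)
  then have 1: "sc n (sine_mode m) = 0" if "n \<noteq> m"
    using that by (auto simp: power2_eq_iff)
  have 2: "sc n (sine_mode n) = 1" if n: "0 < n"
  proof -
    let ?F = "\<lambda>x. x / 2 - sin (2 * real n * x) / (4 * real n)"
    have "((\<lambda>x. sin (real n * x) * sin (real n * x)) has_integral (?F pi - ?F 0)) {0..pi}"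
    proof (rule fundamental_theorem_of_calculus)
      fix x
      have "(?F has_real_derivative (1 - cos (2 * real n * x)) / 2) (at x within {0..pi})"
        using n by (auto intro!: derivative_eq_intros simp: field_simps)
      also have "(1 - cos (2 * real n * x)) / 2 = sin (real n * x) * sin (real n * x)"
        using cos_double_sin[of "real n * x"] by (simp add: power2_eq_square mult.assoc)
      finally show "(?F has_vector_derivative sin (real n * x) * sin (real n * x)) (at x within {0..pi})"
        by (simp add: has_real_derivative_iff_has_vector_derivative)
    qed simp
    moreover have "sin (2 * real n * pi) = 0"
      using sin_npi[of "2 * n"] by (simp add: mult.assoc)
    ultimately show ?thesis unfolding eq by (simp add: integral_unique)
  qed
  show ?thesis using 1 2 by (cases "n = 0") auto
qed

text \<open>The functions \<open>sin x * cos x ^ k\<close> are trigonometric sine polynomials, and by Weierstrass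
  \<open>u\<close> is a uniform limit of polynomials in \<open>cos x\<close>; hence \<open>u\<^sup>2 sin x\<close> integrates to zero.\<close>

lemma sc_complete:
  assumes 0: "\<And>n. sc n u = 0" shows "u = 0"
proof -
  let ?u = "h10_fun u"
  have cu: "continuous_on {0..pi} ?u" by (rule continuous_on_h10_fun)
  have I: "(\<lambda>x. ?u x * f x) integrable_on {0..pi}" if "continuous_on {0..pi} f" for f
    using that cu by (intro integrable_continuous_real continuous_intros)
  have 1: "integral {0..pi} (\<lambda>x. ?u x * (sin (real n * x) * cos x ^ k)) = 0" for n k
  proof (induction k arbitrary: n)
    case 0
    show ?case using assms[of n] unfolding sc_eq_integral by simp
  next
    case (Suc k)
    show ?case
    proof (cases n)
      case (Suc m)
      \<comment> \<open>Product-to-sum trades one power of the cosine for the two neighbouring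
        frequencies \<open>m\<close> and \<open>m + 2\<close>.\<close>
      have "sin (real (m + 1) * x) * cos x = (sin (real (m + 2) * x) + sin (real m * x)) / 2" for x
        using sin_times_cos[of "real (m + 1) * x" x] by (simp add: algebra_simps)
      then have "sin (real n * x) * cos x ^ Suc k =
          (sin (real (m + 2) * x) + sin (real m * x)) / 2 * cos x ^ k" for x
        unfolding power_Suc Suc by (metis Suc_eq_plus1 mult.assoc)
      then have "integral {0..pi} (\<lambda>x. ?u x * (sin (real n * x) * cos x ^ Suc k)) =
          integral {0..pi} (\<lambda>x. 1 / 2 * (?u x * (sin (real (m + 2) * x) * cos x ^ k)) +
             1 / 2 * (?u x * (sin (real m * x) * cos x ^ k)))"
        by (simp only:) (intro integral_cong, simp add: field_simps)
      also have "\<dots> = 1 / 2 * integral {0..pi} (\<lambda>x. ?u x * (sin (real (m + 2) * x) * cos x ^ k)) +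
          1 / 2 * integral {0..pi} (\<lambda>x. ?u x * (sin (real m * x) * cos x ^ k))"
        by (subst integral_add) (auto intro!: integrable_on_mult_right I continuous_intros simp del: of_nat_add)
      finally show ?thesis by (simp only: Suc.IH mult_zero_right add_0)
    qed simp
  qed
  define h where "h c = ?u (arccos c)" for c
  have ch: "continuous_on {-1..1} h"
    unfolding h_def
    by (rule continuous_on_compose2[OF cu continuous_on_arccos']) (auto simp: arccos_lbound arccos_ubound)
  let ?J = "integral {0..pi} (\<lambda>x. ?u x * (sin x * ?u x))"
  have J: "\<bar>?J\<bar> \<le> e" if e: "0 < e" for e
  proof -
    \<comment> \<open>The summand 1 keeps the denominator positive when
      \<open>u = 0\<close>.\<close>
    define d where "d = e / (3 * norm u * pi + 1)"
    have d: "0 < d" using e unfolding d_def by (intro divide_pos_pos add_nonneg_pos) auto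
    obtain p where p: "real_polynomial_function p" and pd: "\<And>c. c \<in> {-1..1} \<Longrightarrow> \<bar>h c - p c\<bar> < d"
      using Stone_Weierstrass_real_polynomial_function[OF _ ch d] by auto
    obtain a n where pa: "p = (\<lambda>c. \<Sum>i\<le>n. a i * c ^ i)"
      using p real_polynomial_function_imp_sum by blast
    have cp: "continuous_on {0..pi} (\<lambda>x. sin x * p (cos x))"
      unfolding pa by (intro continuous_intros)
    have "integral {0..pi} (\<lambda>x. ?u x * (sin x * p (cos x))) =
        integral {0..pi} (\<lambda>x. \<Sum>i\<le>n. a i * (?u x * (sin (real 1 * x) * cos x ^ i)))"
      by (intro integral_cong) (simp add: pa sum_distrib_left mult_ac)
    also have "\<dots> = (\<Sum>i\<le>n. a i * integral {0..pi} (\<lambda>x. ?u x * (sin (real 1 * x) * cos x ^ i)))"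
      by (subst integral_sum) (auto intro!: integrable_on_mult_right I continuous_intros)
    also have "\<dots> = 0" by (simp only: 1) simp
    finally have z: "integral {0..pi} (\<lambda>x. ?u x * (sin x * p (cos x))) = 0" .
    have "?J = integral {0..pi} (\<lambda>x. ?u x * (sin x * ?u x)) - integral {0..pi} (\<lambda>x. ?u x * (sin x * p (cos x)))"
      using z by simp
    also have "\<dots> = integral {0..pi} (\<lambda>x. ?u x * (sin x * ?u x) - ?u x * (sin x * p (cos x)))"
      using cu by (intro integral_diff[symmetric] I[OF cp] I continuous_intros)
    also have "\<bar>\<dots>\<bar> \<le> integral {0..pi} (\<lambda>x. 3 * norm u * d)"
    proof -
      have "\<bar>?u x * (sin x * ?u x) - ?u x * (sin x * p (cos x))\<bar> \<le> 3 * norm u * d" if x: "x \<in> {0..pi}" for x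
      proof -
        have "\<bar>?u x - p (cos x)\<bar> \<le> d"
          using pd[of "cos x"] x by (auto simp: h_def arccos_cos)
        then have "\<bar>sin x\<bar> * \<bar>?u x - p (cos x)\<bar> \<le> 1 * d"
          by (intro mult_mono) auto
        then have "\<bar>?u x\<bar> * (\<bar>sin x\<bar> * \<bar>?u x - p (cos x)\<bar>) \<le> 3 * norm u * d"
          using h10_fun_bound[of u x] by (intro mult_mono) auto
        moreover have "?u x * (sin x * ?u x) - ?u x * (sin x * p (cos x)) = ?u x * (sin x * (?u x - p (cos x)))"
          by (simp add: algebra_simps)
        ultimately show ?thesis by (simp only: abs_mult)
      qed
      then have "norm (integral {0..pi} (\<lambda>x. ?u x * (sin x * ?u x) - ?u x * (sin x * p (cos x)))) \<le>
          integral {0..pi} (\<lambda>x. 3 * norm u * d)"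
        using cu
        by (intro integral_norm_bound_integral integrable_diff I[OF cp] I continuous_intros) auto
      then show ?thesis by simp
    qed
    also have "\<dots> = (3 * norm u * pi) * d" by simp
    also have "\<dots> \<le> (3 * norm u * pi + 1) * d" using d by (intro mult_right_mono) auto
    also have "\<dots> = e" using e unfolding d_def by (auto simp: add_nonneg_eq_0_iff)
    finally show ?thesis .
  qed
  have "?J = 0"
    using J[of "\<bar>?J\<bar> / 2"] by (cases "?J = 0") auto
  then have "\<forall>x\<in>{0..pi}. ?u x * (sin x * ?u x) = 0"
  proof (subst (asm) integral_eq_0_iff)
    show "continuous_on {0..pi} (\<lambda>x. ?u x * (sin x * ?u x))" using cu by (intro continuous_intros)
    show "0 \<le> ?u x * (sin x * ?u x)" if "x \<in> {0..pi}" for x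
      using that mult_nonneg_nonneg[OF sin_ge_zero[of x] zero_le_square[of "?u x"]] by (simp add: mult_ac)
  qed auto
  then show "u = 0"
    by (intro h10_eqI) (auto simp: sin_gt_zero less_imp_neq[symmetric] dest: sin_gt_zero)
qed

lemma h10_eq_iff_sc: "u = v \<longleftrightarrow> (\<forall>n. sc n u = sc n v)"
  using sc_complete[of "u - v"] by auto

lemma norm_sine_mode: "(norm (sine_mode n))\<^sup>2 = pi / 2 * (real n)\<^sup>2"
  by (simp add: power2_norm_eq_inner inner_sine_mode sc_sine_mode)

section \<open>Parseval's identity and norm bounds from coefficients\<close>

lemma norm_sine_sum:
  assumes "finite A"
  shows "(norm (\<Sum>i\<in>A. c i *\<^sub>R sine_mode i))\<^sup>2 = pi / 2 * (\<Sum>i\<in>A. (real i * c i)\<^sup>2)"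
proof -
  have "pairwise (\<lambda>i j. orthogonal (c i *\<^sub>R sine_mode i) (c j *\<^sub>R sine_mode j)) A"
    by (auto simp: pairwise_def orthogonal_def inner_sine_mode sc_sine_mode)
  then have "(norm (\<Sum>i\<in>A. c i *\<^sub>R sine_mode i))\<^sup>2 = (\<Sum>i\<in>A. (norm (c i *\<^sub>R sine_mode i))\<^sup>2)"
    using assms by (intro norm_sum_Pythagorean)
  also have "\<dots> = (\<Sum>i\<in>A. pi / 2 * (real i * c i)\<^sup>2)"
    by (simp add: power_mult_distrib norm_sine_mode mult_ac)
  finally show ?thesis by (simp add: sum_distrib_left)
qed

lemma summable_sine_series:
  assumes "summable (\<lambda>n. (real n * c n)\<^sup>2)"
  shows "summable (\<lambda>n. c n *\<^sub>R sine_mode n)"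
  unfolding summable_Cauchy
proof (intro allI impI)
  fix e :: real assume e: "0 < e"
  then have "0 < e\<^sup>2 / (pi / 2)" by simp
  then obtain N where N: "\<And>m n. m \<ge> N \<Longrightarrow> norm (\<Sum>i=m..<n. (real i * c i)\<^sup>2) < e\<^sup>2 / (pi / 2)"
    using assms unfolding summable_Cauchy by meson
  have "norm (\<Sum>i=m..<n. c i *\<^sub>R sine_mode i) < e" if "m \<ge> N" for m n
  proof -
    have "(norm (\<Sum>i=m..<n. c i *\<^sub>R sine_mode i))\<^sup>2 < e\<^sup>2"
    proof -
      have "(\<Sum>i=m..<n. (real i * c i)\<^sup>2) < e\<^sup>2 / (pi / 2)"
        using N[OF that, of n] by (simp only: real_norm_def abs_less_iff)
      then have "pi / 2 * (\<Sum>i=m..<n. (real i * c i)\<^sup>2) < e\<^sup>2"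
        by (subst (asm) pos_less_divide_eq) (simp_all add: mult.commute)
      then show ?thesis by (subst norm_sine_sum) simp_all
    qed
    then show ?thesis by (rule power2_less_imp_less) (use e in simp)
  qed
  then show "\<exists>N. \<forall>m\<ge>N. \<forall>n. norm (\<Sum>i=m..<n. c i *\<^sub>R sine_mode i) < e" by blast
qed

lemma sc_sine_series:
  assumes "summable (\<lambda>n. (real n * c n)\<^sup>2)" and n: "0 < n"
  shows "sc n (\<Sum>i. c i *\<^sub>R sine_mode i) = c n"
proof -
  have "(\<lambda>i. sc n (c i *\<^sub>R sine_mode i)) sums sc n (\<Sum>i. c i *\<^sub>R sine_mode i)"
    by (intro bounded_linear.sums[OF bounded_linear_sc] summable_sums summable_sine_series assms)
  moreover have "(\<lambda>i. sc n (c i *\<^sub>R sine_mode i)) = (\<lambda>i. if i = n then c i else 0)"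
    using n by (auto simp: sc_sine_mode)
  ultimately show ?thesis using sums_unique2 sums_single by metis
qed

text \<open>Bessel's inequality, from the nonnegative norm of \<open>u\<close> minus its partial
  sum.\<close>

lemma summable_sc: "summable (\<lambda>n. (real n * sc n u)\<^sup>2)"
proof (rule summableI_nonneg_bounded)
  fix N
  let ?p = "\<Sum>i<N. sc i u *\<^sub>R sine_mode i"
  have "inner u ?p = pi / 2 * (\<Sum>i<N. (real i * sc i u)\<^sup>2)"
    by (simp add: inner_sum_right inner_sine_mode sum_distrib_left power2_eq_square mult_ac)
  moreover have "inner ?p ?p = pi / 2 * (\<Sum>i<N. (real i * sc i u)\<^sup>2)"
    by (subst norm_sine_sum[symmetric]) (auto simp: power2_norm_eq_inner)
  moreover have "0 \<le> inner (u - ?p) (u - ?p)" by simp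
  ultimately have "pi / 2 * (\<Sum>i<N. (real i * sc i u)\<^sup>2) \<le> (norm u)\<^sup>2"
    unfolding inner_diff_left inner_diff_right power2_norm_eq_inner by (simp add: inner_commute)
  then show "(\<Sum>i<N. (real i * sc i u)\<^sup>2) \<le> (norm u)\<^sup>2 / (pi / 2)" by (simp add: field_simps)
qed simp

text \<open>The series converges to an element with the same coefficients as \<open>u\<close>, and
  completeness of the modes identifies the two.\<close>

lemma sine_expansion: "(\<lambda>n. sc n u *\<^sub>R sine_mode n) sums u"
proof -
  have "u = (\<Sum>n. sc n u *\<^sub>R sine_mode n)"
    unfolding h10_eq_iff_sc using sc_sine_series[OF summable_sc[of u]] by (metis neq0_conv sc_0)
  then show ?thesis using summable_sums[OF summable_sine_series[OF summable_sc[of u]]] by simp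
qed

lemma parseval: "(\<lambda>n. pi / 2 * (real n * sc n u)\<^sup>2) sums (norm u)\<^sup>2"
proof -
  have "(\<lambda>n. inner u (sc n u *\<^sub>R sine_mode n)) sums inner u u"
    by (intro bounded_linear.sums[OF bounded_linear_inner_right] sine_expansion)
  moreover have "inner u (sc n u *\<^sub>R sine_mode n) = pi / 2 * (real n * sc n u)\<^sup>2" for n
    by (simp add: inner_sine_mode power2_eq_square)
  ultimately show ?thesis unfolding power2_norm_eq_inner by (simp only:)
qed

text \<open>The \<open>h10\<close> norm of the sine series with coefficients \<open>1 / n^2\<close>.
  The term \<open>n = 0\<close> is 0, since division by zero yields 0.\<close>

definition sine_const :: real where
  "sine_const = sqrt (pi / 2 * (\<Sum>n. (1 / real n)\<^sup>2))"

lemma summable_inverse_square: "summable (\<lambda>n. (1 / real n)\<^sup>2)"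
  using inverse_power_summable[of 2, where 'a = real] by (simp add: power_divide inverse_eq_divide)

lemma sine_const_nonneg: "0 \<le> sine_const"
  unfolding sine_const_def using summable_inverse_square by (auto intro!: mult_nonneg_nonneg suminf_nonneg)

text \<open>Coefficients of order \<open>1 / n^2\<close> remain square summable after the weight
  \<open>n\<close> of Parseval's identity. Every smoothing estimate ends here.\<close>

lemma norm_le_sc:
  assumes "\<And>n. 0 < n \<Longrightarrow> \<bar>sc n u\<bar> \<le> Q / (real n)\<^sup>2"
  shows "norm u \<le> sine_const * Q"
proof -
  have Q: "0 \<le> Q" using assms[of 1] by auto
  have s: "summable (\<lambda>n. pi / 2 * (Q\<^sup>2 * (1 / real n)\<^sup>2))"
    by (intro summable_mult summable_inverse_square)
  have "(norm u)\<^sup>2 \<le> (\<Sum>n. pi / 2 * (Q\<^sup>2 * (1 / real n)\<^sup>2))"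
    unfolding sums_unique[OF parseval]
  proof (rule suminf_le[OF _ sums_summable[OF parseval] s])
    fix n
    have "\<bar>real n * sc n u\<bar> \<le> \<bar>Q * (1 / real n)\<bar>"
      using assms[of n] Q by (cases "n = 0") (auto simp: abs_mult field_simps power2_eq_square)
    then show "pi / 2 * (real n * sc n u)\<^sup>2 \<le> pi / 2 * (Q\<^sup>2 * (1 / real n)\<^sup>2)"
      unfolding power_mult_distrib[symmetric, of Q] abs_le_square_iff by (intro mult_left_mono) auto
  qed
  also have "\<dots> = pi / 2 * (\<Sum>n. (1 / real n)\<^sup>2) * Q\<^sup>2"
    using summable_inverse_square by (simp add: suminf_mult suminf_divide summable_mult)
  also have "\<dots> = (sine_const * Q)\<^sup>2"
    unfolding sine_const_def power_mult_distrib
    using summable_inverse_square by (simp add: suminf_nonneg)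
  finally show ?thesis by (rule power2_le_imp_le) (use Q sine_const_nonneg in simp)
qed

lemma sc_abs_le:
  assumes "\<And>x. x \<in> {0..pi} \<Longrightarrow> \<bar>h10_fun u x\<bar> \<le> Q"
  shows "\<bar>sc n u\<bar> \<le> 2 * Q"
proof -
  have "norm (integral {0..pi} (\<lambda>x. h10_fun u x * sin (real n * x))) \<le> integral {0..pi} (\<lambda>x. Q)"
  proof (rule integral_norm_bound_integral)
    show "(\<lambda>x. h10_fun u x * sin (real n * x)) integrable_on {0..pi}"
      by (intro integrable_continuous_real continuous_intros continuous_on_h10_fun)
    show "norm (h10_fun u x * sin (real n * x)) \<le> Q" if "x \<in> {0..pi}" for x
    proof -
      have "\<bar>h10_fun u x\<bar> * \<bar>sin (real n * x)\<bar> \<le> Q * 1"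
        using assms[OF that] by (intro mult_mono) auto
      then show ?thesis by (simp add: abs_mult)
    qed
  qed auto
  then have "2 / pi * \<bar>integral {0..pi} (\<lambda>x. h10_fun u x * sin (real n * x))\<bar> \<le> 2 / pi * (pi * Q)"
    by (intro mult_left_mono) auto
  then show ?thesis by (simp add: sc_eq_integral abs_mult)
qed

text \<open>On nonnegative functions this is the \<open>L^1\<close> norm. Being linear and monotone,
  it is a scalar that converges along bounded monotone families.\<close>

definition mass :: "h10 \<Rightarrow> real" where "mass u = integral {0..pi} (h10_fun u)"

lemma sc_abs_le_mass:
  assumes "\<And>x. x \<in> {0..pi} \<Longrightarrow> 0 \<le> h10_fun u x"
  shows "\<bar>sc n u\<bar> \<le> mass u"
proof -
  have "norm (integral {0..pi} (\<lambda>x. h10_fun u x * sin (real n * x))) \<le> integral {0..pi} (h10_fun u)"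
  proof (rule integral_norm_bound_integral)
    show "norm (h10_fun u x * sin (real n * x)) \<le> h10_fun u x" if "x \<in> {0..pi}" for x
    proof -
      have "\<bar>h10_fun u x\<bar> * \<bar>sin (real n * x)\<bar> \<le> h10_fun u x * 1"
        using assms[OF that] by (intro mult_mono) auto
      then show ?thesis by (simp add: abs_mult)
    qed
  qed (intro integrable_continuous_real continuous_intros continuous_on_h10_fun)+
  then have "2 / pi * \<bar>integral {0..pi} (\<lambda>x. h10_fun u x * sin (real n * x))\<bar> \<le> 1 * mass u"
    using pi_gt3 unfolding mass_def by (intro mult_mono) auto
  then show ?thesis by (simp add: sc_eq_integral abs_mult)
qed

text \<open>A Weierstrass test adapted to orthogonal terms: the majorant \<open>b\<close> has to be
  square summable only, whereas summing the norms would require it to be summable.\<close>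

lemma continuous_on_sine_series:
  fixes c :: "nat \<Rightarrow> 'a::topological_space \<Rightarrow> real"
  assumes c: "\<And>n. continuous_on S (c n)" and b: "summable (\<lambda>n. (b n)\<^sup>2)"
    and le: "\<And>n t. t \<in> S \<Longrightarrow> \<bar>real n * c n t\<bar> \<le> b n"
  shows "continuous_on S (\<lambda>t. \<Sum>n. c n t *\<^sub>R sine_mode n)"
    and "t \<in> S \<Longrightarrow> summable (\<lambda>n. (real n * c n t)\<^sup>2)"
proof -
  have sq: "(real n * c n t)\<^sup>2 \<le> (b n)\<^sup>2" if "t \<in> S" for n t
    using le[OF that, of n] by (intro power2_le_iff_abs_le[THEN iffD2]) (auto intro: order_trans[OF abs_ge_zero])
  then show sm: "summable (\<lambda>n. (real n * c n t)\<^sup>2)" if "t \<in> S" for t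
    using that by (intro summable_comparison_test'[OF b, of 0]) auto
  have "uniform_limit S (\<lambda>N t. \<Sum>n<N. c n t *\<^sub>R sine_mode n) (\<lambda>t. \<Sum>n. c n t *\<^sub>R sine_mode n) sequentially"
    unfolding uniform_limit_sequentially_iff
  proof (intro allI impI)
    fix e :: real assume e: "0 < e"
    then have "0 < (e / 2)\<^sup>2 / (pi / 2)" by simp
    then obtain N where N: "\<And>m n. m \<ge> N \<Longrightarrow> norm (\<Sum>i=m..<n. (b i)\<^sup>2) < (e / 2)\<^sup>2 / (pi / 2)"
      using b unfolding summable_Cauchy by meson
    have "dist (\<Sum>n<m. c n t *\<^sub>R sine_mode n) (\<Sum>n. c n t *\<^sub>R sine_mode n) < e"
      if m: "m \<ge> N" and t: "t \<in> S" for m t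
    proof -
      let ?s = "\<lambda>m. \<Sum>n<m. c n t *\<^sub>R sine_mode n"
      have "norm (?s n - ?s m) \<le> e / 2" if n: "n \<ge> m" for n
      proof -
        have "?s n - ?s m = (\<Sum>i=m..<n. c i t *\<^sub>R sine_mode i)"
          using n by (metis lessThan_atLeast0 sum_diff_nat_ivl zero_le)
        then have "(norm (?s n - ?s m))\<^sup>2 = pi / 2 * (\<Sum>i=m..<n. (real i * c i t)\<^sup>2)"
          by (simp add: norm_sine_sum)
        also have "\<dots> \<le> pi / 2 * (\<Sum>i=m..<n. (b i)\<^sup>2)"
          using sq[OF t] by (intro mult_left_mono sum_mono) auto
        also have "\<dots> \<le> (e / 2)\<^sup>2"
        proof -
          have "(\<Sum>i=m..<n. (b i)\<^sup>2) < (e / 2)\<^sup>2 / (pi / 2)"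
            using N[OF m, of n] by (simp only: real_norm_def abs_less_iff)
          then have "pi / 2 * (\<Sum>i=m..<n. (b i)\<^sup>2) < (e / 2)\<^sup>2"
            by (subst (asm) pos_less_divide_eq) (simp_all add: mult.commute)
          then show ?thesis by simp
        qed
        finally show ?thesis by (rule power2_le_imp_le) (use e in simp)
      qed
      then have ev: "\<forall>\<^sub>F n in sequentially. norm (?s n - ?s m) \<le> e / 2"
        by (auto intro: eventually_sequentiallyI)
      have "(\<lambda>n. norm (?s n - ?s m)) \<longlonglongrightarrow> norm ((\<Sum>n. c n t *\<^sub>R sine_mode n) - ?s m)"
        by (intro tendsto_norm tendsto_diff tendsto_const summable_LIMSEQ summable_sine_series sm t)
      then have "norm ((\<Sum>n. c n t *\<^sub>R sine_mode n) - ?s m) \<le> e / 2"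
        using ev by (intro tendsto_upperbound) auto
      then show ?thesis using e by (simp add: dist_norm norm_minus_commute)
    qed
    then show "\<exists>N. \<forall>n\<ge>N. \<forall>x\<in>S. dist (\<Sum>i<n. c i x *\<^sub>R sine_mode i) (\<Sum>i. c i x *\<^sub>R sine_mode i) < e"
      by blast
  qed
  then show "continuous_on S (\<lambda>t. \<Sum>n. c n t *\<^sub>R sine_mode n)"
    by (rule uniform_limit_theorem[rotated]) (auto intro!: always_eventually continuous_intros c)
qed

section \<open>The heat semigroup and its maximum principle\<close>

definition heat :: "real \<Rightarrow> h10 \<Rightarrow> h10" where
  "heat t u = heat_semigroup t (h10_fun u)"

lemma heat_eq: "heat t u = (\<Sum>n. (exp (- (real n)\<^sup>2 * t) * sc n u) *\<^sub>R sine_mode n)"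
  by (simp add: heat_def heat_semigroup_def sc_def)

lemma heat_coeff_le: "0 \<le> t \<Longrightarrow> \<bar>real n * (exp (- (real n)\<^sup>2 * t) * sc n u)\<bar> \<le> \<bar>real n * sc n u\<bar>"
  by (simp add: abs_mult mult_left_mono mult_left_le_one_le)

lemma summable_abs_sc: "summable (\<lambda>n. \<bar>real n * sc n u\<bar>\<^sup>2)"
  using summable_sc[of u] by simp

lemma summable_heat: "0 \<le> t \<Longrightarrow> summable (\<lambda>n. (real n * (exp (- (real n)\<^sup>2 * t) * sc n u))\<^sup>2)"
  using continuous_on_sine_series(2)[of "{t}" "\<lambda>n t. exp (- (real n)\<^sup>2 * t) * sc n u" "\<lambda>n. \<bar>real n * sc n u\<bar>" t]
    summable_abs_sc heat_coeff_le by simp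

lemma sc_heat: "0 \<le> t \<Longrightarrow> sc n (heat t u) = exp (- (real n)\<^sup>2 * t) * sc n u"
  unfolding heat_eq by (cases "n = 0") (simp, rule sc_sine_series[OF summable_heat], simp_all)

lemma continuous_on_heat: "continuous_on {0..} (\<lambda>t. heat t u)"
  unfolding heat_eq
  by (rule continuous_on_sine_series(1)[OF _ summable_abs_sc])
    (use heat_coeff_le in \<open>auto intro!: continuous_intros\<close>)

lemma heat_0 [simp]: "heat 0 u = u"
  by (simp add: h10_eq_iff_sc sc_heat)

lemma heat_diff: "0 \<le> t \<Longrightarrow> heat t (u - v) = heat t u - heat t v"
  by (simp add: h10_eq_iff_sc sc_heat right_diff_distrib)

lemma heat_minus: "0 \<le> t \<Longrightarrow> heat t (- u) = - heat t u"
  by (simp add: h10_eq_iff_sc sc_heat)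

lemma norm_heat_le: "0 \<le> t \<Longrightarrow> norm (heat t u) \<le> norm u"
proof -
  assume t: "0 \<le> t"
  have "(norm (heat t u))\<^sup>2 \<le> (norm u)\<^sup>2"
    unfolding sums_unique[OF parseval]
  proof (rule suminf_le[OF _ sums_summable[OF parseval] sums_summable[OF parseval]])
    fix n
    show "pi / 2 * (real n * sc n (heat t u))\<^sup>2 \<le> pi / 2 * (real n * sc n u)\<^sup>2"
      using heat_coeff_le[OF t, of n u]
      by (intro mult_left_mono) (simp_all add: sc_heat t abs_le_square_iff)
  qed
  then show ?thesis by (rule power2_le_imp_le) simp
qed

text \<open>The semigroup is only strongly continuous at time 0. So the variation of
  \<open>G\<close> is absorbed by contractivity, and the variation in time is taken at the fixed
  vector \<open>G r0\<close>.\<close>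

lemma continuous_on_heat_diff:
  assumes G: "continuous_on {s..t} G"
  shows "continuous_on {s..t} (\<lambda>r. heat (t - r) (G r))"
  unfolding continuous_on_def
proof
  fix r0 assume r0: "r0 \<in> {s..t}"
  have 1: "((\<lambda>r. heat (t - r) (G r0)) \<longlongrightarrow> heat (t - r0) (G r0)) (at r0 within {s..t})"
  proof -
    have "continuous_on {s..t} (\<lambda>r. heat (t - r) (G r0))"
      by (rule continuous_on_compose2[OF continuous_on_heat]) (auto intro!: continuous_intros)
    then show ?thesis using r0 unfolding continuous_on_def by blast
  qed
  have 2: "(G \<longlongrightarrow> G r0) (at r0 within {s..t})"
    using G r0 unfolding continuous_on_def by blast
  have 3: "((\<lambda>r. heat (t - r) (G r - G r0)) \<longlongrightarrow> 0) (at r0 within {s..t})"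
  proof (rule Lim_null_comparison)
    show "\<forall>\<^sub>F r in at r0 within {s..t}. norm (heat (t - r) (G r - G r0)) \<le> norm (G r - G r0)"
      by (auto simp: eventually_at_filter intro!: always_eventually norm_heat_le)
    show "((\<lambda>r. norm (G r - G r0)) \<longlongrightarrow> 0) (at r0 within {s..t})"
      using 2 by (simp add: LIM_zero_iff tendsto_norm_zero_iff)
  qed
  have "((\<lambda>r. heat (t - r) (G r - G r0) + heat (t - r) (G r0)) \<longlongrightarrow> 0 + heat (t - r0) (G r0)) (at r0 within {s..t})"
    by (rule tendsto_add[OF 3 1])
  moreover have "\<forall>\<^sub>F r in at r0 within {s..t}. heat (t - r) (G r - G r0) + heat (t - r) (G r0) = heat (t - r) (G r)"
    by (auto simp: eventually_at_filter heat_diff intro!: always_eventually)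
  ultimately show "((\<lambda>r. heat (t - r) (G r)) \<longlongrightarrow> heat (t - r0) (G r0)) (at r0 within {s..t})"
    using tendsto_cong by force
qed

section \<open>Maximum principle for the heat semigroup\<close>

lemma DERIV_second_local_min:
  fixes p q :: "real \<Rightarrow> real"
  assumes p: "\<And>x. \<bar>x0 - x\<bar> < d \<Longrightarrow> (p has_real_derivative q x) (at x)" and q: "(q has_real_derivative l) (at x0)"
    and d: "0 < d" and min: "\<And>x. \<bar>x0 - x\<bar> < d \<Longrightarrow> p x0 \<le> p x"
  shows "0 \<le> l"
proof (rule ccontr)
  assume "\<not> 0 \<le> l"
  then have "l < 0" by simp
  from DERIV_neg_dec_right[OF q this] obtain e where e: "0 < e" "\<And>h. 0 < h \<Longrightarrow> h < e \<Longrightarrow> q (x0 + h) < q x0"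
    by blast
  have "q x0 = 0" by (rule DERIV_local_min[OF p d]) (use min d in auto)
  define h where "h = min d e / 2"
  have h: "0 < h" "h < d" "h < e" using d e by (auto simp: h_def)
  have "isCont p x" if "\<bar>x0 - x\<bar> < d" for x using p[OF that] by (rule DERIV_isCont)
  then have cp: "continuous_on {x0..x0 + h} p"
    using h by (intro continuous_at_imp_continuous_on) auto
  have "p x0 > p (x0 + h)"
  proof (rule DERIV_neg_imp_decreasing_open[OF _ _ cp])
    fix x assume "x0 < x" "x < x0 + h"
    then show "\<exists>y. (p has_real_derivative y) (at x) \<and> y < 0"
      using p[of x] e(2)[of "x - x0"] h \<open>q x0 = 0\<close> by auto
  qed (use h in auto)
  moreover have "p x0 \<le> p (x0 + h)" using h by (intro min) auto
  ultimately show False by simp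
qed

text \<open>Finite sums are smooth up to the initial time, so the classical argument applies: after
  adding \<open>e * t\<close>, a minimum below \<open>- M\<close> lies neither on the lateral
  boundary nor at time 0, and an interior one contradicts the heat equation.\<close>

lemma sine_sum_lower_bound:
  fixes a :: "nat \<Rightarrow> real" and N :: nat
  defines "v \<equiv> \<lambda>t x. \<Sum>n<N. a n * exp (- (real n)\<^sup>2 * t) * sin (real n * x)"
  assumes M: "0 \<le> M" and init: "\<And>x. x \<in> {0..pi} \<Longrightarrow> - M \<le> v 0 x" and t: "0 \<le> t" and x: "x \<in> {0..pi}"
  shows "- M \<le> v t x"
proof (rule ccontr)
  assume neg: "\<not> - M \<le> v t x"
  \<comment> \<open>Only half of the defect is spent: the perturbed function is still below
    \<open>- M\<close> at the given point.\<close>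
  define e where "e = (- M - v t x) / (2 * (t + 1))"
  have e: "0 < e" using neg t by (auto simp: e_def)
  have zneg: "v t x + e * t < - M"
  proof -
    have "e * (t + 1) = (- M - v t x) / 2" using t by (simp add: e_def field_simps)
    then have "e * t \<le> (- M - v t x) / 2" using e by (simp add: distrib_left)
    moreover have "v t x < - M" using neg by simp
    ultimately show ?thesis by (simp add: field_simps)
  qed
  define z where "z = (\<lambda>(t, x). v t x + e * t)"
  have "compact ({0..t} \<times> {0..pi})" by (intro compact_Times compact_Icc)
  moreover have "{0..t} \<times> {0..pi} \<noteq> {}" using t by auto
  moreover have "continuous_on ({0..t} \<times> {0..pi}) z"
    unfolding z_def v_def case_prod_beta by (intro continuous_intros)
  ultimately obtain p where p: "p \<in> {0..t} \<times> {0..pi}" "\<And>q. q \<in> {0..t} \<times> {0..pi} \<Longrightarrow> z p \<le> z q"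
    using continuous_attains_inf by metis
  obtain t0 x0 where p_eq: "p = (t0, x0)" by force
  have t0: "0 \<le> t0" "t0 \<le> t" and x0: "0 \<le> x0" "x0 \<le> pi" using p p_eq by auto
  have min: "v t0 x0 + e * t0 \<le> v t' x' + e * t'" if "t' \<in> {0..t}" "x' \<in> {0..pi}" for t' x'
    using p(2)[of "(t', x')"] that by (simp add: p_eq z_def)
  have z0: "v t0 x0 + e * t0 < - M" using min[of t x] zneg t x by auto
  have "t0 \<noteq> 0" using z0 init[of x0] x0 by auto
  then have t0p: "0 < t0" using t0 by simp
  have bd: "v t' 0 = 0" "v t' pi = 0" for t'
    unfolding v_def by (simp_all add: sin_npi)
  have "0 \<le> e * t0" using e t0 by simp
  then have "x0 \<noteq> 0" "x0 \<noteq> pi" using z0 bd[of t0] M by auto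
  then have x0p: "0 < x0" "x0 < pi" using x0 by auto
  \<comment> \<open>\<open>l\<close> is both the time derivative and the second space derivative of
    \<open>v\<close> at the minimum, since every mode solves the heat equation.\<close>
  define l where "l = (\<Sum>n<N. - (real n)\<^sup>2 * a n * exp (- (real n)\<^sup>2 * t0) * sin (real n * x0))"
  have dt: "((\<lambda>s. v s x0 + e * s) has_real_derivative (l + e)) (at t0)"
    unfolding v_def l_def
    by (auto intro!: derivative_eq_intros sum.cong simp: sum_distrib_left mult_ac)
  \<comment> \<open>The minimum may occur at the final time, so only comparison with earlier times
    is available.\<close>
  have le: "l + e \<le> 0"
  proof (rule ccontr)
    assume "\<not> l + e \<le> 0"
    then obtain d where d: "0 < d" "\<And>h. 0 < h \<Longrightarrow> h < d \<Longrightarrow> v (t0 - h) x0 + e * (t0 - h) < v t0 x0 + e * t0"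
      using DERIV_pos_inc_left[OF dt] by auto
    define h where "h = min d t0 / 2"
    have "0 < h" "h < d" "h \<le> t0" using d t0p by (auto simp: h_def)
    then show False using d(2)[of h] min[of "t0 - h" x0] t0 x0 by auto
  qed
  define q where "q x = (\<Sum>n<N. a n * exp (- (real n)\<^sup>2 * t0) * (real n * cos (real n * x)))" for x
  have dp: "((\<lambda>x. v t0 x) has_real_derivative q x) (at x)" for x
    unfolding v_def q_def by (auto intro!: derivative_eq_intros sum.cong simp: mult_ac)
  have dq: "(q has_real_derivative l) (at x0)"
    unfolding q_def l_def by (auto intro!: derivative_eq_intros sum.cong simp: mult_ac power2_eq_square)
  have "0 \<le> l"
  proof (rule DERIV_second_local_min[OF dp dq])
    show "0 < min x0 (pi - x0)" using x0p by simp
    fix x assume "\<bar>x0 - x\<bar> < min x0 (pi - x0)"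
    then have "x \<in> {0..pi}" by auto
    then show "v t0 x0 \<le> v t0 x" using min[of t0 x] t0 by auto
  qed
  then show False using le e by simp
qed

text \<open>Truncation spoils the lower bound of \<open>u\<close> by at most \<open>e N\<close>,
  uniformly in space, because the sine series converges in the norm; the error vanishes in the
  limit.\<close>

lemma heat_lower_bound:
  assumes M: "0 \<le> M" and u: "\<And>x. x \<in> {0..pi} \<Longrightarrow> - M \<le> h10_fun u x" and t: "0 \<le> t"
  shows "- M \<le> h10_fun (heat t u) x"
proof (cases "x \<in> {0..pi}")
  case False
  then show ?thesis using M by (simp add: h10_fun_outside)
next
  case x: True
  define P where "P N = (\<Sum>n<N. sc n u *\<^sub>R sine_mode n)" for N
  define e where "e N = 3 * norm (P N - u)" for N
  have P: "P \<longlonglongrightarrow> u" using sine_expansion[of u] by (simp add: sums_def P_def[abs_def])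
  then have "(\<lambda>N. norm (P N - u)) \<longlonglongrightarrow> 0" by (simp add: LIM_zero_iff tendsto_norm_zero_iff)
  from tendsto_mult_left[OF this, of 3] have e: "e \<longlonglongrightarrow> 0" by (simp add: e_def[abs_def])
  have Pf: "h10_fun (\<Sum>n<N. (exp (- (real n)\<^sup>2 * t) * sc n u) *\<^sub>R sine_mode n) y =
      (\<Sum>n<N. sc n u * exp (- (real n)\<^sup>2 * t) * sin (real n * y))" if "y \<in> {0..pi}" for N t y
    using that by (simp add: h10_fun_sum h10_fun_sine_mode mult_ac)
  have low: "- (M + e N) \<le> (\<Sum>n<N. sc n u * exp (- (real n)\<^sup>2 * t) * sin (real n * x))" for N
  proof (rule sine_sum_lower_bound[OF _ _ t x])
    show "0 \<le> M + e N" using M by (simp add: e_def)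
    fix y assume y: "y \<in> {0..pi}"
    have "h10_fun (P N) y = (\<Sum>n<N. sc n u * exp (- (real n)\<^sup>2 * 0) * sin (real n * y))"
      using Pf[OF y, of 0 N] by (simp add: P_def)
    moreover have "\<bar>h10_fun (P N) y - h10_fun u y\<bar> \<le> e N"
      using h10_fun_bound[of "P N - u" y] by (simp add: e_def)
    ultimately show "- (M + e N) \<le> (\<Sum>n<N. sc n u * exp (- (real n)\<^sup>2 * 0) * sin (real n * y))"
      using u[OF y] by linarith
  qed
  have "(\<lambda>N. \<Sum>n<N. (exp (- (real n)\<^sup>2 * t) * sc n u) *\<^sub>R sine_mode n) \<longlonglongrightarrow> heat t u"
    unfolding heat_eq by (intro summable_LIMSEQ summable_sine_series summable_heat t)
  from tendsto_h10_fun[OF this, of x]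
  have "(\<lambda>N. \<Sum>n<N. sc n u * exp (- (real n)\<^sup>2 * t) * sin (real n * x)) \<longlonglongrightarrow> h10_fun (heat t u) x"
    by (simp only: Pf[OF x])
  moreover have "(\<lambda>N. - (M + e N)) \<longlonglongrightarrow> - (M + 0)"
    by (intro tendsto_minus tendsto_add tendsto_const e)
  ultimately have "- (M + 0) \<le> h10_fun (heat t u) x"
    using low by (intro LIMSEQ_le[of "\<lambda>N. - (M + e N)"]) auto
  then show ?thesis by simp
qed

lemma heat_nonneg:
  "(\<And>x. x \<in> {0..pi} \<Longrightarrow> 0 \<le> h10_fun u x) \<Longrightarrow> 0 \<le> t \<Longrightarrow> 0 \<le> h10_fun (heat t u) x"
  using heat_lower_bound[of 0 u t x] by simp

lemma heat_upper_bound: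
  assumes "0 \<le> M" "\<And>x. x \<in> {0..pi} \<Longrightarrow> h10_fun u x \<le> M" "0 \<le> t"
  shows "h10_fun (heat t u) x \<le> M"
  using heat_lower_bound[of M "- u" t x] assms by (simp add: heat_minus)

lemma heat_abs_bound:
  assumes "\<And>x. x \<in> {0..pi} \<Longrightarrow> \<bar>h10_fun u x\<bar> \<le> M" "0 \<le> t"
  shows "\<bar>h10_fun (heat t u) x\<bar> \<le> M"
proof -
  have "0 \<le> M" using assms(1)[of 0] by simp
  then show ?thesis
    using heat_lower_bound[of M u t x] heat_upper_bound[of M u t x] assms
    by (auto simp: abs_le_iff minus_le_iff)
qed

section \<open>The inhomogeneous heat equation\<close>

text \<open>The equation \<open>u_t = u_xx + G\<close>, tested against each sine mode. This requires
  no regularity in space beyond \<open>h10\<close>; at time \<open>s\<close> the derivative is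
  one-sided.\<close>

definition lin_sol :: "real \<Rightarrow> (real \<Rightarrow> h10) \<Rightarrow> (real \<Rightarrow> h10) \<Rightarrow> bool" where
  "lin_sol s u G \<longleftrightarrow> continuous_on {s..} u \<and> continuous_on {s..} G \<and>
    (\<forall>n. \<forall>t\<ge>s. ((\<lambda>t. sc n (u t)) has_real_derivative (sc n (G t) - (real n)\<^sup>2 * sc n (u t))) (at t within {s..}))"

lemma lin_solD:
  assumes "lin_sol s u G"
  shows "continuous_on {s..} u" "continuous_on {s..} G"
    "t \<ge> s \<Longrightarrow> ((\<lambda>t. sc n (u t)) has_real_derivative (sc n (G t) - (real n)\<^sup>2 * sc n (u t))) (at t within {s..})"
  using assms by (auto simp: lin_sol_def)

lemma lin_sol_restrict: "lin_sol s u G \<Longrightarrow> s \<le> s' \<Longrightarrow> lin_sol s' u G"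
  unfolding lin_sol_def
  by (intro conjI allI impI; elim conjE)
    (auto intro: continuous_on_subset DERIV_subset[where s = "{s..}"])

lemma lin_sol_diff:
  assumes "lin_sol s u G" "lin_sol s v H"
  shows "lin_sol s (\<lambda>t. u t - v t) (\<lambda>t. G t - H t)"
  using assms unfolding lin_sol_def
  by (auto intro!: continuous_intros derivative_eq_intros simp: algebra_simps)

lemma lin_sol_add:
  assumes "lin_sol s u G" "lin_sol s v H"
  shows "lin_sol s (\<lambda>t. u t + v t) (\<lambda>t. G t + H t)"
  using assms unfolding lin_sol_def
  by (auto intro!: continuous_intros derivative_eq_intros simp: algebra_simps)

lemma lin_sol_scale:
  assumes "lin_sol s u G"
  shows "lin_sol s (\<lambda>t. c *\<^sub>R u t) (\<lambda>t. c *\<^sub>R G t)"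
  using assms unfolding lin_sol_def
  by (auto intro!: continuous_intros derivative_eq_intros simp: algebra_simps)

lemma at_within_atLeastAtMost: "t < T \<Longrightarrow> at t within {s..T} = at t within {s..}" for t :: real
  by (rule at_within_nhd[of t "{..<T}"]) auto

lemma continuous_on_halfline:
  fixes f :: "real \<Rightarrow> 'a::topological_space"
  assumes "\<And>T. s \<le> T \<Longrightarrow> continuous_on {s..T} f"
  shows "continuous_on {s..} f"
  unfolding continuous_on_def
proof
  fix t assume t: "t \<in> {s..}"
  then have "(f \<longlongrightarrow> f t) (at t within {s..t + 1})"
    using assms[of "t + 1"] unfolding continuous_on_def by auto
  then show "(f \<longlongrightarrow> f t) (at t within {s..})"
    by (simp add: at_within_atLeastAtMost)
qed

text \<open>Both sides are compared coefficientwise, by the fundamental theorem with an integrating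
  factor. The term \<open>c u\<close> is added and subtracted: \<open>c = 0\<close> gives the mild
  formula, and a positive \<open>c\<close> controls the sign of the shifted source.\<close>

lemma duhamel:
  assumes sol: "lin_sol s u G" and st: "s \<le> t"
  shows "((\<lambda>r. exp (- c * (t - r)) *\<^sub>R heat (t - r) (G r + c *\<^sub>R u r)) has_integral
           (u t - exp (- c * (t - s)) *\<^sub>R heat (t - s) (u s))) {s..t}"
proof -
  note D = lin_solD[OF sol]
  let ?f = "\<lambda>r. exp (- c * (t - r)) *\<^sub>R heat (t - r) (G r + c *\<^sub>R u r)"
  have "continuous_on {s..t} G" "continuous_on {s..t} u"
    using D(1,2) by (auto intro: continuous_on_subset)
  then have "continuous_on {s..t} ?f"
    by (intro continuous_intros continuous_on_heat_diff)
  then obtain I where I: "(?f has_integral I) {s..t}"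
    using integrable_continuous_real unfolding integrable_on_def by blast
  have "sc n I = sc n (u t - exp (- c * (t - s)) *\<^sub>R heat (t - s) (u s))" for n
  proof -
    let ?k = "(real n)\<^sup>2 + c"
    have "((\<lambda>r. sc n (?f r)) has_integral sc n I) {s..t}"
      using has_integral_linear[OF I bounded_linear_sc[of n]] by (simp add: o_def)
    moreover have "((\<lambda>r. sc n (?f r)) has_integral
        (exp (- ?k * (t - t)) * sc n (u t) - exp (- ?k * (t - s)) * sc n (u s))) {s..t}"
    proof (rule fundamental_theorem_of_calculus[OF st])
      fix r assume r: "r \<in> {s..t}"
      have "((\<lambda>r. sc n (u r)) has_real_derivative (sc n (G r) - (real n)\<^sup>2 * sc n (u r))) (at r within {s..t})"
        using r by (intro DERIV_subset[OF D(3)]) auto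
      then have "((\<lambda>r. exp (- ?k * (t - r)) * sc n (u r)) has_real_derivative
          exp (- ?k * (t - r)) * (sc n (G r) + c * sc n (u r))) (at r within {s..t})"
        by (auto intro!: derivative_eq_intros simp: algebra_simps)
      moreover have "sc n (?f r) = exp (- ?k * (t - r)) * (sc n (G r) + c * sc n (u r))"
      proof -
        have "exp (- ?k * (t - r)) = exp (- c * (t - r)) * exp (- (real n)\<^sup>2 * (t - r))"
          by (simp add: exp_add[symmetric] algebra_simps)
        then show ?thesis using r by (simp add: sc_heat)
      qed
      ultimately show "((\<lambda>r. exp (- ?k * (t - r)) * sc n (u r)) has_vector_derivative sc n (?f r)) (at r within {s..t})"
        by (simp add: has_real_derivative_iff_has_vector_derivative)
    qed
    ultimately have "sc n I = exp (- ?k * (t - t)) * sc n (u t) - exp (- ?k * (t - s)) * sc n (u s)"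
      by (rule has_integral_unique)
    moreover have "exp (- ?k * (t - s)) = exp (- c * (t - s)) * exp (- (real n)\<^sup>2 * (t - s))"
      by (simp add: exp_add[symmetric] algebra_simps)
    ultimately show ?thesis using st by (simp add: sc_heat)
  qed
  then have "I = u t - exp (- c * (t - s)) *\<^sub>R heat (t - s) (u s)" by (simp add: h10_eq_iff_sc)
  then show ?thesis using I by simp
qed

lemma duhamel_at:
  assumes sol: "lin_sol s u G" and st: "s \<le> t"
  shows "((\<lambda>r. exp (- c * (t - r)) * h10_fun (heat (t - r) (G r + c *\<^sub>R u r)) x) has_integral
           (h10_fun (u t) x - exp (- c * (t - s)) * h10_fun (heat (t - s) (u s)) x)) {s..t}"
  using has_integral_linear[OF duhamel[OF sol st, of c] bounded_linear_h10_fun[of x]]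
  by (simp add: o_def)

lemma exp_series_tail: "(\<lambda>k. (z::real) ^ k / fact k) \<longlonglongrightarrow> 0"
  using summable_LIMSEQ_zero[OF summable_exp[of z]] by (simp add: field_simps)

lemma has_integral_power:
  fixes s t :: real assumes "s \<le> t"
  shows "((\<lambda>r. (r - s) ^ k) has_integral ((t - s) ^ Suc k / real (Suc k))) {s..t}"
proof -
  have "((\<lambda>r. (r - s) ^ k) has_integral ((t - s) ^ Suc k / real (Suc k) - (s - s) ^ Suc k / real (Suc k))) {s..t}"
  proof (rule fundamental_theorem_of_calculus[OF assms])
    fix r
    have "((\<lambda>r. (r - s) ^ Suc k / real (Suc k)) has_real_derivative (real (Suc k) * (r - s) ^ k / real (Suc k))) (at r within {s..t})"
      using DERIV_cdivide[OF DERIV_power_Suc[OF DERIV_diff[OF DERIV_ident DERIV_const]], where c = "real (Suc k)"]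
      by (simp only: of_nat_Suc diff_0_right mult_1_left)
    then show "((\<lambda>r. (r - s) ^ Suc k / real (Suc k)) has_vector_derivative (r - s) ^ k) (at r within {s..t})"
      unfolding has_real_derivative_iff_has_vector_derivative[symmetric] by (simp del: of_nat_Suc)
  qed
  then show ?thesis by simp
qed

text \<open>The shift by \<open>K\<close> makes \<open>G + K w\<close> bounded below by a multiple of the negative part
  of \<open>w\<close>; the lower bound for \<open>w\<close> is then improved iteratively, as in Gronwall's lemma.\<close>

lemma comparison:
  assumes sol: "lin_sol s w G" and K: "0 \<le> K"
    and init: "\<And>x. x \<in> {0..pi} \<Longrightarrow> 0 \<le> h10_fun (w s) x"
    and G: "\<And>t x. t \<in> {s..T} \<Longrightarrow> x \<in> {0..pi} \<Longrightarrow> - K * \<bar>h10_fun (w t) x\<bar> \<le> h10_fun (G t) x"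
    and t: "t \<in> {s..T}"
  shows "0 \<le> h10_fun (w t) x"
proof -
  have "continuous_on {s..T} w" using lin_solD(1)[OF sol] by (rule continuous_on_subset) auto
  then have "bounded (w ` {s..T})" by (intro compact_imp_bounded compact_continuous_image compact_Icc)
  then obtain B0 where "\<forall>y\<in>w ` {s..T}. norm y \<le> B0" unfolding bounded_iff by blast
  then have B0: "\<And>t. t \<in> {s..T} \<Longrightarrow> norm (w t) \<le> B0" by blast
  define B where "B = 3 * B0"
  have B: "\<bar>h10_fun (w t) x\<bar> \<le> B" if "t \<in> {s..T}" for t x
    using h10_fun_bound[of "w t" x] B0[OF that] by (simp add: B_def)
  have B_nonneg: "0 \<le> B" using B[OF t, of 0] by simp
  have *: "- (B * (2 * K * (t - s)) ^ k / fact k) \<le> h10_fun (w t) x" if "t \<in> {s..T}" for t x k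
    using that
  proof (induction k arbitrary: t x)
    case 0
    then show ?case using B[of t x] by simp
  next
    case (Suc k)
    then have st: "s \<le> t" by simp
    define m where "m r = 2 * K * (B * (2 * K) ^ k / fact k) * (r - s) ^ k" for r
    have mnn: "0 \<le> m r" if "r \<in> {s..t}" for r
      using K B_nonneg that by (auto simp: m_def)
    have lower: "- m r \<le> exp (- K * (t - r)) * h10_fun (heat (t - r) (G r + K *\<^sub>R w r)) x" if r: "r \<in> {s..t}" for r
    proof -
      have "- m r \<le> h10_fun (heat (t - r) (G r + K *\<^sub>R w r)) x"
      proof (rule heat_lower_bound[OF mnn[OF r]])
        fix y assume y: "y \<in> {0..pi}"
        have rT: "r \<in> {s..T}" using r Suc.prems by auto
        have "- (B * (2 * K * (r - s)) ^ k / fact k) \<le> h10_fun (w r) y"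
          by (rule Suc.IH[OF rT])
        moreover have "0 \<le> B * (2 * K * (r - s)) ^ k / fact k"
          using K B_nonneg r by auto
        \<comment> \<open>\<open>w - |w|\<close> vanishes where \<open>w \<ge> 0\<close> and is
          twice \<open>w\<close> elsewhere; this is the origin of the factor 2 in
          \<open>2 * K\<close>.\<close>
        ultimately have "- (2 * (B * (2 * K * (r - s)) ^ k / fact k)) \<le> h10_fun (w r) y - \<bar>h10_fun (w r) y\<bar>"
          by linarith
        then have "K * - (2 * (B * (2 * K * (r - s)) ^ k / fact k)) \<le> K * (h10_fun (w r) y - \<bar>h10_fun (w r) y\<bar>)"
          using K by (rule mult_left_mono)
        also have "\<dots> \<le> h10_fun (G r + K *\<^sub>R w r) y"
          using G[OF rT y] by (simp add: right_diff_distrib)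
        also have "K * - (2 * (B * (2 * K * (r - s)) ^ k / fact k)) = - m r"
          by (simp add: m_def power_mult_distrib)
        finally show "- m r \<le> h10_fun (G r + K *\<^sub>R w r) y" .
      qed (use r in auto)
      then have "exp (- K * (t - r)) * - m r \<le> exp (- K * (t - r)) * h10_fun (heat (t - r) (G r + K *\<^sub>R w r)) x"
        by (intro mult_left_mono) auto
      moreover have "exp (- K * (t - r)) * m r \<le> 1 * m r"
        using K r mnn[OF r] by (intro mult_right_mono) auto
      ultimately show ?thesis by simp
    qed
    have "((\<lambda>r. - m r) has_integral - (2 * K * (B * (2 * K) ^ k / fact k) * ((t - s) ^ Suc k / real (Suc k)))) {s..t}"
      unfolding m_def by (intro has_integral_neg has_integral_mult_right has_integral_power st)
    from has_integral_le[OF this duhamel_at[OF sol st, of K x]] lower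
    have "- (2 * K * (B * (2 * K) ^ k / fact k) * ((t - s) ^ Suc k / real (Suc k))) \<le>
        h10_fun (w t) x - exp (- K * (t - s)) * h10_fun (heat (t - s) (w s)) x" by blast
    moreover have "0 \<le> exp (- K * (t - s)) * h10_fun (heat (t - s) (w s)) x"
      using heat_nonneg[OF init, of "t - s" x] st by (intro mult_nonneg_nonneg) auto
    moreover have "2 * K * (B * (2 * K) ^ k / fact k) * ((t - s) ^ Suc k / real (Suc k)) =
        B * (2 * K * (t - s)) ^ Suc k / fact (Suc k)"
    proof -
      have "2 * K * (B * X / F) * (Y / Z) = B * ((2 * K * X) * Y) / (Z * F)" for X Y Z F :: real by (simp add: mult_ac)
      then show ?thesis
        unfolding power_mult_distrib[of "2 * K"] fact_Suc power_Suc[of "2 * K"] by blast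
    qed
    ultimately show ?case by linarith
  qed
  have "(\<lambda>k. - (B * ((2 * K * (t - s)) ^ k / fact k))) \<longlonglongrightarrow> - (B * 0)"
    by (intro tendsto_minus tendsto_mult tendsto_const exp_series_tail)
  then have "- (B * 0) \<le> h10_fun (w t) x"
    using *[OF t] by (intro LIMSEQ_le_const2) auto
  then show ?thesis by simp
qed

section \<open>Coefficient bounds and solvability of the linear equation\<close>

text \<open>\<open>Q / k\<close> is the equilibrium of the ODE with source \<open>Q\<close>; the
  excess of \<open>a\<close> over it, times the integrating factor, cannot increase.\<close>

lemma ode_upper_bound:
  fixes a g :: "real \<Rightarrow> real"
  assumes d: "\<And>r. r \<in> {s..t} \<Longrightarrow> (a has_real_derivative (g r - k * a r)) (at r within {s..t})"
    and k: "0 < k" and g: "\<And>r. r \<in> {s..t} \<Longrightarrow> g r \<le> Q" and Q: "0 \<le> Q" and st: "s \<le> t"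
  shows "a t \<le> exp (- k * (t - s)) * a s + Q / k"
proof -
  let ?b = "\<lambda>r. exp (k * (r - s)) * (a r - Q / k)"
  have db: "(?b has_real_derivative (exp (k * (r - s)) * (g r - Q))) (at r within {s..t})" if "r \<in> {s..t}" for r
    using k d[OF that] by (auto intro!: derivative_eq_intros simp: field_simps)
  have "?b t \<le> ?b s"
  proof (rule DERIV_nonpos_imp_decreasing_open[OF st])
    fix r assume r: "s < r" "r < t"
    have "at r within {s..t} = at r" using r by (intro at_within_interior) auto
    then show "\<exists>y. (?b has_real_derivative y) (at r) \<and> y \<le> 0"
      using db[of r] g[of r] r by (auto intro!: exI mult_nonneg_nonpos)
  next
    show "continuous_on {s..t} ?b"
      using db by (intro DERIV_continuous_on) auto
  qed
  then have "exp (- k * (t - s)) * ?b t \<le> exp (- k * (t - s)) * ?b s"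
    by (intro mult_left_mono) auto
  then have "a t - Q / k \<le> exp (- k * (t - s)) * (a s - Q / k)"
    by (simp add: mult.assoc[symmetric] exp_add[symmetric])
  also have "\<dots> \<le> exp (- k * (t - s)) * a s"
    using Q k by (intro mult_left_mono) auto
  finally show ?thesis by simp
qed

lemma ode_bound:
  fixes a g :: "real \<Rightarrow> real"
  assumes d: "\<And>r. r \<in> {s..t} \<Longrightarrow> (a has_real_derivative (g r - k * a r)) (at r within {s..t})"
    and k: "0 < k" and g: "\<And>r. r \<in> {s..t} \<Longrightarrow> \<bar>g r\<bar> \<le> Q" and st: "s \<le> t"
  shows "\<bar>a t\<bar> \<le> exp (- k * (t - s)) * \<bar>a s\<bar> + Q / k"
proof -
  have Q: "0 \<le> Q" using g[of s] st by auto
  have "a t \<le> exp (- k * (t - s)) * a s + Q / k"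
    using d k _ Q st by (rule ode_upper_bound) (use g in \<open>auto simp: abs_le_iff\<close>)
  moreover have "- a t \<le> exp (- k * (t - s)) * - a s + Q / k"
  proof (rule ode_upper_bound[OF _ k _ Q st])
    fix r assume r: "r \<in> {s..t}"
    show "((\<lambda>r. - a r) has_real_derivative (- g r - k * - a r)) (at r within {s..t})"
      using DERIV_minus[OF d[OF r]] by simp
    show "- g r \<le> Q" using g[OF r] by simp
  qed
  moreover have "exp (- k * (t - s)) * a s \<le> exp (- k * (t - s)) * \<bar>a s\<bar>"
    "exp (- k * (t - s)) * - a s \<le> exp (- k * (t - s)) * \<bar>a s\<bar>"
    by (intro mult_left_mono; simp)+
  ultimately show ?thesis by (simp only: abs_le_iff) linarith
qed

text \<open>Parabolic smoothing: the bounds on the coefficients of \<open>u t\<close> are square summable with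
  weight \<open>n\<^sup>2\<close>, uniformly in \<open>c\<close>.\<close>

lemma lin_sol_norm_bound:
  assumes sol: "lin_sol s u (\<lambda>t. G t - c *\<^sub>R u t)" and c: "0 \<le> c" and st: "s \<le> t"
    and G: "\<And>r x. r \<in> {s..t} \<Longrightarrow> x \<in> {0..pi} \<Longrightarrow> \<bar>h10_fun (G r) x\<bar> \<le> Q"
    and init: "\<And>n. 0 < n \<Longrightarrow> exp (- (real n)\<^sup>2 * (t - s)) * \<bar>sc n (u s)\<bar> \<le> R / (real n)\<^sup>2"
  shows "norm (u t) \<le> sine_const * (R + 2 * Q)"
proof (rule norm_le_sc)
  fix n :: nat assume n: "0 < n"
  let ?k = "(real n)\<^sup>2 + c"
  have Q: "0 \<le> Q" using G[of s 0] st by auto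
  have k: "0 < ?k" using n c by (simp add: add_pos_nonneg)
  have "\<bar>sc n (u t)\<bar> \<le> exp (- ?k * (t - s)) * \<bar>sc n (u s)\<bar> + 2 * Q / ?k"
  proof (rule ode_bound[OF _ k _ st])
    fix r assume r: "r \<in> {s..t}"
    show "\<bar>sc n (G r)\<bar> \<le> 2 * Q" by (rule sc_abs_le) (rule G[OF r])
    show "((\<lambda>r. sc n (u r)) has_real_derivative (sc n (G r) - ?k * sc n (u r))) (at r within {s..t})"
      using DERIV_subset[OF lin_solD(3)[OF sol, of r n], of "{s..t}"] r by (auto simp: algebra_simps)
  qed
  also have "exp (- ?k * (t - s)) * \<bar>sc n (u s)\<bar> \<le> exp (- (real n)\<^sup>2 * (t - s)) * \<bar>sc n (u s)\<bar>"
    using mult_nonneg_nonneg[of c "t - s"] c st by (intro mult_right_mono) (auto simp: algebra_simps)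
  also have "\<dots> \<le> R / (real n)\<^sup>2" by (rule init[OF n])
  also have "2 * Q / ?k \<le> 2 * Q / (real n)\<^sup>2"
    using c n Q by (intro divide_left_mono) (auto simp: add_pos_nonneg)
  finally show "\<bar>sc n (u t)\<bar> \<le> (R + 2 * Q) / (real n)\<^sup>2"
    by (simp add: add_divide_distrib)
qed

text \<open>Variation of constants solves each coefficient equation, and the resulting series is
  shown to stay in \<open>h10\<close>. The damping \<open>c\<close> is part of the equation because
  the Picard iteration treats it implicitly.\<close>

lemma lin_solve:
  assumes G: "continuous_on {s..} G" and c: "0 \<le> c"
  obtains u where "u s = u0" "lin_sol s u (\<lambda>t. G t - c *\<^sub>R u t)"
proof -
  define k where "k n = (real n)\<^sup>2 + c" for n :: nat
  define F where "F n t = integral {s..t} (\<lambda>r. exp (k n * (r - s)) * sc n (G r))" for n t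
  define a where "a n t = exp (- k n * (t - s)) * (sc n u0 + F n t)" for n t
  have dF: "(F n has_real_derivative (exp (k n * (t - s)) * sc n (G t))) (at t within {s..})" if t: "s \<le> t" for n t
  proof -
    have "continuous_on {s..t + 1} G" by (rule continuous_on_subset[OF G]) auto
    then have "continuous_on {s..t + 1} (\<lambda>r. exp (k n * (r - s)) * sc n (G r))"
      by (intro continuous_intros continuous_on_sc)
    from integral_has_real_derivative[OF this, of t] t show ?thesis
      by (simp add: F_def[abs_def] at_within_atLeastAtMost)
  qed
  have da: "(a n has_real_derivative (sc n (G t) - k n * a n t)) (at t within {s..})" if t: "s \<le> t" for n t
  proof -
    have "(a n has_real_derivative (- k n * exp (- k n * (t - s)) * (sc n u0 + F n t) +
        exp (- k n * (t - s)) * (exp (k n * (t - s)) * sc n (G t)))) (at t within {s..})"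
      unfolding a_def[abs_def] by (auto intro!: derivative_eq_intros dF[OF t])
    also have "exp (- k n * (t - s)) * (exp (k n * (t - s)) * sc n (G t)) = sc n (G t)"
      by (simp add: mult.assoc[symmetric] exp_add[symmetric])
    finally show ?thesis unfolding a_def[abs_def] by (simp add: mult.assoc)
  qed
  have ca: "continuous_on {s..} (a n)" for n
    using da by (intro DERIV_continuous_on) auto
  define u where "u t = (\<Sum>n. a n t *\<^sub>R sine_mode n)" for t
  have main: "continuous_on {s..T} u \<and> (\<forall>t\<in>{s..T}. summable (\<lambda>n. (real n * a n t)\<^sup>2))" if T: "s \<le> T" for T
  proof -
    have "continuous_on {s..T} G" by (rule continuous_on_subset[OF G]) auto
    then have "bounded (G ` {s..T})" by (intro compact_imp_bounded compact_continuous_image compact_Icc)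
    then obtain Q where "\<forall>y\<in>G ` {s..T}. norm y \<le> Q" unfolding bounded_iff by blast
    then have Q: "\<And>t. t \<in> {s..T} \<Longrightarrow> norm (G t) \<le> Q" by blast
    have Qnn: "0 \<le> Q" using Q[of s] T norm_ge_zero order_trans by (metis atLeastAtMost_iff order_refl)
    \<comment> \<open>The first term is square summable since \<open>u0\<close> lies in
      \<open>h10\<close>, the second since the rate \<open>n^2\<close> in the denominator outweighs
      the weight \<open>n\<close>. The factor 6 combines \<open>sc_abs_le\<close> and
      \<open>h10_fun_bound\<close>.\<close>
    define b where "b n = \<bar>real n * sc n u0\<bar> + 6 * Q * (1 / real n)" for n
    have sb: "summable (\<lambda>n. (b n)\<^sup>2)"
    proof (rule summable_comparison_test'[of _ 0])
      show "summable (\<lambda>n. 2 * \<bar>real n * sc n u0\<bar>\<^sup>2 + 2 * ((6 * Q)\<^sup>2 * (1 / real n)\<^sup>2))"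
        by (intro summable_add summable_mult summable_abs_sc summable_inverse_square)
      fix n
      have "0 \<le> (\<bar>real n * sc n u0\<bar> - 6 * Q * (1 / real n))\<^sup>2" by simp
      then have "(b n)\<^sup>2 \<le> 2 * \<bar>real n * sc n u0\<bar>\<^sup>2 + 2 * (6 * Q * (1 / real n))\<^sup>2"
        unfolding b_def power2_sum power2_diff by linarith
      then show "norm ((b n)\<^sup>2) \<le> 2 * \<bar>real n * sc n u0\<bar>\<^sup>2 + 2 * ((6 * Q)\<^sup>2 * (1 / real n)\<^sup>2)"
        unfolding power_mult_distrib[of "6 * Q"] by simp
    qed
    have le: "\<bar>real n * a n t\<bar> \<le> b n" if t: "t \<in> {s..T}" for n t
    proof (cases "n = 0")
      case False
      then have k: "0 < k n" using c by (simp add: k_def add_pos_nonneg)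
      have "\<bar>a n t\<bar> \<le> exp (- k n * (t - s)) * \<bar>a n s\<bar> + 6 * Q / k n"
      proof (rule ode_bound[OF _ k])
        fix r assume r: "r \<in> {s..t}"
        show "(a n has_real_derivative (sc n (G r) - k n * a n r)) (at r within {s..t})"
          using r by (intro DERIV_subset[OF da]) auto
        have "\<bar>sc n (G r)\<bar> \<le> 2 * (3 * Q)"
        proof (rule sc_abs_le)
          fix x show "\<bar>h10_fun (G r) x\<bar> \<le> 3 * Q"
            using h10_fun_bound[of "G r" x] Q[of r] r t by auto
        qed
        then show "\<bar>sc n (G r)\<bar> \<le> 6 * Q" by simp
      qed (use t in auto)
      also have "\<dots> \<le> 1 * \<bar>a n s\<bar> + 6 * Q / (real n)\<^sup>2"
        using k t False c Qnn mult_nonneg_nonneg[of "k n" "t - s"]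
        by (intro add_mono mult_right_mono divide_left_mono) (auto simp: k_def add_pos_nonneg algebra_simps)
      also have "a n s = sc n u0" by (simp add: a_def F_def)
      finally have "real n * \<bar>a n t\<bar> \<le> real n * (1 * \<bar>sc n u0\<bar> + 6 * Q / (real n)\<^sup>2)"
        by (intro mult_left_mono) auto
      also have "\<dots> = b n"
        using False by (simp add: b_def abs_mult distrib_left power2_eq_square)
      finally show ?thesis by (simp add: abs_mult)
    qed (auto simp: b_def)
    have "continuous_on {s..T} (a n)" for n
      by (rule continuous_on_subset[OF ca]) auto
    from continuous_on_sine_series[OF this sb le] show ?thesis unfolding u_def by blast
  qed
  have scu: "sc n (u t) = a n t" if t: "s \<le> t" and n: "0 < n" for n t
    unfolding u_def using main[of t] t n by (intro sc_sine_series) auto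
  have cu: "continuous_on {s..} u" using main by (intro continuous_on_halfline) auto
  have us: "u s = u0"
    unfolding h10_eq_iff_sc
  proof
    fix n show "sc n (u s) = sc n u0"
      by (cases "n = 0") (simp_all add: scu a_def F_def)
  qed
  have "lin_sol s u (\<lambda>t. G t - c *\<^sub>R u t)"
    unfolding lin_sol_def
  proof (intro conjI allI impI cu)
    show "continuous_on {s..} (\<lambda>t. G t - c *\<^sub>R u t)"
      by (intro continuous_intros G cu)
    fix n :: nat and t assume t: "s \<le> t"
    show "((\<lambda>t. sc n (u t)) has_real_derivative sc n (G t - c *\<^sub>R u t) - (real n)\<^sup>2 * sc n (u t)) (at t within {s..})"
    proof (cases "n = 0")
      case False
      have "((\<lambda>t. sc n (u t)) has_real_derivative sc n (G t) - k n * a n t) (at t within {s..})"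
        by (rule has_field_derivative_transform_within[OF da[OF t] zero_less_one]) (use False t scu in auto)
      then show ?thesis using t False by (simp add: scu k_def algebra_simps)
    qed simp
  qed
  with us show ?thesis by (rule that)
qed

section \<open>The nonlinear equation\<close>

definition h10_le :: "h10 \<Rightarrow> h10 \<Rightarrow> bool" (infix "\<preceq>" 50) where
  "u \<preceq> v \<longleftrightarrow> (\<forall>x. h10_fun u x \<le> h10_fun v x)"

lemma h10_leI: "(\<And>x. x \<in> {0<..<pi} \<Longrightarrow> h10_fun u x \<le> h10_fun v x) \<Longrightarrow> u \<preceq> v"
  unfolding h10_le_def
proof
  fix x assume *: "\<And>x. x \<in> {0<..<pi} \<Longrightarrow> h10_fun u x \<le> h10_fun v x"
  show "h10_fun u x \<le> h10_fun v x"
  proof (cases "x \<in> {0<..<pi}")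
    case False
    then have "x = 0 \<or> x = pi \<or> x \<notin> {0..pi}" by auto
    then show ?thesis using h10_fun_outside by auto
  qed (use * in auto)
qed

lemma h10_leD: "u \<preceq> v \<Longrightarrow> h10_fun u x \<le> h10_fun v x"
  by (simp add: h10_le_def)

lemma h10_le_refl [simp]: "u \<preceq> u"
  by (simp add: h10_le_def)

lemma h10_le_trans: "u \<preceq> v \<Longrightarrow> v \<preceq> w \<Longrightarrow> u \<preceq> w"
  unfolding h10_le_def using order_trans by blast

lemma h10_le_antisym: "u \<preceq> v \<Longrightarrow> v \<preceq> u \<Longrightarrow> u = v"
  by (intro h10_eqI) (auto simp: h10_le_def intro: antisym)

definition cube :: "h10 \<Rightarrow> h10" where "cube u = h10_mult u (h10_mult u u)"

lemma h10_fun_cube [simp]: "h10_fun (cube u) x = h10_fun u x ^ 3"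
  by (simp add: cube_def power3_eq_cube)

lemma continuous_on_cube: "continuous_on S f \<Longrightarrow> continuous_on S (\<lambda>t. cube (f t))"
  unfolding cube_def by (intro continuous_on_h10_mult)

text \<open>The function \<open>reaction\<close> as an element of \<open>h10\<close>, so that
  continuity in time is inherited from the algebra structure.\<close>

definition reac :: "real \<Rightarrow> real \<Rightarrow> h10 \<Rightarrow> h10" where
  "reac lam b u = lam *\<^sub>R u - b *\<^sub>R cube u"

lemma h10_fun_reac: "h10_fun (reac lam b u) x = lam * h10_fun u x - b * h10_fun u x ^ 3"
  by (simp add: reac_def)

lemma reac_eq_reaction: "h10_fun (reac lam b u) = reaction lam b (h10_fun u)"
  by (simp add: fun_eq_iff h10_fun_reac reaction_def)

lemma continuous_on_reac:
  "continuous_on S \<beta> \<Longrightarrow> continuous_on S f \<Longrightarrow> continuous_on S (\<lambda>t. reac lam (\<beta> t) (f t))"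
  unfolding reac_def by (intro continuous_intros continuous_on_cube)

text \<open>The differential form of \<open>mild_solution\<close>, with the initial value left to
  \<open>u s\<close>; restriction, scaling and comparison are immediate in this form.\<close>

definition sol :: "real \<Rightarrow> (real \<Rightarrow> real) \<Rightarrow> real \<Rightarrow> (real \<Rightarrow> h10) \<Rightarrow> bool" where
  "sol lam \<beta> s u \<longleftrightarrow> lin_sol s u (\<lambda>t. reac lam (\<beta> t) (u t))"

lemma sol_restrict: "sol lam \<beta> s u \<Longrightarrow> s \<le> s' \<Longrightarrow> sol lam \<beta> s' u"
  unfolding sol_def by (rule lin_sol_restrict)

lemma sol_lin_sol: "sol lam \<beta> s u \<Longrightarrow> lin_sol s u (\<lambda>t. reac lam (\<beta> t) (u t))"
  by (simp add: sol_def)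

lemma sol_continuous: "sol lam \<beta> s u \<Longrightarrow> continuous_on {s..} u"
  by (simp add: sol_def lin_sol_def)

lemma lin_sol_cong:
  assumes "lin_sol s v G" "\<And>t. s \<le> t \<Longrightarrow> u t = v t" "\<And>t. s \<le> t \<Longrightarrow> H t = G t"
  shows "lin_sol s u H"
  unfolding lin_sol_def
proof (intro conjI allI impI)
  show "continuous_on {s..} u" "continuous_on {s..} H"
    using lin_solD(1,2)[OF assms(1)] continuous_on_cong[of "{s..}" "{s..}" u v]
      continuous_on_cong[of "{s..}" "{s..}" H G] assms(2,3) by auto
  fix n t assume t: "s \<le> t"
  have "((\<lambda>t. sc n (v t)) has_real_derivative sc n (H t) - (real n)\<^sup>2 * sc n (u t)) (at t within {s..})"
    using lin_solD(3)[OF assms(1) t, of n] assms t by simp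
  then show "((\<lambda>t. sc n (u t)) has_real_derivative sc n (H t) - (real n)\<^sup>2 * sc n (u t)) (at t within {s..})"
    by (rule has_field_derivative_transform_within[OF _ zero_less_one]) (use assms t in auto)
qed

text \<open>With the reaction frozen along \<open>u\<close>, the linear problem has a solution
  \<open>v\<close>. Duhamel's formula gives \<open>v\<close> and \<open>u\<close> the same integral
  representation, so they agree and \<open>u\<close> inherits the coefficient equations.\<close>

lemma mild_solution_iff:
  assumes \<beta>: "continuous_on UNIV \<beta>"
  shows "mild_solution lam \<beta> s u0 u \<longleftrightarrow> sol lam \<beta> s u \<and> u s = u0"
proof
  assume m: "mild_solution lam \<beta> s u0 u"
  let ?G = "\<lambda>t. reac lam (\<beta> t) (u t)"
  have cu: "continuous_on {s..} u" using m by (simp add: mild_solution_def)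
  have I: "((\<lambda>r. heat (t - r) (?G r)) has_integral (u t - heat (t - s) u0)) {s..t}" if "s \<le> t" for t
    using m that by (simp add: mild_solution_def heat_def reac_eq_reaction)
  have cG: "continuous_on {s..} ?G"
    by (intro continuous_on_reac continuous_on_subset[OF \<beta>] cu) auto
  obtain v where v: "v s = u0" "lin_sol s v (\<lambda>t. ?G t - 0 *\<^sub>R v t)"
    using lin_solve[OF cG order_refl] by metis
  then have vl: "lin_sol s v ?G" by simp
  have uv: "u t = v t" if t: "s \<le> t" for t
  proof -
    have "((\<lambda>r. heat (t - r) (?G r)) has_integral (v t - heat (t - s) u0)) {s..t}"
      using duhamel[OF vl t, of 0] v(1) by simp
    from has_integral_unique[OF this I[OF t]] show ?thesis by simp
  qed
  have "lin_sol s u ?G" by (rule lin_sol_cong[OF vl uv]) auto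
  then show "sol lam \<beta> s u \<and> u s = u0" using uv[of s] v(1) by (simp add: sol_def)
next
  assume s: "sol lam \<beta> s u \<and> u s = u0"
  then have "((\<lambda>r. heat (t - r) (reac lam (\<beta> r) (u r))) has_integral (u t - heat (t - s) u0)) {s..t}" if "s \<le> t" for t
    using duhamel[of s u _ t 0] that by (auto simp: sol_def)
  then show "mild_solution lam \<beta> s u0 u"
    using s by (auto simp: mild_solution_def heat_def reac_eq_reaction sol_continuous)
qed

lemma cubic_lipschitz:
  fixes a c b lam B b2 :: real
  assumes a: "\<bar>a\<bar> \<le> B" and c: "\<bar>c\<bar> \<le> B" and b: "\<bar>b\<bar> \<le> b2"
  shows "\<bar>(lam * a - b * a ^ 3) - (lam * c - b * c ^ 3)\<bar> \<le> (\<bar>lam\<bar> + 3 * b2 * B\<^sup>2) * \<bar>a - c\<bar>"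
proof -
  have B: "0 \<le> B" using a by linarith
  have "a\<^sup>2 \<le> B\<^sup>2" "c\<^sup>2 \<le> B\<^sup>2"
    using a c B by (auto intro!: power2_le_iff_abs_le[THEN iffD2])
  moreover have "\<bar>a * c\<bar> \<le> B\<^sup>2"
    unfolding abs_mult power2_eq_square using a c B by (intro mult_mono) auto
  ultimately have "\<bar>a\<^sup>2 + a * c + c\<^sup>2\<bar> \<le> 3 * B\<^sup>2"
    unfolding abs_le_iff using zero_le_power2[of a] zero_le_power2[of c] by linarith
  then have "\<bar>b\<bar> * \<bar>a\<^sup>2 + a * c + c\<^sup>2\<bar> \<le> b2 * (3 * B\<^sup>2)"
    using b by (intro mult_mono) auto
  then have "\<bar>lam - b * (a\<^sup>2 + a * c + c\<^sup>2)\<bar> \<le> \<bar>lam\<bar> + 3 * b2 * B\<^sup>2"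
    using abs_triangle_ineq4[of lam "b * (a\<^sup>2 + a * c + c\<^sup>2)"] by (simp add: abs_mult)
  then have "\<bar>lam - b * (a\<^sup>2 + a * c + c\<^sup>2)\<bar> * \<bar>a - c\<bar> \<le> (\<bar>lam\<bar> + 3 * b2 * B\<^sup>2) * \<bar>a - c\<bar>"
    by (rule mult_right_mono) simp
  moreover have "(lam * a - b * a ^ 3) - (lam * c - b * c ^ 3) = (lam - b * (a\<^sup>2 + a * c + c\<^sup>2)) * (a - c)"
    by (simp add: algebra_simps power2_eq_square power3_eq_cube)
  ultimately show ?thesis by (simp add: abs_mult)
qed

lemma reac_lipschitz:
  assumes "\<bar>h10_fun u x\<bar> \<le> B" "\<bar>h10_fun v x\<bar> \<le> B" "\<bar>b\<bar> \<le> b2"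
  shows "\<bar>h10_fun (reac lam b u - reac lam b v) x\<bar> \<le> (\<bar>lam\<bar> + 3 * b2 * B\<^sup>2) * \<bar>h10_fun (u - v) x\<bar>"
  using cubic_lipschitz[OF assms, of lam] by (simp add: h10_fun_reac)

lemma continuous_h10_bound:
  fixes u :: "real \<Rightarrow> h10"
  assumes "continuous_on {s..} u"
  obtains B where "0 \<le> B" "\<And>t x. t \<in> {s..T} \<Longrightarrow> \<bar>h10_fun (u t) x\<bar> \<le> B"
proof -
  have "continuous_on {s..T} u" using assms by (rule continuous_on_subset) auto
  then have "bounded (u ` {s..T})" by (intro compact_imp_bounded compact_continuous_image compact_Icc)
  then obtain a where a: "\<forall>y\<in>u ` {s..T}. norm y \<le> a" unfolding bounded_iff by blast
  show ?thesis
  proof (rule that[of "3 * \<bar>a\<bar>"])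
    fix t x assume "t \<in> {s..T}"
    then have "norm (u t) \<le> a" using a by blast
    then show "\<bar>h10_fun (u t) x\<bar> \<le> 3 * \<bar>a\<bar>" using h10_fun_bound[of "u t" x] by linarith
  qed simp
qed

text \<open>The hypothesis compares defects: \<open>G - f(u)\<close> dominates
  \<open>H - f(v)\<close>, where \<open>f\<close> is the reaction. This covers sub- and
  supersolutions alike, and linear comparison problems when the coefficient is 0. A Lipschitz bound
  for \<open>f\<close> on the range of both functions reduces it to
  \<open>comparison\<close>.\<close>

lemma reac_comparison:
  assumes \<beta>: "continuous_on UNIV \<beta>" and u: "lin_sol s u G" and v: "lin_sol s v H"
    and GH: "\<And>r x. r \<in> {s..t} \<Longrightarrow> x \<in> {0..pi} \<Longrightarrow>
      h10_fun (reac lam (\<beta> r) (u r) - reac lam (\<beta> r) (v r)) x \<le> h10_fun (G r - H r) x"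
    and le: "v s \<preceq> u s" and t: "s \<le> t"
  shows "v t \<preceq> u t"
proof -
  obtain B1 where B1: "0 \<le> B1" "\<And>r x. r \<in> {s..t} \<Longrightarrow> \<bar>h10_fun (u r) x\<bar> \<le> B1"
    using continuous_h10_bound[OF lin_solD(1)[OF u]] by metis
  obtain B2 where B2: "0 \<le> B2" "\<And>r x. r \<in> {s..t} \<Longrightarrow> \<bar>h10_fun (v r) x\<bar> \<le> B2"
    using continuous_h10_bound[OF lin_solD(1)[OF v]] by metis
  have "compact (\<beta> ` {s..t})"
    by (intro compact_continuous_image continuous_on_subset[OF \<beta>] compact_Icc) auto
  then have "bounded (\<beta> ` {s..t})" by (rule compact_imp_bounded)
  then obtain b2 where "\<forall>y\<in>\<beta> ` {s..t}. norm y \<le> b2" unfolding bounded_iff by blast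
  then have b2: "\<And>r. r \<in> {s..t} \<Longrightarrow> \<bar>\<beta> r\<bar> \<le> b2" by (metis imageI real_norm_def)
  let ?B = "max B1 B2"
  let ?K = "\<bar>lam\<bar> + 3 * b2 * ?B\<^sup>2"
  have "0 \<le> b2" using b2[of s] t by auto
  show ?thesis
    unfolding h10_le_def
  proof
    fix x
    have "0 \<le> h10_fun (u t - v t) x"
    proof (rule comparison[OF lin_sol_diff[OF u v], where K = ?K and T = t])
      show "0 \<le> ?K" using \<open>0 \<le> b2\<close> by simp
      fix r x assume r: "r \<in> {s..t}" and x: "x \<in> {0..pi}"
      have "\<bar>h10_fun (reac lam (\<beta> r) (u r) - reac lam (\<beta> r) (v r)) x\<bar> \<le> ?K * \<bar>h10_fun (u r - v r) x\<bar>"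
        using B1(2)[OF r] B2(2)[OF r] b2[OF r] by (intro reac_lipschitz) (auto simp: le_max_iff_disj)
      then show "- ?K * \<bar>h10_fun (u r - v r) x\<bar> \<le> h10_fun (G r - H r) x"
        using GH[OF r x] unfolding abs_le_iff mult_minus_left by linarith
    qed (use le t in \<open>auto simp: h10_le_def\<close>)
    then show "h10_fun (v t) x \<le> h10_fun (u t) x" by simp
  qed
qed

lemma sol_mono:
  assumes "continuous_on UNIV \<beta>" "sol lam \<beta> s u" "sol lam \<beta> s v" "v s \<preceq> u s" "s \<le> t"
  shows "v t \<preceq> u t"
  by (rule reac_comparison[OF assms(1) sol_lin_sol[OF assms(2)] sol_lin_sol[OF assms(3)] order_refl assms(4,5)])

lemma sol_unique:
  assumes "continuous_on UNIV \<beta>" "sol lam \<beta> s u" "sol lam \<beta> s v" "u s = v s" "s \<le> t"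
  shows "u t = v t"
proof (rule h10_le_antisym)
  show "u t \<preceq> v t" by (rule sol_mono[OF assms(1,3,2)]) (use assms in auto)
  show "v t \<preceq> u t" by (rule sol_mono[OF assms(1,2,3)]) (use assms in auto)
qed

text \<open>Uniqueness resolves the definite description, so \<open>evolution\<close> can be read
  off from any known solution. Existence is supplied separately: for nonnegative data by
  \<open>sol_exists\<close>, for sign-changing data by dilation and reflection.\<close>

lemma evolution_eq:
  assumes \<beta>: "continuous_on UNIV \<beta>" and u: "sol lam \<beta> s u" and t: "s \<le> t"
  shows "evolution lam \<beta> t s (u s) = u t"
  unfolding evolution_def mild_solution_iff[OF \<beta>]
proof (rule the_equality)
  show "\<exists>v. (sol lam \<beta> s v \<and> v s = u s) \<and> v t = u t" using u by blast
  fix w assume "\<exists>v. (sol lam \<beta> s v \<and> v s = u s) \<and> v t = w"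
  then obtain v where "sol lam \<beta> s v" "v s = u s" "v t = w" by blast
  then show "w = u t" using sol_unique[OF \<beta> _ u _ t, of v] by blast
qed

text \<open>Duhamel's formula combined with the maximum principle: the supremum of the source is
  integrated in time, and the damping only helps.\<close>

lemma lin_sol_pointwise:
  assumes w: "lin_sol s w (\<lambda>t. G t - c *\<^sub>R w t)" and w0: "w s = 0" and c: "0 \<le> c" and st: "s \<le> t"
    and g: "\<And>r x. r \<in> {s..t} \<Longrightarrow> x \<in> {0..pi} \<Longrightarrow> \<bar>h10_fun (G r) x\<bar> \<le> g r" and I: "(g has_integral I) {s..t}"
  shows "\<bar>h10_fun (w t) x\<bar> \<le> I"
proof -
  let ?f = "\<lambda>r. exp (- c * (t - r)) * h10_fun (heat (t - r) (G r)) x"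
  have f: "(?f has_integral h10_fun (w t) x) {s..t}"
    using duhamel_at[OF w st, of c x] by (simp add: w0 heat_def[of _ 0] heat_eq[of _ 0, unfolded heat_def])
  have b: "\<bar>?f r\<bar> \<le> g r" if r: "r \<in> {s..t}" for r
  proof -
    have "0 \<le> g r" using g[OF r, of 0] by simp
    moreover have "\<bar>h10_fun (heat (t - r) (G r)) x\<bar> \<le> g r"
      using g[OF r] r by (intro heat_abs_bound) auto
    moreover have "exp (- c * (t - r)) \<le> 1" using c r by simp
    ultimately have "exp (- c * (t - r)) * \<bar>h10_fun (heat (t - r) (G r)) x\<bar> \<le> 1 * g r"
      by (intro mult_mono) auto
    then show ?thesis by (simp add: abs_mult)
  qed
  have "h10_fun (w t) x \<le> I"
    by (rule has_integral_le[OF f I]) (use b in \<open>auto simp: abs_le_iff\<close>)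
  moreover have "- I \<le> h10_fun (w t) x"
  proof (rule has_integral_le[OF has_integral_neg[OF I] f])
    fix r assume "r \<in> {s..t}"
    then show "- g r \<le> ?f r" using b[of r] unfolding abs_le_iff by linarith
  qed
  ultimately show ?thesis by (simp add: abs_le_iff minus_le_iff)
qed

section \<open>Global existence for nonnegative data\<close>

text \<open>The setting of the first mode. Constant \<open>\<beta>\<close> with
  \<open>b1 = b2\<close> is an instance as well; it is the one used to construct the stationary
  solution and to prove its uniqueness.\<close>

locale chafee_infante =
  fixes lam b1 b2 :: real and \<beta> :: "real \<Rightarrow> real"
  assumes lam: "1 < lam" and b1: "0 < b1" and beta_ge: "\<And>t. b1 \<le> \<beta> t" and beta_le: "\<And>t. \<beta> t \<le> b2"
    and beta_cont: "continuous_on UNIV \<beta>"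
begin

abbreviation E :: "real \<Rightarrow> real \<Rightarrow> h10 \<Rightarrow> h10" where "E \<equiv> evolution lam \<beta>"

lemma beta_pos: "0 < \<beta> t" using b1 beta_ge[of t] by linarith

lemma b2_pos: "0 < b2" using beta_pos[of 0] beta_le[of 0] by linarith

text \<open>Above \<open>M\<close> the reaction term is nonpositive.\<close>

definition cap :: "real \<Rightarrow> bool" where "cap M \<longleftrightarrow> 0 \<le> M \<and> lam \<le> b1 * M\<^sup>2"

definition below :: "h10 \<Rightarrow> real \<Rightarrow> bool" where "below u M \<longleftrightarrow> 0 \<preceq> u \<and> (\<forall>x. h10_fun u x \<le> M)"

lemma below_abs: "below u M \<Longrightarrow> \<bar>h10_fun u x\<bar> \<le> M"
  by (auto simp: below_def h10_le_def abs_le_iff intro: order_trans[of _ 0])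

text \<open>The shift \<open>c\<close> makes the reaction map \<open>[0, M]\<close> into
  \<open>[0, c M]\<close>. Since \<open>M\<close> is the equilibrium of
  \<open>m' = - c m + c M\<close>, this keeps the interval invariant under the damped heat
  flow.\<close>

lemma picard_reac_bounds:
  fixes a M b :: real
  assumes M: "cap M" and a: "0 \<le> a" "a \<le> M" and b: "b1 \<le> b" "b \<le> b2"
  defines "c \<equiv> 3 * b2 * M\<^sup>2"
  shows "0 \<le> (lam + c) * a - b * a ^ 3" "(lam + c) * a - b * a ^ 3 \<le> c * M"
proof -
  have bp: "0 < b" using b b1 by linarith
  have M0: "0 \<le> M" using M by (simp add: cap_def)
  have a2: "a\<^sup>2 \<le> M\<^sup>2" using a by (intro power_mono) auto
  have ba: "b * a\<^sup>2 \<le> b2 * M\<^sup>2" using a2 b bp by (intro mult_mono) auto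
  have nn: "0 \<le> b2 * M\<^sup>2" using b2_pos by simp
  have "0 \<le> lam + c - b * a\<^sup>2" using ba nn lam by (simp add: c_def)
  then have "0 \<le> (lam + c - b * a\<^sup>2) * a" using a by simp
  then show "0 \<le> (lam + c) * a - b * a ^ 3" by (simp add: algebra_simps power2_eq_square power3_eq_cube)
  have "lam \<le> b * M\<^sup>2"
    using M mult_right_mono[OF b(1), of "M\<^sup>2"] by (auto simp: cap_def)
  then have "a * (lam - b * a\<^sup>2) \<le> a * (b * M\<^sup>2 - b * a\<^sup>2)" using a by (intro mult_left_mono) auto
  also have "\<dots> = (b * (a * (M + a))) * (M - a)" by (simp add: algebra_simps power2_eq_square)
  also have "\<dots> \<le> (b2 * (M * (2 * M))) * (M - a)"
    using a b bp M0 by (intro mult_right_mono mult_mono) auto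
  also have "\<dots> \<le> c * (M - a)"
    using a nn by (intro mult_right_mono) (auto simp: c_def power2_eq_square mult_ac)
  finally show "(lam + c) * a - b * a ^ 3 \<le> c * M"
    by (simp add: algebra_simps power2_eq_square power3_eq_cube)
qed

text \<open>Picard iteration with the damping \<open>c\<close> kept implicit. All iterates stay
  between 0 and \<open>M\<close>, so one Lipschitz constant \<open>L\<close> serves for all times
  and no continuation argument arises.\<close>

lemma sol_exists:
  assumes M: "cap M" and u0: "below u0 M"
  obtains u where "sol lam \<beta> s u" "u s = u0" "\<And>t. s \<le> t \<Longrightarrow> below (u t) M"
proof -
  define c where "c = 3 * b2 * M\<^sup>2"
  have c: "0 \<le> c" using b2_pos by (simp add: c_def)
  have M0: "0 \<le> M" using M by (simp add: cap_def)
  define h where "h r u = reac (lam + c) (\<beta> r) u" for r u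
  define L where "L = \<bar>lam + c\<bar> + 3 * b2 * M\<^sup>2"
  have L: "0 \<le> L" using b2_pos by (simp add: L_def)
  have hcont: "continuous_on {s..} (\<lambda>t. h t (u t))" if "continuous_on {s..} u" for u
    unfolding h_def by (intro continuous_on_reac that continuous_on_subset[OF beta_cont]) auto
  have hlip: "\<bar>h10_fun (h r u - h r v) x\<bar> \<le> L * \<bar>h10_fun (u - v) x\<bar>" if "below u M" "below v M" for r u v x
    unfolding h_def L_def using that beta_pos[of r] beta_le[of r]
    by (intro reac_lipschitz below_abs) auto
  define P where "P u v \<longleftrightarrow> v s = u0 \<and> lin_sol s v (\<lambda>t. h t (u t) - c *\<^sub>R v t)" for u v
  define \<Phi> where "\<Phi> u = (SOME v. P u v)" for u
  have \<Phi>: "\<Phi> u s = u0 \<and> lin_sol s (\<Phi> u) (\<lambda>t. h t (u t) - c *\<^sub>R \<Phi> u t)" if cu: "continuous_on {s..} u" for u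
  proof -
    obtain v where "v s = u0" "lin_sol s v (\<lambda>t. h t (u t) - c *\<^sub>R v t)"
      by (rule lin_solve[OF hcont[OF cu] c, where ?u0.0 = u0])
    then have "P u v" by (simp add: P_def)
    then have "P u (\<Phi> u)" unfolding \<Phi>_def by (rule someI[of "P u"])
    then show ?thesis by (simp add: P_def)
  qed
  have \<Phi>_below: "below (\<Phi> u t) M"
    if cu: "continuous_on {s..} u" and bu: "\<And>t. s \<le> t \<Longrightarrow> below (u t) M" and t: "s \<le> t" for u t
  proof -
    note P = \<Phi>[OF cu]
    have hb: "0 \<le> h10_fun (h r (u r)) x" "h10_fun (h r (u r)) x \<le> c * M" if "s \<le> r" for r x
      using bu[OF that] picard_reac_bounds[OF M, of "h10_fun (u r) x" "\<beta> r"] beta_ge[of r] beta_le[of r]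
      by (auto simp: h_def h10_fun_reac c_def below_def h10_le_def)
    have u0b: "0 \<le> h10_fun u0 x" "h10_fun u0 x \<le> M" for x
      using u0 by (auto simp: below_def h10_le_def)
    let ?f = "\<lambda>x r. exp (- c * (t - r)) * h10_fun (heat (t - r) (h r (u r))) x"
    have f: "(?f x has_integral (h10_fun (\<Phi> u t) x - exp (- c * (t - s)) * h10_fun (heat (t - s) u0) x)) {s..t}" for x
      using duhamel_at[OF conjunct2[OF P] t, of c x] P by simp
    have "0 \<le> h10_fun (\<Phi> u t) x" for x
    proof -
      have "0 \<le> h10_fun (\<Phi> u t) x - exp (- c * (t - s)) * h10_fun (heat (t - s) u0) x"
        by (rule has_integral_nonneg[OF f]) (auto intro!: mult_nonneg_nonneg heat_nonneg hb)
      moreover have "0 \<le> exp (- c * (t - s)) * h10_fun (heat (t - s) u0) x"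
        using t by (auto intro!: mult_nonneg_nonneg heat_nonneg u0b)
      ultimately show ?thesis by simp
    qed
    moreover have "h10_fun (\<Phi> u t) x \<le> M" for x
    proof -
      \<comment> \<open>The contribution of the constant source \<open>c * M\<close>; together with
        the initial part it adds up to exactly \<open>M\<close>.\<close>
      have "((\<lambda>r. exp (- c * (t - r)) * (c * M)) has_integral (exp (- c * (t - t)) * M - exp (- c * (t - s)) * M)) {s..t}"
        using t by (intro fundamental_theorem_of_calculus)
          (auto intro!: derivative_eq_intros simp: has_real_derivative_iff_has_vector_derivative[symmetric])
      note J = this
      have up: "h10_fun (heat (t - r) (h r (u r))) x \<le> c * M" if "r \<in> {s..t}" for r
        by (rule heat_upper_bound) (use c M0 hb that in auto)
      have "h10_fun (\<Phi> u t) x - exp (- c * (t - s)) * h10_fun (heat (t - s) u0) x \<le>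
          exp (- c * (t - t)) * M - exp (- c * (t - s)) * M"
        by (rule has_integral_le[OF f[of x] J]) (auto intro!: mult_left_mono up)
      moreover have "exp (- c * (t - s)) * h10_fun (heat (t - s) u0) x \<le> exp (- c * (t - s)) * M"
        using t M0 by (intro mult_left_mono heat_upper_bound u0b) auto
      moreover have "exp (- c * (t - t)) * M = M" by simp
      ultimately show ?thesis by linarith
    qed
    ultimately show ?thesis by (simp add: below_def h10_le_def)
  qed
  define U where "U k = (\<Phi> ^^ k) (\<lambda>_. u0)" for k
  have U_Suc: "U (Suc k) = \<Phi> (U k)" for k by (simp add: U_def)
  have U: "continuous_on {s..} (U k) \<and> (\<forall>t\<ge>s. below (U k t) M)" for k
  proof (induction k)
    case (Suc k)
    then show ?case unfolding U_Suc using \<Phi>[of "U k"] \<Phi>_below[of "U k"] lin_solD(1) by blast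
  qed (use u0 in \<open>auto simp: U_def\<close>)
  have US: "U (Suc k) s = u0" "lin_sol s (U (Suc k)) (\<lambda>t. h t (U k t) - c *\<^sub>R U (Suc k) t)" for k
    unfolding U_Suc using \<Phi>[of "U k"] U[of k] by auto
  have dif: "lin_sol s (\<lambda>t. U (Suc (Suc k)) t - U (Suc k) t)
      (\<lambda>t. (h t (U (Suc k) t) - h t (U k t)) - c *\<^sub>R (U (Suc (Suc k)) t - U (Suc k) t))" for k
    by (rule lin_sol_cong[OF lin_sol_diff[OF US(2)[of "Suc k"] US(2)[of k]]]) (auto simp: algebra_simps)
  \<comment> \<open>Each step integrates the previous bound once more in time. This produces the
    factorial, and with it convergence without smallness of \<open>t - s\<close>.\<close>
  have D: "\<bar>h10_fun (U (Suc k) t - U k t) x\<bar> \<le> M * (L * (t - s)) ^ k / fact k" if "s \<le> t" for k t x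
    using that
  proof (induction k arbitrary: t x)
    case 0
    have "below (U (Suc 0) t) M" "below (U 0 t) M" using U 0 by blast+
    then have "0 \<le> h10_fun (U (Suc 0) t) x" "h10_fun (U (Suc 0) t) x \<le> M" "0 \<le> h10_fun (U 0 t) x" "h10_fun (U 0 t) x \<le> M"
      by (auto simp: below_def h10_le_def)
    then show ?case by simp
  next
    case (Suc k)
    have "\<bar>h10_fun (U (Suc (Suc k)) t - U (Suc k) t) x\<bar> \<le> L * (M * L ^ k / fact k) * ((t - s) ^ Suc k / real (Suc k))"
    proof (rule lin_sol_pointwise[OF dif _ c Suc.prems])
      show "U (Suc (Suc k)) s - U (Suc k) s = 0" by (simp add: US(1))
      show "((\<lambda>r. L * (M * L ^ k / fact k) * (r - s) ^ k) has_integral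
          L * (M * L ^ k / fact k) * ((t - s) ^ Suc k / real (Suc k))) {s..t}"
        by (intro has_integral_mult_right has_integral_power Suc.prems)
      fix r x assume r: "r \<in> {s..t}"
      have "\<bar>h10_fun (h r (U (Suc k) r) - h r (U k r)) x\<bar> \<le> L * \<bar>h10_fun (U (Suc k) r - U k r) x\<bar>"
        using U r by (intro hlip) auto
      also have "\<dots> \<le> L * (M * (L * (r - s)) ^ k / fact k)"
        using L Suc.IH[of r x] r by (intro mult_left_mono) auto
      finally show "\<bar>h10_fun (h r (U (Suc k) r) - h r (U k r)) x\<bar> \<le> L * (M * L ^ k / fact k) * (r - s) ^ k"
        by (simp add: power_mult_distrib)
    qed
    also have "\<dots> = M * (L * (t - s)) ^ Suc k / fact (Suc k)"
    proof -
      have "L * (M * X / F) * (Y / Z) = M * ((L * X) * Y) / (Z * F)" for X Y Z F :: real by (simp add: mult_ac)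
      then show ?thesis unfolding power_mult_distrib fact_Suc power_Suc[of L] by blast
    qed
    finally show ?case .
  qed
  \<comment> \<open>Smoothing turns the pointwise bounds into norm bounds; the differences vanish at
    time \<open>s\<close>, hence \<open>R = 0\<close>.\<close>
  have N: "norm (U (Suc (Suc k)) t - U (Suc k) t) \<le> sine_const * 2 * L * M * ((L * (T - s)) ^ k / fact k)"
    if t: "t \<in> {s..T}" for k t T
  proof -
    have "norm (U (Suc (Suc k)) t - U (Suc k) t) \<le> sine_const * (0 + 2 * (L * (M * (L * (T - s)) ^ k / fact k)))"
    proof (rule lin_sol_norm_bound[OF dif c])
      fix r x assume r: "r \<in> {s..t}"
      have "\<bar>h10_fun (h r (U (Suc k) r) - h r (U k r)) x\<bar> \<le> L * \<bar>h10_fun (U (Suc k) r - U k r) x\<bar>"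
        using U r by (intro hlip) auto
      also have "\<dots> \<le> L * (M * (L * (r - s)) ^ k / fact k)"
        using L D[of r k x] r by (intro mult_left_mono) auto
      also have "\<dots> \<le> L * (M * (L * (T - s)) ^ k / fact k)"
        using L M0 r t by (intro mult_left_mono divide_right_mono power_mono) auto
      finally show "\<bar>h10_fun (h r (U (Suc k) r) - h r (U k r)) x\<bar> \<le> L * (M * (L * (T - s)) ^ k / fact k)" .
    qed (use t in \<open>auto simp: US(1)\<close>)
    then show ?thesis by (simp add: mult_ac)
  qed
  \<comment> \<open>The series starts at \<open>U 1\<close>, because \<open>U 0\<close> is the
    constant curve \<open>u0\<close>, which need not solve a linear equation of this form.\<close>
  define u where "u t = U 1 t + (\<Sum>k. U (Suc (Suc k)) t - U (Suc k) t)" for t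
  have tele: "U 1 t + (\<Sum>k<n. U (Suc (Suc k)) t - U (Suc k) t) = U (Suc n) t" for n t
    using sum_lessThan_telescope[of "\<lambda>k. U (Suc k) t" n] by simp
  have unif: "uniform_limit {s..T} (\<lambda>n t. U (Suc n) t) u sequentially" for T
  proof -
    have sm: "summable (\<lambda>k. sine_const * 2 * L * M * ((L * (T - s)) ^ k / fact k))"
      using summable_exp[of "L * (T - s)"] by (intro summable_mult) (simp add: field_simps)
    have "uniform_limit {s..T} (\<lambda>n t. \<Sum>k<n. U (Suc (Suc k)) t - U (Suc k) t)
        (\<lambda>t. \<Sum>k. U (Suc (Suc k)) t - U (Suc k) t) sequentially"
      by (rule Weierstrass_m_test[OF N sm])
    from uniform_limit_add[OF uniform_limit_const this, of "U 1"] show ?thesis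
      unfolding u_def by (simp only: tele)
  qed
  have ulim: "(\<lambda>n. U (Suc n) t) \<longlonglongrightarrow> u t" if "s \<le> t" for t
    using tendsto_uniform_limitI[OF unif[of t], of t] that by simp
  have cu: "continuous_on {s..} u"
  proof (rule continuous_on_halfline)
    fix T
    have "continuous_on {s..T} (U k)" for k
      by (rule continuous_on_subset[OF conjunct1[OF U]]) auto
    then show "continuous_on {s..T} u"
      by (intro uniform_limit_theorem[OF _ unif]) auto
  qed
  have bu: "below (u t) M" if t: "s \<le> t" for t
  proof -
    have l: "(\<lambda>n. h10_fun (U (Suc n) t) x) \<longlonglongrightarrow> h10_fun (u t) x" for x
      by (rule tendsto_h10_fun[OF ulim[OF t]])
    have b: "0 \<le> h10_fun (U (Suc n) t) x" "h10_fun (U (Suc n) t) x \<le> M" for n x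
      using U t unfolding below_def h10_le_def h10_fun_zero by blast+
    have "0 \<le> h10_fun (u t) x" for x by (rule LIMSEQ_le_const[OF l]) (use b in blast)
    moreover have "h10_fun (u t) x \<le> M" for x by (rule LIMSEQ_le_const2[OF l]) (use b in blast)
    ultimately show ?thesis by (simp add: below_def h10_le_def)
  qed
  note V = \<Phi>[OF cu]
  \<comment> \<open>The limit is a fixed point: \<open>\<Phi> u\<close> and
    \<open>U (Suc (Suc n))\<close> have the same initial value and solve the same linear equation,
    up to a source that tends uniformly to 0.\<close>
  have Vu: "\<Phi> u t = u t" if t: "s \<le> t" for t
  proof (rule h10_eqI)
    fix x
    have "(\<lambda>n. h10_fun (U (Suc n) t) x) \<longlonglongrightarrow> h10_fun (\<Phi> u t) x"
    \<comment> \<open>The shift of the index by one matches the iterates that arise from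
      \<open>U (Suc n)\<close>.\<close>
    proof (rule LIMSEQ_offset[where k = 1], rule LIMSEQ_I)
      fix e :: real assume e: "0 < e"
      define d where "d = e / (3 * (L * (t - s) + 1))"
      have pos: "0 < L * (t - s) + 1" using L t by (simp add: add_nonneg_pos)
      have d: "0 < d" using e pos by (simp add: d_def)
      obtain n0 where n0: "\<And>n r. n \<ge> n0 \<Longrightarrow> r \<in> {s..t} \<Longrightarrow> dist (U (Suc n) r) (u r) < d"
        using unif[of t] d unfolding uniform_limit_sequentially_iff by meson
      have "norm (h10_fun (U (Suc (n + 1)) t) x - h10_fun (\<Phi> u t) x) < e" if n: "n \<ge> n0" for n
      proof -
        let ?w = "\<lambda>t. \<Phi> u t - U (Suc (Suc n)) t"
        have w: "lin_sol s ?w (\<lambda>t. (h t (u t) - h t (U (Suc n) t)) - c *\<^sub>R ?w t)"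
          by (rule lin_sol_cong[OF lin_sol_diff[OF conjunct2[OF V] US(2)[of "Suc n"]]]) (auto simp: algebra_simps)
        have "\<bar>h10_fun (?w t) x\<bar> \<le> (t - s) *\<^sub>R (L * (3 * d))"
        proof (rule lin_sol_pointwise[OF w _ c t])
          show "((\<lambda>r. L * (3 * d)) has_integral (t - s) *\<^sub>R (L * (3 * d))) {s..t}"
            using has_integral_const_real[of "L * (3 * d)" s t] t by simp
          fix r x assume r: "r \<in> {s..t}"
          have "\<bar>h10_fun (h r (u r) - h r (U (Suc n) r)) x\<bar> \<le> L * \<bar>h10_fun (u r - U (Suc n) r) x\<bar>"
            using U r bu by (intro hlip) auto
          also have "\<dots> \<le> L * (3 * d)"
            using L n0[OF n r] h10_fun_bound[of "u r - U (Suc n) r" x]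
            by (intro mult_left_mono) (auto simp: dist_norm norm_minus_commute)
          finally show "\<bar>h10_fun (h r (u r) - h r (U (Suc n) r)) x\<bar> \<le> L * (3 * d)" .
        qed (use V US(1) in auto)
        also have "\<dots> = (L * (t - s)) * (3 * d)" by simp
        also have "\<dots> < (L * (t - s) + 1) * (3 * d)" using d by (intro mult_strict_right_mono) auto
        also have "\<dots> = e"
        proof -
          have "X * (3 * (e / (3 * X))) = e" if "0 < X" for X using that by simp
          from this[OF pos] show ?thesis unfolding d_def .
        qed
        finally show ?thesis by (simp add: abs_minus_commute)
      qed
      then show "\<exists>n0. \<forall>n\<ge>n0. norm (h10_fun (U (Suc (n + 1)) t) x - h10_fun (\<Phi> u t) x) < e" by blast
    qed
    moreover have "(\<lambda>n. h10_fun (U (Suc n) t) x) \<longlonglongrightarrow> h10_fun (u t) x"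
      by (rule tendsto_h10_fun[OF ulim[OF t]])
    ultimately show "h10_fun (\<Phi> u t) x = h10_fun (u t) x" by (rule LIMSEQ_unique)
  qed
  have "lin_sol s u (\<lambda>t. reac lam (\<beta> t) (u t))"
    by (rule lin_sol_cong[OF conjunct2[OF V]]) (use Vu in \<open>auto simp: h_def reac_def algebra_simps\<close>)
  then have "sol lam \<beta> s u" by (simp add: sol_def)
  moreover have "u s = u0" using Vu[of s] V by simp
  ultimately show ?thesis using bu by (rule that)
qed

lemma below_cap:
  assumes "0 \<preceq> u"
  obtains M where "cap M" "below u M"
proof -
  define M where "M = max (sqrt (lam / b1)) (3 * norm u)"
  have 0: "0 \<le> lam / b1" using lam b1 by simp
  have "(sqrt (lam / b1))\<^sup>2 \<le> M\<^sup>2"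
    by (rule power_mono) (use 0 in \<open>auto simp: M_def\<close>)
  then have "lam / b1 \<le> M\<^sup>2" using 0 by simp
  then have "lam \<le> M\<^sup>2 * b1" using b1 by (simp only: pos_divide_le_eq)
  moreover have "0 \<le> M" by (simp add: M_def le_max_iff_disj)
  ultimately have "cap M" by (simp add: cap_def mult.commute)
  moreover have "h10_fun u x \<le> M" for x
    using h10_fun_bound[of u x] unfolding M_def by linarith
  then have "below u M" using assms by (simp add: below_def)
  ultimately show ?thesis by (rule that)
qed

lemma
  assumes "0 \<preceq> u0"
  shows E_sol: "sol lam \<beta> s (\<lambda>t. E t s u0)"
    and E_self: "E s s u0 = u0"
    and E_nonneg: "s \<le> t \<Longrightarrow> 0 \<preceq> E t s u0"
proof -
  obtain M where M: "cap M" "below u0 M" using below_cap[OF assms] by blast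
  obtain u where u: "sol lam \<beta> s u" "u s = u0" "\<And>t. s \<le> t \<Longrightarrow> below (u t) M"
    using sol_exists[OF M] by blast
  have e: "E t s u0 = u t" if "s \<le> t" for t
    using evolution_eq[OF beta_cont u(1) that] u(2) by simp
  show "sol lam \<beta> s (\<lambda>t. E t s u0)"
    unfolding sol_def by (rule lin_sol_cong[OF sol_lin_sol[OF u(1)]]) (auto simp: e)
  show "E s s u0 = u0" using e[of s] u(2) by simp
  show "0 \<preceq> E t s u0" if "s \<le> t" using e[OF that] u(3)[OF that] by (simp add: below_def)
qed

lemma E_below:
  assumes "cap M" "below u0 M" "s \<le> t" shows "below (E t s u0) M"
proof -
  obtain u where u: "sol lam \<beta> s u" "u s = u0" "\<And>t. s \<le> t \<Longrightarrow> below (u t) M"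
    using sol_exists[OF assms(1,2)] by blast
  show ?thesis using evolution_eq[OF beta_cont u(1) assms(3)] u assms(3) by simp
qed

lemma E_mono: "0 \<preceq> v \<Longrightarrow> v \<preceq> u \<Longrightarrow> s \<le> t \<Longrightarrow> E t s v \<preceq> E t s u"
proof -
  assume v: "0 \<preceq> v" and vu: "v \<preceq> u" and st: "s \<le> t"
  have u: "0 \<preceq> u" using v vu by (rule h10_le_trans)
  show ?thesis
    using sol_mono[OF beta_cont E_sol[OF u] E_sol[OF v] _ st] vu by (simp only: E_self u v)
qed

lemma E_cocycle: "0 \<preceq> u \<Longrightarrow> s \<le> r \<Longrightarrow> r \<le> t \<Longrightarrow> E t r (E r s u) = E t s u"
  by (rule evolution_eq[OF beta_cont sol_restrict[OF E_sol]])

end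

section \<open>Smoothing and pullback limits\<close>

lemma lin_sol_heat:
  "lin_sol s (\<lambda>t. exp (\<mu> * (t - s)) *\<^sub>R heat (t - s) w) (\<lambda>t. \<mu> *\<^sub>R exp (\<mu> * (t - s)) *\<^sub>R heat (t - s) w)"
proof -
  have c: "continuous_on {s..} (\<lambda>t. heat (t - s) w)"
    by (rule continuous_on_compose2[OF continuous_on_heat]) (auto intro!: continuous_intros)
  show ?thesis
    unfolding lin_sol_def
  proof (intro conjI allI impI)
    fix n t assume t: "s \<le> t"
    let ?f = "\<lambda>t. exp (\<mu> * (t - s)) * (exp (- (real n)\<^sup>2 * (t - s)) * sc n w)"
    have "(?f has_real_derivative (\<mu> - (real n)\<^sup>2) * ?f t) (at t within {s..})"
      by (auto intro!: derivative_eq_intros simp: algebra_simps)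
    then have "((\<lambda>t. sc n (exp (\<mu> * (t - s)) *\<^sub>R heat (t - s) w)) has_real_derivative (\<mu> - (real n)\<^sup>2) * ?f t) (at t within {s..})"
      by (rule has_field_derivative_transform_within[OF _ zero_less_one]) (use t in \<open>auto simp: sc_heat\<close>)
    then show "((\<lambda>t. sc n (exp (\<mu> * (t - s)) *\<^sub>R heat (t - s) w)) has_real_derivative
        sc n (\<mu> *\<^sub>R exp (\<mu> * (t - s)) *\<^sub>R heat (t - s) w) - (real n)\<^sup>2 * sc n (exp (\<mu> * (t - s)) *\<^sub>R heat (t - s) w)) (at t within {s..})"
      using t by (simp add: sc_heat left_diff_distrib mult.assoc)
  qed (intro continuous_intros c)+
qed

lemma exp_minus_square_le: "0 < n \<Longrightarrow> 1 \<le> \<tau> \<Longrightarrow> exp (- (real n)\<^sup>2 * \<tau>) \<le> 1 / (real n)\<^sup>2"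
proof -
  assume n: "0 < n" and \<tau>: "1 \<le> \<tau>"
  have "(real n)\<^sup>2 * 1 \<le> (real n)\<^sup>2 * \<tau>" using \<tau> by (intro mult_left_mono) auto
  then have "exp (- (real n)\<^sup>2 * \<tau>) \<le> exp (- (real n)\<^sup>2)" by simp
  also have "\<dots> = 1 / exp ((real n)\<^sup>2)" by (simp add: exp_minus field_simps)
  also have "\<dots> \<le> 1 / (real n)\<^sup>2"
  proof (rule divide_left_mono)
    show "(real n)\<^sup>2 \<le> exp ((real n)\<^sup>2)" using exp_ge_add_one_self[of "(real n)\<^sup>2"] by linarith
  qed (use n in auto)
  finally show ?thesis .
qed

text \<open>For nonnegative \<open>u\<close> the coefficients are bounded by the mass, and from unit
  time on the factors \<open>exp (- n^2 \<tau>)\<close> turn this into decay of order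
  \<open>1 / n^2\<close>.\<close>

lemma norm_heat_le_mass:
  assumes u: "0 \<preceq> u" and \<tau>: "1 \<le> \<tau>"
  shows "norm (heat \<tau> u) \<le> sine_const * mass u"
proof (rule norm_le_sc)
  fix n :: nat assume n: "0 < n"
  have "\<bar>sc n (heat \<tau> u)\<bar> = exp (- (real n)\<^sup>2 * \<tau>) * \<bar>sc n u\<bar>"
    using \<tau> by (simp add: sc_heat abs_mult)
  also have "\<dots> \<le> 1 / (real n)\<^sup>2 * mass u"
    using u exp_minus_square_le[OF n \<tau>] by (intro mult_mono sc_abs_le_mass) (auto simp: h10_le_def)
  finally show "\<bar>sc n (heat \<tau> u)\<bar> \<le> mass u / (real n)\<^sup>2" by simp
qed

lemma mass_diff: "mass (u - v) = mass u - mass v"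
proof -
  have "mass (u - v) = integral {0..pi} (\<lambda>x. h10_fun u x - h10_fun v x)"
    unfolding mass_def by (intro integral_cong) auto
  also have "\<dots> = mass u - mass v"
    unfolding mass_def by (intro integral_diff integrable_continuous_real continuous_on_h10_fun)
  finally show ?thesis .
qed

lemma mass_mono: "u \<preceq> v \<Longrightarrow> mass u \<le> mass v"
  unfolding mass_def
  by (intro integral_le integrable_continuous_real continuous_on_h10_fun) (auto simp: h10_le_def)

lemma tendsto_h10_le:
  assumes "(f \<longlongrightarrow> u) F" "(g \<longlongrightarrow> v) F" "\<forall>\<^sub>F s in F. f s \<preceq> g s" "F \<noteq> bot"
  shows "u \<preceq> v"
  unfolding h10_le_def
proof
  fix x
  show "h10_fun u x \<le> h10_fun v x"
    by (rule tendsto_le[OF assms(4) tendsto_h10_fun[OF assms(2)] tendsto_h10_fun[OF assms(1)]])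
      (use assms(3) in \<open>eventually_elim, auto simp: h10_le_def\<close>)
qed

lemma global_sol:
  assumes "\<And>s. sol lam \<beta> s \<xi>" "continuous_on UNIV \<beta>"
  shows "global_solution lam \<beta> \<xi>"
  unfolding global_solution_def
proof
  have "isCont \<xi> t" for t
  proof (rule continuous_on_interior)
    show "continuous_on {t - 1..} \<xi>" by (rule sol_continuous[OF assms(1)])
    show "t \<in> interior {t - 1..}" by (simp add: interior_real_atLeast)
  qed
  then show "continuous_on UNIV \<xi>" by (simp add: continuous_at_imp_continuous_on)
  show "\<forall>s t. s \<le> t \<longrightarrow> evolution lam \<beta> t s (\<xi> s) = \<xi> t"
    using evolution_eq[OF assms(2) assms(1)] by blast
qed

context chafee_infante
begin

section \<open>Quantitative dependence on the data\<close>

text \<open>The cubes of two ordered nonnegative solutions are ordered too, so the difference is a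
  subsolution of \<open>z_t = z_xx + lam z\<close>.\<close>

lemma ordered_bound:
  assumes v: "0 \<preceq> v" and vu: "v \<preceq> u" and st: "s \<le> t"
  shows "E t s u - E t s v \<preceq> exp (lam * (t - s)) *\<^sub>R heat (t - s) (u - v)"
proof -
  have u: "0 \<preceq> u" using v vu by (rule h10_le_trans)
  let ?z = "\<lambda>t. exp (lam * (t - s)) *\<^sub>R heat (t - s) (u - v)"
  show ?thesis
  proof (rule reac_comparison[OF _ lin_sol_heat[of s lam "u - v"] lin_sol_diff[OF sol_lin_sol[OF E_sol[OF u]] sol_lin_sol[OF E_sol[OF v]]] _ _ st, where \<beta> = "\<lambda>_. 0" and lam = lam])
    fix r x assume r: "r \<in> {s..t}"
    have "h10_fun (E r s v) x \<le> h10_fun (E r s u) x" using E_mono[OF v vu, of s r] r by (simp add: h10_le_def)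
    then have "h10_fun (E r s v) x ^ 3 \<le> h10_fun (E r s u) x ^ 3"
      using E_nonneg[OF v, of s r] r by (intro power_mono) (auto simp: h10_le_def)
    then have "0 \<le> \<beta> r * (h10_fun (E r s u) x ^ 3 - h10_fun (E r s v) x ^ 3)"
      using beta_pos[of r] by simp
    then show "h10_fun (reac lam 0 (?z r) - reac lam 0 (E r s u - E r s v)) x
        \<le> h10_fun (lam *\<^sub>R ?z r - (reac lam (\<beta> r) (E r s u) - reac lam (\<beta> r) (E r s v))) x"
      by (simp add: h10_fun_reac algebra_simps)
  qed (auto simp: E_self u v)
qed

text \<open>Keeping the heat flow of the difference inside the norm, instead of passing to
  \<open>norm (u - v)\<close>, is what later allows the mass to control the difference.\<close>

lemma E_diff_pointwise:
  assumes "0 \<preceq> u" "0 \<preceq> v" and le: "u \<preceq> v \<or> v \<preceq> u" and st: "s \<le> t"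
  shows "\<bar>h10_fun (E t s u) x - h10_fun (E t s v) x\<bar> \<le> exp (lam * (t - s)) * (3 * norm (heat (t - s) (u - v)))"
proof -
  have *: "\<bar>h10_fun (E t s u) x - h10_fun (E t s v) x\<bar> \<le> exp (lam * (t - s)) * (3 * norm (heat (t - s) (u - v)))"
    if v: "0 \<preceq> v" and vu: "v \<preceq> u" for u v
  proof -
    have "h10_fun (E t s v) x \<le> h10_fun (E t s u) x"
      using E_mono[OF v vu st] by (simp add: h10_le_def)
    moreover have "h10_fun (E t s u) x - h10_fun (E t s v) x \<le> exp (lam * (t - s)) * h10_fun (heat (t - s) (u - v)) x"
      using ordered_bound[OF v vu st] by (simp add: h10_le_def)
    moreover have "exp (lam * (t - s)) * h10_fun (heat (t - s) (u - v)) x \<le> exp (lam * (t - s)) * (3 * norm (heat (t - s) (u - v)))"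
      using h10_fun_bound[of "heat (t - s) (u - v)" x] by (intro mult_left_mono) auto
    ultimately show ?thesis by linarith
  qed
  have "norm (heat (t - s) (v - u)) = norm (heat (t - s) (u - v))"
    using st heat_minus[of "t - s" "u - v"] by simp
  then show ?thesis using *[of v u] *[of u v] assms by (auto simp: abs_minus_commute)
qed

text \<open>From \<open>lin_sol_norm_bound\<close> with \<open>R = 2 W\<close> for the initial
  difference and \<open>Q = K W\<close> for the source, where \<open>K\<close> is the Lipschitz
  constant of the reaction on \<open>[- M, M]\<close>.\<close>

definition smoothing_const :: "real \<Rightarrow> real" where
  "smoothing_const M = sine_const * (2 + 2 * (\<bar>lam\<bar> + 3 * b2 * M\<^sup>2))"

text \<open>A uniform bound on a window of unit length becomes a norm bound at its end: the
  Lipschitz constant controls the source, and the factors \<open>exp (- n^2)\<close> regularize the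
  initial difference.\<close>

lemma smoothing:
  assumes u: "sol lam \<beta> s u" and v: "sol lam \<beta> s v"
    and b: "\<And>r x. r \<in> {s..s + 1} \<Longrightarrow> \<bar>h10_fun (u r) x\<bar> \<le> M" "\<And>r x. r \<in> {s..s + 1} \<Longrightarrow> \<bar>h10_fun (v r) x\<bar> \<le> M"
    and W: "\<And>r x. r \<in> {s..s + 1} \<Longrightarrow> \<bar>h10_fun (u r - v r) x\<bar> \<le> W"
  shows "norm (u (s + 1) - v (s + 1)) \<le> smoothing_const M * W"
proof -
  let ?K = "\<bar>lam\<bar> + 3 * b2 * M\<^sup>2"
  have K: "0 \<le> ?K" using b2_pos by simp
  have l: "lin_sol s (\<lambda>t. u t - v t) (\<lambda>t. (reac lam (\<beta> t) (u t) - reac lam (\<beta> t) (v t)) - 0 *\<^sub>R (u t - v t))"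
    by (rule lin_sol_cong[OF lin_sol_diff[OF sol_lin_sol[OF u] sol_lin_sol[OF v]]]) auto
  have "norm (u (s + 1) - v (s + 1)) \<le> sine_const * (2 * W + 2 * (?K * W))"
  proof (rule lin_sol_norm_bound[OF l])
    fix r x assume r: "r \<in> {s..s + 1}"
    have "\<bar>h10_fun (reac lam (\<beta> r) (u r) - reac lam (\<beta> r) (v r)) x\<bar> \<le> ?K * \<bar>h10_fun (u r - v r) x\<bar>"
      using b[OF r] beta_pos[of r] beta_le[of r] by (intro reac_lipschitz) auto
    also have "\<dots> \<le> ?K * W" using W[OF r] K by (intro mult_left_mono) auto
    finally show "\<bar>h10_fun (reac lam (\<beta> r) (u r) - reac lam (\<beta> r) (v r)) x\<bar> \<le> ?K * W" .
  next
    fix n :: nat assume n: "0 < n"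
    have "\<bar>sc n (u s - v s)\<bar> \<le> 2 * W" by (rule sc_abs_le) (rule W, simp)
    then have "exp (- (real n)\<^sup>2 * (s + 1 - s)) * \<bar>sc n (u s - v s)\<bar> \<le> 1 / (real n)\<^sup>2 * (2 * W)"
      by (intro mult_mono exp_minus_square_le n) auto
    then show "exp (- (real n)\<^sup>2 * (s + 1 - s)) * \<bar>sc n (u s - v s)\<bar> \<le> 2 * W / (real n)\<^sup>2" by simp
  qed auto
  also have "\<dots> = smoothing_const M * W" by (simp add: smoothing_const_def algebra_simps)
  finally show ?thesis .
qed

text \<open>Two unit steps: during the first the heat flow turns the mass into a uniform bound,
  during the second \<open>smoothing\<close> turns this into a norm bound; hence the time 2 and the
  factor \<open>exp (lam * 2)\<close>.\<close>

lemma smoothing_mass: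
  assumes M: "cap M" and u: "below u M" and v: "below v M" and vu: "v \<preceq> u"
  shows "norm (E (s + 2) s u - E (s + 2) s v) \<le>
    smoothing_const M * (exp (lam * 2) * 3 * sine_const) * (mass u - mass v)"
proof -
  have u0: "0 \<preceq> u" and v0: "0 \<preceq> v" using u v by (auto simp: below_def)
  have nn: "0 \<preceq> u - v" using vu by (simp add: h10_le_def)
  have m: "0 \<le> mass u - mass v" using mass_mono[OF vu] by simp
  let ?W = "exp (lam * 2) * 3 * sine_const * (mass u - mass v)"
  have W: "\<bar>h10_fun (E r s u - E r s v) x\<bar> \<le> ?W" if r: "r \<in> {s + 1..s + 1 + 1}" for r x
  proof -
    have "\<bar>h10_fun (E r s u - E r s v) x\<bar> \<le> exp (lam * (r - s)) * (3 * norm (heat (r - s) (u - v)))"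
      using E_diff_pointwise[OF u0 v0 _ , of s r x] vu r by simp
    also have "\<dots> \<le> exp (lam * 2) * (3 * (sine_const * (mass u - mass v)))"
      using norm_heat_le_mass[OF nn, of "r - s"] r lam m sine_const_nonneg
      by (intro mult_mono) (auto simp: mass_diff)
    finally show ?thesis by (simp only: mult_ac)
  qed
  have "norm (E (s + 1 + 1) s u - E (s + 1 + 1) s v) \<le> smoothing_const M * ?W"
  proof (rule smoothing[OF sol_restrict[OF E_sol[OF u0]] sol_restrict[OF E_sol[OF v0]] _ _ W])
    fix r x assume "r \<in> {s + 1..s + 1 + 1}"
    then show "\<bar>h10_fun (E r s u) x\<bar> \<le> M" "\<bar>h10_fun (E r s v) x\<bar> \<le> M"
      using E_below[OF M u, of s r] E_below[OF M v, of s r] by (auto intro: below_abs)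
  qed auto
  then show ?thesis by (simp add: mult.assoc add.commute)
qed

lemma smoothing_const_nonneg: "0 \<le> smoothing_const M"
  using sine_const_nonneg b2_pos by (simp add: smoothing_const_def)

text \<open>Monotonicity in \<open>s\<close> gives convergence of the mass, and smoothing upgrades it to
  convergence in the norm.\<close>

lemma pullback_limit:
  assumes M: "cap M" and A: "\<And>s. below (A s) M"
    and mono: "(\<forall>s t. s \<le> t \<longrightarrow> E t s (A s) \<preceq> A t) \<or> (\<forall>s t. s \<le> t \<longrightarrow> A t \<preceq> E t s (A s))"
  obtains \<xi> where "\<And>s. sol lam \<beta> s \<xi>" "\<And>t. ((\<lambda>s. E t s (A s)) \<longlongrightarrow> \<xi> t) at_bot" "\<And>t. below (\<xi> t) M"
proof -
  define f where "f t s = E t s (A s)" for t s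
  have A0: "0 \<preceq> A s" for s using A[of s] by (simp add: below_def)
  have fb: "below (f t s) M" if "s \<le> t" for t s
    unfolding f_def by (rule E_below[OF M A that])
  have f0: "0 \<preceq> f t s" if "s \<le> t" for t s using fb[OF that] by (simp add: below_def)
  have step: "E t r (f r s) = f t s" if "s \<le> r" "r \<le> t" for r s t
    unfolding f_def by (rule E_cocycle[OF A0 that])
  \<comment> \<open>The cocycle property and monotonicity of the flow turn the hypothesis on
    \<open>A\<close> into monotonicity in the initial time.\<close>
  have fmono: "(\<forall>t s s'. s' \<le> s \<longrightarrow> s \<le> t \<longrightarrow> f t s' \<preceq> f t s) \<or> (\<forall>t s s'. s' \<le> s \<longrightarrow> s \<le> t \<longrightarrow> f t s \<preceq> f t s')"
    using mono
  proof
    assume m: "\<forall>s t. s \<le> t \<longrightarrow> E t s (A s) \<preceq> A t"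
    have "f t s' \<preceq> f t s" if "s' \<le> s" "s \<le> t" for t s s'
      using E_mono[OF f0[OF that(1)], of "A s" s t] m that step[OF that] by (simp add: f_def)
    then show ?thesis by blast
  next
    assume m: "\<forall>s t. s \<le> t \<longrightarrow> A t \<preceq> E t s (A s)"
    have "f t s \<preceq> f t s'" if "s' \<le> s" "s \<le> t" for t s s'
      using E_mono[OF A0[of s], of "f s s'" s t] m that step[OF that] by (simp add: f_def)
    then show ?thesis by blast
  qed
  have cmp: "f t s' \<preceq> f t s \<or> f t s \<preceq> f t s'" if "s \<le> t" "s' \<le> t" for t s s'
    using fmono that by (metis linear)
  define C where "C = smoothing_const M * (exp (lam * 2) * 3 * sine_const)"
  have C: "0 \<le> C" using smoothing_const_nonneg sine_const_nonneg by (simp add: C_def)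
  have est: "norm (f (t + 2) s - f (t + 2) s') \<le> C * \<bar>mass (f t s) - mass (f t s')\<bar>" if "s \<le> t" "s' \<le> t" for t s s'
  proof -
    have *: "norm (f (t + 2) s - f (t + 2) s') \<le> C * \<bar>mass (f t s) - mass (f t s')\<bar>"
      if "s \<le> t" "s' \<le> t" "f t s' \<preceq> f t s" for s s'
      using smoothing_mass[OF M fb fb, of s t s' t t] that step[of s t "t + 2"] step[of s' t "t + 2"]
        mass_mono[OF that(3)] by (simp add: C_def)
    show ?thesis using cmp[OF that] *[of s s'] *[of s' s] that by (auto simp: norm_minus_commute abs_minus_commute)
  qed
  \<comment> \<open>The mass is bounded and monotone in \<open>s\<close>; the decreasing case is
    reduced to the increasing one by a change of sign.\<close>
  have osc: "\<exists>s0\<le>t. \<forall>s\<le>s0. \<forall>s'\<le>s0. \<bar>mass (f t s) - mass (f t s')\<bar> < e" if e: "0 < e" for t e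
  proof -
    have gen: "\<exists>s0\<le>t. \<forall>s\<le>s0. \<forall>s'\<le>s0. \<bar>g s - g s'\<bar> < e"
      if g: "\<And>s s'. s' \<le> s \<Longrightarrow> s \<le> t \<Longrightarrow> g s' \<le> g s" and lb: "\<And>s. s \<le> t \<Longrightarrow> m \<le> g s" for g :: "real \<Rightarrow> real" and m
    proof -
      let ?S = "g ` {..t}"
      have ne: "?S \<noteq> {}" and bd: "bdd_below ?S" using lb by (auto intro!: bdd_belowI)
      obtain s0 where s0: "s0 \<le> t" "g s0 < Inf ?S + e"
        using cInf_lessD[OF ne, of "Inf ?S + e"] e by auto
      have "Inf ?S \<le> g s \<and> g s \<le> g s0" if "s \<le> s0" for s
        using that s0 g[of s s0] by (auto intro!: cInf_lower bd)
      then have "\<forall>s\<le>s0. \<forall>s'\<le>s0. \<bar>g s - g s'\<bar> < e"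
        using s0 unfolding abs_less_iff by (smt (verit))
      then show ?thesis using s0 by blast
    qed
    have bnd: "0 \<le> mass (f t s) \<and> mass (f t s) \<le> pi * M" if "s \<le> t" for s
    proof -
      have "integral {0..pi} (h10_fun (f t s)) \<le> integral {0..pi} (\<lambda>x. M)"
        using fb[OF that] by (intro integral_le integrable_continuous_real continuous_on_h10_fun continuous_intros) (auto simp: below_def)
      moreover have "0 \<le> integral {0..pi} (h10_fun (f t s))"
        using f0[OF that] by (intro integral_nonneg integrable_continuous_real continuous_on_h10_fun) (auto simp: h10_le_def)
      ultimately show ?thesis by (simp add: mass_def)
    qed
    from fmono show ?thesis
    proof
      assume "\<forall>t s s'. s' \<le> s \<longrightarrow> s \<le> t \<longrightarrow> f t s' \<preceq> f t s"
      then show ?thesis by (intro gen[of _ 0] mass_mono) (use bnd in auto)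
    next
      assume "\<forall>t s s'. s' \<le> s \<longrightarrow> s \<le> t \<longrightarrow> f t s \<preceq> f t s'"
      then have "\<exists>s0\<le>t. \<forall>s\<le>s0. \<forall>s'\<le>s0. \<bar>- mass (f t s) - - mass (f t s')\<bar> < e"
        by (intro gen[of _ "- (pi * M)"]) (use bnd in \<open>auto intro: mass_mono\<close>)
      then show ?thesis by (simp add: abs_minus_commute)
    qed
  qed
  have cauchy: "\<exists>s0\<le>t. \<forall>s\<le>s0. \<forall>s'\<le>s0. norm (f t s - f t s') < e" if e: "0 < e" for t e
  proof -
    have "0 < e / (C + 1)" using e C by simp
    \<comment> \<open>\<open>est\<close> controls the norm 2 units of time later, so the mass is
      examined at \<open>t - 2\<close>.\<close>
    from osc[OF this, of "t - 2"] obtain s0 where s0: "s0 \<le> t - 2"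
      and o: "\<And>s s'. s \<le> s0 \<Longrightarrow> s' \<le> s0 \<Longrightarrow> \<bar>mass (f (t - 2) s) - mass (f (t - 2) s')\<bar> < e / (C + 1)" by blast
    have "norm (f t s - f t s') < e" if "s \<le> s0" "s' \<le> s0" for s s'
    proof -
      have "norm (f t s - f t s') \<le> C * \<bar>mass (f (t - 2) s) - mass (f (t - 2) s')\<bar>"
        using est[of s "t - 2" s'] that s0 by simp
      also have "\<dots> \<le> C * (e / (C + 1))" using o[OF that] C by (intro mult_left_mono) auto
      also have "\<dots> < e" using C e by (simp add: field_simps)
      finally show ?thesis .
    qed
    then show ?thesis using s0 by (intro exI[of _ s0]) auto
  qed
  have "\<exists>L. (f t \<longlongrightarrow> L) at_bot" for t
  proof -
    define X where "X n = f t (- real n)" for n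
    have "Cauchy X"
    proof (rule CauchyI)
      fix e :: real assume "0 < e"
      from cauchy[OF this, of t] obtain s0 where s0: "\<And>s s'. s \<le> s0 \<Longrightarrow> s' \<le> s0 \<Longrightarrow> norm (f t s - f t s') < e" by blast
      obtain k where "- s0 \<le> real k" using real_arch_simple by blast
      then have "\<forall>m\<ge>k. \<forall>n\<ge>k. norm (X m - X n) < e" unfolding X_def by (auto intro!: s0)
      then show "\<exists>k. \<forall>m\<ge>k. \<forall>n\<ge>k. norm (X m - X n) < e" by blast
    qed
    then obtain L where L: "X \<longlonglongrightarrow> L" using Cauchy_convergent unfolding convergent_def by blast
    have "(f t \<longlongrightarrow> L) at_bot"
    proof (rule tendstoI)
      fix e :: real assume e: "0 < e"
      then have "0 < e / 2" by simp
      from cauchy[OF this, of t] obtain s0 where s0: "\<And>s s'. s \<le> s0 \<Longrightarrow> s' \<le> s0 \<Longrightarrow> norm (f t s - f t s') < e / 2" by blast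
      have "\<forall>\<^sub>F n in sequentially. dist (X n) L < e / 2" using L \<open>0 < e / 2\<close> by (rule tendstoD)
      moreover obtain k where "- s0 \<le> real k" using real_arch_simple by blast
      then have "\<forall>\<^sub>F n in sequentially. - s0 \<le> real n" by (auto intro: eventually_sequentiallyI[of k])
      ultimately have "\<forall>\<^sub>F n in sequentially. dist (X n) L < e / 2 \<and> - s0 \<le> real n" by eventually_elim simp
      then obtain n where n: "dist (X n) L < e / 2" "- s0 \<le> real n"
        using eventually_happens trivial_limit_sequentially by blast
      have "dist (f t s) L < e" if "s \<le> s0" for s
      proof -
        have "dist (f t s) (X n) < e / 2" unfolding X_def dist_norm using n that by (intro s0) auto
        then show ?thesis using n(1) dist_triangle[of "f t s" L "X n"] by linarith
      qed
      then show "\<forall>\<^sub>F s in at_bot. dist (f t s) L < e" by (auto simp: eventually_at_bot_linorder)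
    qed
    then show ?thesis by blast
  qed
  then obtain \<xi> where \<xi>: "\<And>t. (f t \<longlongrightarrow> \<xi> t) at_bot" by metis
  have ev: "\<forall>\<^sub>F s in at_bot. s \<le> t" for t :: real by (rule eventually_le_at_bot)
  have b\<xi>: "below (\<xi> t) M" for t
    unfolding below_def
  proof (intro conjI allI)
    show "0 \<preceq> \<xi> t"
      by (rule tendsto_h10_le[OF tendsto_const \<xi>]) (auto intro: eventually_mono[OF ev[of t] f0])
    fix x show "h10_fun (\<xi> t) x \<le> M"
      by (rule tendsto_upperbound[OF tendsto_h10_fun[OF \<xi>]])
        (use fb in \<open>auto intro: eventually_mono[OF ev[of t]] simp: below_def\<close>)
  qed
  \<comment> \<open>\<open>E_diff_pointwise\<close> applies to ordered pairs only, so the limit has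
    to be ordered relative to the approximants.\<close>
  have cmp\<xi>: "f t s \<preceq> \<xi> t \<or> \<xi> t \<preceq> f t s" if st: "s \<le> t" for s t
    using fmono
  proof
    assume m: "\<forall>t s s'. s' \<le> s \<longrightarrow> s \<le> t \<longrightarrow> f t s' \<preceq> f t s"
    have "\<xi> t \<preceq> f t s"
      by (rule tendsto_h10_le[OF \<xi> tendsto_const]) (use m st in \<open>auto intro: eventually_mono[OF ev[of s]]\<close>)
    then show ?thesis ..
  next
    assume m: "\<forall>t s s'. s' \<le> s \<longrightarrow> s \<le> t \<longrightarrow> f t s \<preceq> f t s'"
    have "f t s \<preceq> \<xi> t"
      by (rule tendsto_h10_le[OF tendsto_const \<xi>]) (use m st in \<open>auto intro: eventually_mono[OF ev[of s]]\<close>)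
    then show ?thesis ..
  qed
  have \<xi>0: "0 \<preceq> \<xi> t" for t using b\<xi>[of t] by (simp add: below_def)
  \<comment> \<open>The cocycle property is passed to the limit pointwise, which suffices to
    identify elements of \<open>h10\<close>.\<close>
  have inv: "E t s (\<xi> s) = \<xi> t" if st: "s \<le> t" for s t
  proof (rule h10_eqI)
    fix x
    have "((\<lambda>\<sigma>. exp (lam * (t - s)) * (3 * norm (f s \<sigma> - \<xi> s))) \<longlongrightarrow> exp (lam * (t - s)) * (3 * norm (\<xi> s - \<xi> s))) at_bot"
      by (intro tendsto_intros \<xi>)
    then have lim0: "((\<lambda>\<sigma>. exp (lam * (t - s)) * (3 * norm (f s \<sigma> - \<xi> s))) \<longlongrightarrow> 0) at_bot" by simp
    have "((\<lambda>\<sigma>. h10_fun (f t \<sigma>) x - h10_fun (E t s (\<xi> s)) x) \<longlongrightarrow> 0) at_bot"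
    proof (rule Lim_null_comparison[OF _ lim0])
      show "\<forall>\<^sub>F \<sigma> in at_bot. norm (h10_fun (f t \<sigma>) x - h10_fun (E t s (\<xi> s)) x) \<le> exp (lam * (t - s)) * (3 * norm (f s \<sigma> - \<xi> s))"
        using ev[of s]
      proof eventually_elim
        fix \<sigma> assume \<sigma>: "\<sigma> \<le> s"
        have "\<bar>h10_fun (E t s (f s \<sigma>)) x - h10_fun (E t s (\<xi> s)) x\<bar> \<le> exp (lam * (t - s)) * (3 * norm (heat (t - s) (f s \<sigma> - \<xi> s)))"
          by (rule E_diff_pointwise[OF f0[OF \<sigma>] \<xi>0 cmp\<xi>[OF \<sigma>] st])
        also have "\<dots> \<le> exp (lam * (t - s)) * (3 * norm (f s \<sigma> - \<xi> s))"
          using st by (intro mult_left_mono norm_heat_le) auto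
        finally show "norm (h10_fun (f t \<sigma>) x - h10_fun (E t s (\<xi> s)) x) \<le> exp (lam * (t - s)) * (3 * norm (f s \<sigma> - \<xi> s))"
          by (simp add: step[OF \<sigma> st])
      qed
    qed
    moreover have "((\<lambda>\<sigma>. h10_fun (f t \<sigma>) x - h10_fun (E t s (\<xi> s)) x) \<longlongrightarrow> h10_fun (\<xi> t) x - h10_fun (E t s (\<xi> s)) x) at_bot"
      by (intro tendsto_intros tendsto_h10_fun \<xi>)
    ultimately have "h10_fun (\<xi> t) x - h10_fun (E t s (\<xi> s)) x = 0"
      using tendsto_unique[OF trivial_limit_at_bot_linorder] by blast
    then show "h10_fun (E t s (\<xi> s)) x = h10_fun (\<xi> t) x" by simp
  qed
  have "sol lam \<beta> s \<xi>" for s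
    unfolding sol_def by (rule lin_sol_cong[OF sol_lin_sol[OF E_sol[OF \<xi>0[of s]]]]) (auto simp: inv)
  then show ?thesis using \<xi> b\<xi> by (intro that) (auto simp: f_def[abs_def])
qed

end

section \<open>Barriers and the part metric\<close>

lemma sine_mode_1_nonneg: "0 \<preceq> sine_mode 1"
  by (rule h10_leI) (auto simp: h10_fun_sine_mode sin_ge_zero)

lemma h10_le_scale: "0 \<preceq> u \<Longrightarrow> a \<le> b \<Longrightarrow> a *\<^sub>R u \<preceq> b *\<^sub>R u"
  by (auto simp: h10_le_def mult_right_mono)

lemma lin_sol_sine:
  assumes a: "\<And>t. s \<le> t \<Longrightarrow> (a has_real_derivative a' t) (at t within {s..})" and a': "continuous_on {s..} a'"
  shows "lin_sol s (\<lambda>t. a t *\<^sub>R sine_mode k) (\<lambda>t. (a' t + (real k)\<^sup>2 * a t) *\<^sub>R sine_mode k)"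
proof -
  have ca: "continuous_on {s..} a" using a by (intro DERIV_continuous_on) auto
  show ?thesis
    unfolding lin_sol_def
  proof (intro conjI allI impI)
    fix n t assume t: "s \<le> t"
    show "((\<lambda>t. sc n (a t *\<^sub>R sine_mode k)) has_real_derivative
        sc n ((a' t + (real k)\<^sup>2 * a t) *\<^sub>R sine_mode k) - (real n)\<^sup>2 * sc n (a t *\<^sub>R sine_mode k)) (at t within {s..})"
      using a[OF t] by (cases "n = k \<and> 0 < n") (auto simp: sc_sine_mode)
  qed (intro continuous_intros ca a')+
qed

lemma sin_triple: "sin (3 * x) = 3 * sin x - 4 * sin x ^ 3" for x :: real
proof -
  have "sin (3 * x) = sin (2 * x + x)" by simp
  also have "\<dots> = 2 * sin x * (cos x)\<^sup>2 + (1 - 2 * (sin x)\<^sup>2) * sin x"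
    unfolding sin_add sin_double cos_double_sin by (simp add: power2_eq_square)
  also have "\<dots> = 3 * sin x - 4 * sin x ^ 3"
    unfolding cos_squared_eq by (simp add: algebra_simps power2_eq_square power3_eq_cube)
  finally show ?thesis .
qed

lemma cube_le_self: "0 \<le> x \<Longrightarrow> x \<le> 1 \<Longrightarrow> x ^ 3 \<le> x" for x :: real
  using power_decreasing[of 1 3 x] by simp

text \<open>With \<open>Y = \<theta> X\<close>, the reaction at \<open>Z\<close> minus
  \<open>\<theta>\<close> times the reaction at \<open>X\<close> splits into terms with the factor
  \<open>Z - Y\<close>, bounded below by the damping term, and the gain
  \<open>b \<theta> (1 - \<theta>^2) X^3\<close>. The gain is estimated through
  \<open>X \<ge> \<delta> S\<close>, where \<open>S\<close> stands for \<open>sin x\<close>.\<close>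

lemma part_inequality:
  fixes X Z S M \<theta> \<theta>0 \<delta> b b1 b2 lam :: real
  assumes X: "0 \<le> X" "X \<le> M" and Z: "Z \<le> M" and \<theta>: "0 \<le> \<theta>0" "\<theta>0 \<le> \<theta>" "\<theta> \<le> 1"
    and le: "\<theta> * X \<le> Z" and S: "0 \<le> S" "\<delta> * S \<le> X" and \<delta>: "0 \<le> \<delta>"
    and b: "0 \<le> b1" "b1 \<le> b" "b \<le> b2" and lam: "0 \<le> lam"
  shows "- (3 * b2 * M\<^sup>2) * (Z - \<theta> * X) + b1 * \<theta>0 * (1 - \<theta>) * \<delta> ^ 3 * S ^ 3
    \<le> (lam * Z - b * Z ^ 3) - \<theta> * (lam * X - b * X ^ 3)"
proof -
  let ?Y = "\<theta> * X"
  have Y: "0 \<le> ?Y" "?Y \<le> M" using X \<theta> le Z by auto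
  then have Z0: "0 \<le> Z" using le by linarith
  have q: "Z\<^sup>2 + Z * ?Y + ?Y\<^sup>2 \<le> 3 * M\<^sup>2"
    using mult_mono[OF Z Y(2)] mult_mono[OF Z Z] mult_mono[OF Y(2) Y(2)] Y Z0 X by (simp add: power2_eq_square)
  have q0: "0 \<le> Z\<^sup>2 + Z * ?Y + ?Y\<^sup>2" using Y Z0 by simp
  have 1: "b * ((Z\<^sup>2 + Z * ?Y + ?Y\<^sup>2) * (Z - ?Y)) \<le> b2 * (3 * M\<^sup>2 * (Z - ?Y))"
    using b q q0 le by (intro mult_mono mult_right_mono mult_nonneg_nonneg) auto
  have "1 * (1 - \<theta>) \<le> (1 + \<theta>) * (1 - \<theta>)" using \<theta> by (intro mult_right_mono) auto
  then have \<theta>2: "1 - \<theta> \<le> 1 - \<theta>\<^sup>2" by (simp add: algebra_simps power2_eq_square)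
  have S3: "(\<delta> * S) ^ 3 \<le> X ^ 3" using S \<delta> by (intro power_mono) auto
  have 2: "b1 * \<theta>0 * (1 - \<theta>) * (\<delta> * S) ^ 3 \<le> b * \<theta> * (1 - \<theta>\<^sup>2) * X ^ 3"
    using b \<theta> \<theta>2 S3 S \<delta> by (intro mult_mono) auto
  have 3: "0 \<le> lam * (Z - ?Y)" using lam le by simp
  have e1: "(lam * Z - b * Z ^ 3) - \<theta> * (lam * X - b * X ^ 3) =
      lam * (Z - ?Y) - b * ((Z\<^sup>2 + Z * ?Y + ?Y\<^sup>2) * (Z - ?Y)) + b * \<theta> * (1 - \<theta>\<^sup>2) * X ^ 3"
    by (simp add: algebra_simps power2_eq_square power3_eq_cube)
  have e2: "b1 * \<theta>0 * (1 - \<theta>) * (\<delta> * S) ^ 3 = b1 * \<theta>0 * (1 - \<theta>) * \<delta> ^ 3 * S ^ 3"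
    by (simp add: power_mult_distrib)
  have e3: "- (3 * b2 * M\<^sup>2) * (Z - ?Y) = - (b2 * (3 * M\<^sup>2 * (Z - ?Y)))" by simp
  have "p + r' \<le> a" if "a = l - q + v" "r = r'" "p = - q'" "q \<le> q'" "r \<le> v" "0 \<le> l"
    for a l q q' v r r' p :: real
    using that by linarith
  from this[OF e1 e2 e3 1 2 3] show ?thesis .
qed

context chafee_infante
begin

text \<open>Since \<open>sin^3 x \<le> sin x\<close> on the interval, the cubic term is at most a
  multiple of \<open>sin x\<close>, and the subsolution condition reduces to the logistic inequality
  for \<open>a\<close>. The eigenvalue of the first mode accounts for
  \<open>lam - 1\<close>.\<close>

lemma barrier_sub:
  assumes a: "\<And>t. s \<le> t \<Longrightarrow> (a has_real_derivative a' t) (at t within {s..})" "continuous_on {s..} a'"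
    and nn: "\<And>t. 0 \<le> a t" and le: "\<And>t. s \<le> t \<Longrightarrow> a' t \<le> (lam - 1) * a t - b2 * a t ^ 3"
    and u: "sol lam \<beta> s u" and init: "a s *\<^sub>R sine_mode 1 \<preceq> u s" and t: "s \<le> t"
  shows "a t *\<^sub>R sine_mode 1 \<preceq> u t"
proof (rule reac_comparison[OF beta_cont sol_lin_sol[OF u] lin_sol_sine[OF a, where k = 1] _ init t, where lam = lam])
  fix r x assume r: "r \<in> {s..t}" and x: "x \<in> {0..pi}"
  have S: "0 \<le> sin x" "sin x \<le> 1" using x sin_ge_zero by auto
  have S3: "sin x ^ 3 \<le> sin x"
    using S by (rule cube_le_self)
  have "(a' r + a r) * sin x \<le> (lam * a r - b2 * a r ^ 3) * sin x"
    using le[of r] r S by (intro mult_right_mono) (auto simp: algebra_simps)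
  moreover have "\<beta> r * (a r ^ 3 * sin x ^ 3) \<le> b2 * (a r ^ 3 * sin x)"
    using S S3 nn[of r] beta_le[of r] b2_pos by (intro mult_mono mult_left_mono) auto
  ultimately have "(a' r + a r) * sin x \<le> lam * (a r * sin x) - \<beta> r * (a r * sin x) ^ 3"
    by (simp add: algebra_simps power_mult_distrib)
  then show "h10_fun (reac lam (\<beta> r) (u r) - reac lam (\<beta> r) (a r *\<^sub>R sine_mode 1)) x
      \<le> h10_fun (reac lam (\<beta> r) (u r) - (a' r + (real 1)\<^sup>2 * a r) *\<^sub>R sine_mode 1) x"
    using x by (simp add: h10_fun_reac h10_fun_sine_mode)
qed

text \<open>The cubic term has the favourable sign and is dropped; only the linear growth rate
  \<open>lam - 1\<close> of the first mode remains.\<close>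

lemma barrier_super:
  assumes a: "\<And>t. s \<le> t \<Longrightarrow> (a has_real_derivative a' t) (at t within {s..})" "continuous_on {s..} a'"
    and nn: "\<And>t. 0 \<le> a t" and le: "\<And>t. s \<le> t \<Longrightarrow> (lam - 1) * a t \<le> a' t"
    and u: "sol lam \<beta> s u" and init: "u s \<preceq> a s *\<^sub>R sine_mode 1" and t: "s \<le> t"
  shows "u t \<preceq> a t *\<^sub>R sine_mode 1"
proof (rule reac_comparison[OF beta_cont lin_sol_sine[OF a, where k = 1] sol_lin_sol[OF u] _ init t, where lam = lam])
  fix r x assume r: "r \<in> {s..t}" and x: "x \<in> {0..pi}"
  have S: "0 \<le> sin x" using x sin_ge_zero by auto
  have "(lam * a r) * sin x \<le> (a' r + a r) * sin x"
    using le[of r] r S by (intro mult_right_mono) (auto simp: algebra_simps)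
  moreover have "0 \<le> \<beta> r * (a r * sin x) ^ 3"
    using S nn[of r] beta_pos[of r] by simp
  ultimately have "lam * (a r * sin x) - \<beta> r * (a r * sin x) ^ 3 \<le> (a' r + a r) * sin x"
    by (simp add: mult.assoc)
  then show "h10_fun (reac lam (\<beta> r) (a r *\<^sub>R sine_mode 1) - reac lam (\<beta> r) (u r)) x
      \<le> h10_fun ((a' r + (real 1)\<^sup>2 * a r) *\<^sub>R sine_mode 1 - reac lam (\<beta> r) (u r)) x"
    using x by (simp add: h10_fun_reac h10_fun_sine_mode)
qed

lemma lin_sol_const:
  assumes "\<And>n. (real n)\<^sup>2 * sc n \<phi> = sc n G" shows "lin_sol s (\<lambda>_. \<phi>) (\<lambda>_. G)"
  using assms by (simp add: lin_sol_def)

text \<open>Raising the coefficient from \<open>b1\<close> to \<open>\<beta> r\<close> only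
  strengthens the absorption, so the autonomous equilibrium is a supersolution.\<close>

lemma stationary_super:
  assumes \<phi>: "\<And>n. (real n)\<^sup>2 * sc n \<phi> = sc n (reac lam b1 \<phi>)" and nn: "0 \<preceq> \<phi>" and st: "s \<le> t"
  shows "E t s \<phi> \<preceq> \<phi>"
proof (rule reac_comparison[OF beta_cont lin_sol_const[OF \<phi>] sol_lin_sol[OF E_sol[OF nn]] _ _ st, where lam = lam])
  fix r x
  have "b1 * h10_fun \<phi> x ^ 3 \<le> \<beta> r * h10_fun \<phi> x ^ 3"
    using nn beta_ge[of r] by (intro mult_right_mono) (auto simp: h10_le_def)
  then show "h10_fun (reac lam (\<beta> r) \<phi> - reac lam (\<beta> r) (E r s \<phi>)) x \<le> h10_fun (reac lam b1 \<phi> - reac lam (\<beta> r) (E r s \<phi>)) x"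
    by (simp add: h10_fun_reac)
qed (simp add: E_self nn)

section \<open>Contraction in the part metric\<close>

text \<open>Because \<open>\<theta>^3 \<le> \<theta>\<close>, the reaction at
  \<open>\<theta> \<xi>\<close> is at least \<open>\<theta>\<close> times the reaction at
  \<open>\<xi>\<close>, so \<open>\<theta> \<xi>\<close> is a subsolution.\<close>

lemma part_preserved:
  assumes \<xi>: "sol lam \<beta> s \<xi>" and \<zeta>: "sol lam \<beta> s \<zeta>" and nn: "\<And>r. s \<le> r \<Longrightarrow> 0 \<preceq> \<xi> r"
    and \<theta>: "0 \<le> \<theta>" "\<theta> \<le> 1" and le: "\<theta> *\<^sub>R \<xi> s \<preceq> \<zeta> s" and t: "s \<le> t"
  shows "\<theta> *\<^sub>R \<xi> t \<preceq> \<zeta> t"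
proof (rule reac_comparison[OF beta_cont sol_lin_sol[OF \<zeta>] lin_sol_scale[OF sol_lin_sol[OF \<xi>]] _ le t, where lam = lam])
  fix r x assume r: "r \<in> {s..t}"
  let ?X = "h10_fun (\<xi> r) x"
  have "0 \<le> ?X" using nn[of r] r by (simp add: h10_le_def)
  moreover have "\<theta> ^ 3 \<le> \<theta>" using \<theta> by (rule cube_le_self)
  ultimately have "\<beta> r * (\<theta> ^ 3 * ?X ^ 3) \<le> \<beta> r * (\<theta> * ?X ^ 3)"
    using beta_pos[of r] by (intro mult_left_mono mult_right_mono) auto
  then show "h10_fun (reac lam (\<beta> r) (\<zeta> r) - reac lam (\<beta> r) (\<theta> *\<^sub>R \<xi> r)) x
      \<le> h10_fun (reac lam (\<beta> r) (\<zeta> r) - \<theta> *\<^sub>R reac lam (\<beta> r) (\<xi> r)) x"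
    by (simp add: h10_fun_reac algebra_simps power_mult_distrib)
qed

text \<open>The fraction of \<open>1 - \<theta>\<close> gained in unit time: the exponential is the
  loss to damping, \<open>7 / 24 = 3 / 8 - 1 / 12\<close> comes from the explicit two-mode solution
  at time 1, \<open>b1 \<theta>0 \<delta>^3\<close> measures the source, and \<open>C\<close>
  converts \<open>sin x\<close> back into \<open>\<xi>\<close>. The minimum with 1 keeps
  \<open>1 - part_rate\<close> nonnegative.\<close>

definition part_rate :: "real \<Rightarrow> real \<Rightarrow> real \<Rightarrow> real \<Rightarrow> real" where
  "part_rate M \<theta>0 \<delta> C = min 1 (exp (- (3 * b2 * M\<^sup>2)) * (7 / 24) * (b1 * \<theta>0 * \<delta> ^ 3) / C)"

lemma part_rate_bounds: "0 < \<theta>0 \<Longrightarrow> 0 < \<delta> \<Longrightarrow> 0 < C \<Longrightarrow> 0 < part_rate M \<theta>0 \<delta> C \<and> part_rate M \<theta>0 \<delta> C \<le> 1"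
  using b1 by (simp add: part_rate_def)

text \<open>A quantitative Hopf lemma: \<open>\<zeta> - \<theta> \<xi>\<close> is driven by a multiple of
  \<open>sin\<^sup>3 x = (3 sin x - sin 3x) / 4\<close>, for which the linear problem is solved explicitly.\<close>

lemma part_step:
  assumes \<xi>: "sol lam \<beta> s \<xi>" and \<zeta>: "sol lam \<beta> s \<zeta>"
    and b\<xi>: "\<And>r. s \<le> r \<Longrightarrow> below (\<xi> r) M" and b\<zeta>: "\<And>r. s \<le> r \<Longrightarrow> below (\<zeta> r) M"
    and \<delta>: "0 < \<delta>" "\<And>r. s \<le> r \<Longrightarrow> \<delta> *\<^sub>R sine_mode 1 \<preceq> \<xi> r"
    and C: "0 < C" "\<xi> (s + 1) \<preceq> C *\<^sub>R sine_mode 1"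
    and \<theta>: "0 < \<theta>0" "\<theta>0 \<le> \<theta>" "\<theta> \<le> 1" and le: "\<theta> *\<^sub>R \<xi> s \<preceq> \<zeta> s"
  shows "(1 - (1 - \<theta>) * (1 - part_rate M \<theta>0 \<delta> C)) *\<^sub>R \<xi> (s + 1) \<preceq> \<zeta> (s + 1)"
proof -
  define K where "K = 3 * b2 * M\<^sup>2"
  have K: "0 \<le> K" using b2_pos by (simp add: K_def)
  define g where "g = b1 * \<theta>0 * (1 - \<theta>) * \<delta> ^ 3"
  have g: "0 \<le> g" using b1 \<theta> \<delta> by (simp add: g_def)
  have nn\<xi>: "0 \<preceq> \<xi> r" if "s \<le> r" for r using b\<xi>[OF that] by (simp add: below_def)
  have pres: "\<theta> *\<^sub>R \<xi> t \<preceq> \<zeta> t" if "s \<le> t" for t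
    by (rule part_preserved[OF \<xi> \<zeta> nn\<xi> _ \<theta>(3) le that]) (use \<theta> in auto)
  \<comment> \<open>Variation of constants for the damped equation with source
    \<open>g exp (- K (t - s)) sin^3 x\<close>; the third mode has rate 9, whence
    \<open>g / 36 = (g / 4) / 9\<close>.\<close>
  define p where "p t = exp (- K * (t - s)) * (g * (3 / 4) * (1 - exp (- (t - s))))" for t
  define q where "q t = exp (- K * (t - s)) * (- (g / 36) * (1 - exp (- 9 * (t - s))))" for t
  define p' where "p' t = - K * p t + exp (- K * (t - s)) * (g * (3 / 4)) - p t" for t
  define q' where "q' t = - K * q t - exp (- K * (t - s)) * (g / 4) - 9 * q t" for t
  \<comment> \<open>Names for the exponentials keep the derivative computations polynomial.\<close>
  define A where "A t = exp (- K * (t - s))" for t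
  define B where "B t = exp (- (t - s))" for t
  define D where "D t = exp (- 9 * (t - s))" for t
  have dA: "(A has_real_derivative - K * A t) (at t within {s..})"
    and dB: "(B has_real_derivative - B t) (at t within {s..})"
    and dD: "(D has_real_derivative - 9 * D t) (at t within {s..})" for t
    unfolding A_def[abs_def] B_def[abs_def] D_def[abs_def] by (auto intro!: derivative_eq_intros)
  have dp: "(p has_real_derivative p' t) (at t within {s..})" for t
    unfolding p_def[abs_def] p'_def A_def[symmetric] B_def[symmetric]
    by (rule derivative_eq_intros dA dB refl)+ (simp add: field_simps)
  have dq: "(q has_real_derivative q' t) (at t within {s..})" for t
    unfolding q_def[abs_def] q'_def A_def[symmetric] D_def[symmetric]
    by (rule derivative_eq_intros dA dD refl)+ (simp add: field_simps)
  have cp: "continuous_on {s..} p'" and cq: "continuous_on {s..} q'"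
    unfolding p'_def q'_def p_def q_def by (intro continuous_intros)+
  let ?y = "\<lambda>t. p t *\<^sub>R sine_mode 1 + q t *\<^sub>R sine_mode 3"
  let ?H = "\<lambda>t. (p' t + (real 1)\<^sup>2 * p t) *\<^sub>R sine_mode 1 + (q' t + (real 3)\<^sup>2 * q t) *\<^sub>R sine_mode 3"
  have y: "lin_sol s ?y ?H"
    by (intro lin_sol_add lin_sol_sine dp dq cp cq)
  \<comment> \<open>A linear comparison with reaction \<open>- K w\<close> and no cubic term: the
    damping dominates the possibly negative part of the nonlinear difference.\<close>
  have main: "?y (s + 1) \<preceq> \<zeta> (s + 1) - \<theta> *\<^sub>R \<xi> (s + 1)"
  proof (rule reac_comparison[OF _ lin_sol_diff[OF sol_lin_sol[OF \<zeta>] lin_sol_scale[OF sol_lin_sol[OF \<xi>]]] y, where lam = "- K" and \<beta> = "\<lambda>_. 0"])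
    show "?y s \<preceq> \<zeta> s - \<theta> *\<^sub>R \<xi> s" using le by (simp add: p_def q_def h10_le_def)
    fix r x assume r: "r \<in> {s..s + 1}" and x: "x \<in> {0..pi}"
    let ?X = "h10_fun (\<xi> r) x" and ?Z = "h10_fun (\<zeta> r) x" and ?S = "sin x"
    have S: "0 \<le> ?S" using x sin_ge_zero by auto
    have "- (3 * b2 * M\<^sup>2) * (?Z - \<theta> * ?X) + b1 * \<theta>0 * (1 - \<theta>) * \<delta> ^ 3 * ?S ^ 3
        \<le> (lam * ?Z - \<beta> r * ?Z ^ 3) - \<theta> * (lam * ?X - \<beta> r * ?X ^ 3)"
    proof (rule part_inequality)
      show "0 \<le> ?X" "?X \<le> M" "?Z \<le> M"
        using b\<xi>[of r] b\<zeta>[of r] r by (auto simp: below_def h10_le_def)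
      show "\<theta> * ?X \<le> ?Z" using pres[of r] r by (simp add: h10_le_def)
      have "h10_fun (\<delta> *\<^sub>R sine_mode 1) x \<le> ?X" using \<delta>(2)[of r] r by (intro h10_leD) auto
      then show "\<delta> * ?S \<le> ?X" using x by (simp add: h10_fun_sine_mode)
    qed (use \<theta> S \<delta> b1 beta_ge beta_le lam in auto)
    then have 1: "- K * (?Z - \<theta> * ?X) + g * ?S ^ 3 \<le> (lam * ?Z - \<beta> r * ?Z ^ 3) - \<theta> * (lam * ?X - \<beta> r * ?X ^ 3)"
      by (simp add: K_def g_def)
    \<comment> \<open>The source of the explicit solution carries the additional factor
      \<open>exp (- K (r - s)) \<le> 1\<close>, which makes damping a common factor of both
      modes.\<close>
    have "exp (- K * (r - s)) * (g * ?S ^ 3) \<le> 1 * (g * ?S ^ 3)"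
      using K g S r by (intro mult_right_mono) auto
    moreover have "h10_fun (?H r) x = - K * h10_fun (?y r) x + exp (- K * (r - s)) * (g * ?S ^ 3)"
    proof -
      have "h10_fun (?H r) x = (p' r + p r) * sin x + (q' r + 9 * q r) * sin (3 * x)"
        using x by (simp add: h10_fun_sine_mode)
      also have "\<dots> = - K * (p r * sin x + q r * sin (3 * x)) + exp (- K * (r - s)) * (g * (3 / 4 * sin x - 1 / 4 * sin (3 * x)))"
        by (simp add: p'_def q'_def algebra_simps)
      also have "3 / 4 * sin x - 1 / 4 * sin (3 * x) = ?S ^ 3" unfolding sin_triple by (simp add: field_simps)
      finally show ?thesis using x by (simp add: h10_fun_sine_mode)
    qed
    ultimately have "- K * (?Z - \<theta> * ?X) - (- K * h10_fun (?y r) x) \<le>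
        ((lam * ?Z - \<beta> r * ?Z ^ 3) - \<theta> * (lam * ?X - \<beta> r * ?X ^ 3)) - h10_fun (?H r) x"
      using 1 by linarith
    then show "h10_fun (reac (- K) 0 (\<zeta> r - \<theta> *\<^sub>R \<xi> r) - reac (- K) 0 (?y r)) x \<le>
        h10_fun (reac lam (\<beta> r) (\<zeta> r) - \<theta> *\<^sub>R reac lam (\<beta> r) (\<xi> r) - ?H r) x"
      unfolding h10_fun_diff h10_fun_reac h10_fun_scale by simp
  qed auto
  let ?\<kappa> = "part_rate M \<theta>0 \<delta> C"
  show ?thesis
  proof (rule h10_leI)
    fix x :: real assume x: "x \<in> {0<..<pi}"
    let ?X = "h10_fun (\<xi> (s + 1)) x" and ?Z = "h10_fun (\<zeta> (s + 1)) x" and ?S = "sin x"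
    have S: "0 \<le> ?S" using x sin_ge_zero by auto
    have X: "0 \<le> ?X" using nn\<xi>[of "s + 1"] by (simp add: h10_le_def)
    have "h10_fun (?y (s + 1)) x \<le> h10_fun (\<zeta> (s + 1) - \<theta> *\<^sub>R \<xi> (s + 1)) x"
      by (rule h10_leD[OF main])
    then have yz: "p (s + 1) * ?S + q (s + 1) * sin (3 * x) \<le> ?Z - \<theta> * ?X"
      using x by (simp add: h10_fun_sine_mode)
    have "exp (- 1) \<le> (1 / 2 :: real)"
      using exp_ge_add_one_self[of 1] by (simp add: exp_minus field_simps)
    then have e1: "1 / 2 \<le> 1 - exp (- 1 :: real)" by simp
    have "exp (- K) * (g * (7 / 24) * ?S) \<le> p (s + 1) * ?S + q (s + 1) * sin (3 * x)"
    proof -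
      \<comment> \<open>The third mode is subtracted and may have either sign; only its upper bound
        \<open>3 sin x\<close> matters.\<close>
      have S3: "sin (3 * x) \<le> 3 * ?S" using S by (simp add: sin_triple)
      have "(1 - exp (- 9)) * sin (3 * x) \<le> 1 * (3 * ?S)"
      proof (cases "0 \<le> sin (3 * x)")
        case True
        then show ?thesis using S3 by (intro mult_mono) auto
      next
        case False
        then have "(1 - exp (- 9)) * sin (3 * x) \<le> 0" by (intro mult_nonneg_nonpos) auto
        then show ?thesis using S by simp
      qed
      then have "g / 36 * ((1 - exp (- 9)) * sin (3 * x)) \<le> g / 36 * (1 * (3 * ?S))"
        using g by (intro mult_left_mono) auto
      moreover have "g * (3 / 4) * (1 / 2) * ?S \<le> g * (3 / 4) * (1 - exp (- 1)) * ?S"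
        using g e1 S by (intro mult_right_mono mult_left_mono) auto
      ultimately have "g * (7 / 24) * ?S \<le> g * (3 / 4) * (1 - exp (- 1)) * ?S - g / 36 * ((1 - exp (- 9)) * sin (3 * x))"
        by simp
      then have "exp (- K) * (g * (7 / 24) * ?S) \<le> exp (- K) * (g * (3 / 4) * (1 - exp (- 1)) * ?S - g / 36 * ((1 - exp (- 9)) * sin (3 * x)))"
        by (intro mult_left_mono) auto
      also have "\<dots> = p (s + 1) * ?S + q (s + 1) * sin (3 * x)"
      proof -
        have "k * (a * b * z - h * (v * w)) = k * (a * b) * z + k * (- h * v) * w" for k a b z h v w :: real
          by (simp add: right_diff_distrib)
        from this[of "exp (- K)" "g * (3 / 4)" "1 - exp (- 1)" ?S "g / 36" "1 - exp (- 9)" "sin (3 * x)"]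
        show ?thesis by (simp add: p_def q_def)
      qed
      finally show ?thesis .
    qed
    moreover have "(1 - \<theta>) * (?\<kappa> * ?X) \<le> exp (- K) * (g * (7 / 24) * ?S)"
    proof -
      let ?c = "exp (- K) * (7 / 24) * (b1 * \<theta>0 * \<delta> ^ 3)"
      have c: "0 \<le> ?c / C" using b1 \<theta> \<delta> C by simp
      have "h10_fun (\<xi> (s + 1)) x \<le> h10_fun (C *\<^sub>R sine_mode 1) x" by (rule h10_leD[OF C(2)])
      then have XC: "?X \<le> C * ?S" using x by (simp add: h10_fun_sine_mode)
      have "?\<kappa> \<le> ?c / C" unfolding part_rate_def K_def by (rule min.cobounded2)
      from mult_mono[OF this XC c X] have "?\<kappa> * ?X \<le> (?c / C) * (C * ?S)" .
      also have "\<dots> = ?c * ?S"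
        unfolding mult.assoc[symmetric] using C(1) by (subst nonzero_divide_eq_eq[THEN iffD1, OF _ refl]) auto
      finally have "(1 - \<theta>) * (?\<kappa> * ?X) \<le> (1 - \<theta>) * (?c * ?S)"
        using \<theta> by (intro mult_left_mono) auto
      then show ?thesis by (simp add: g_def mult_ac)
    qed
    ultimately have "(1 - \<theta>) * (?\<kappa> * ?X) \<le> ?Z - \<theta> * ?X" using yz by linarith
    then show "h10_fun ((1 - (1 - \<theta>) * (1 - ?\<kappa>)) *\<^sub>R \<xi> (s + 1)) x \<le> ?Z"
      by (simp add: algebra_simps)
  qed
qed

text \<open>The defects satisfy
  \<open>1 - \<theta> (n + 1) = (1 - \<theta> n) (1 - \<kappa>)\<close>. The rate is computed once
  from \<open>\<theta>0\<close>, which stays a lower bound for every \<open>\<theta> n\<close>; the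
  factor \<open>1 - \<theta>0\<close> is at most 1 and is dropped at the end.\<close>

lemma part_iterate:
  assumes \<xi>: "sol lam \<beta> s \<xi>" and \<zeta>: "sol lam \<beta> s \<zeta>"
    and b\<xi>: "\<And>r. s \<le> r \<Longrightarrow> below (\<xi> r) M" and b\<zeta>: "\<And>r. s \<le> r \<Longrightarrow> below (\<zeta> r) M"
    and \<delta>: "0 < \<delta>" "\<And>r. s \<le> r \<Longrightarrow> \<delta> *\<^sub>R sine_mode 1 \<preceq> \<xi> r"
    and C: "0 < C" "\<And>r. s \<le> r \<Longrightarrow> \<xi> r \<preceq> C *\<^sub>R sine_mode 1"
    and \<theta>: "0 < \<theta>0" "\<theta>0 \<le> 1" and le: "\<theta>0 *\<^sub>R \<xi> s \<preceq> \<zeta> s" and t: "s + real n \<le> t"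
  shows "(1 - (1 - part_rate M \<theta>0 \<delta> C) ^ n) *\<^sub>R \<xi> t \<preceq> \<zeta> t"
proof -
  define \<kappa> where "\<kappa> = part_rate M \<theta>0 \<delta> C"
  have \<kappa>: "0 < \<kappa>" "\<kappa> \<le> 1" using part_rate_bounds[OF \<theta>(1) \<delta>(1) C(1)] by (auto simp: \<kappa>_def)
  have nn\<xi>: "0 \<preceq> \<xi> r" if "s \<le> r" for r using b\<xi>[OF that] by (simp add: below_def)
  define \<theta> where "\<theta> n = 1 - (1 - \<theta>0) * (1 - \<kappa>) ^ n" for n :: nat
  have pw: "0 \<le> (1 - \<kappa>) ^ n" "(1 - \<kappa>) ^ n \<le> 1" for n using \<kappa> by (auto intro: power_le_one)
  have \<theta>n: "\<theta>0 \<le> \<theta> n" "\<theta> n \<le> 1" for n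
  proof -
    have "(1 - \<theta>0) * (1 - \<kappa>) ^ n \<le> (1 - \<theta>0) * 1" using pw[of n] \<theta> by (intro mult_left_mono) auto
    then show "\<theta>0 \<le> \<theta> n" by (simp add: \<theta>_def)
    have "0 \<le> (1 - \<theta>0) * (1 - \<kappa>) ^ n" using pw[of n] \<theta> by (intro mult_nonneg_nonneg) auto
    then show "\<theta> n \<le> 1" by (simp add: \<theta>_def)
  qed
  have it: "\<theta> n *\<^sub>R \<xi> (s + real n) \<preceq> \<zeta> (s + real n)" for n
  proof (induction n)
    case 0
    then show ?case using le by (simp add: \<theta>_def)
  next
    case (Suc n)
    have sn: "s \<le> s + real n" by simp
    have "(1 - (1 - \<theta> n) * (1 - part_rate M \<theta>0 \<delta> C)) *\<^sub>R \<xi> (s + real n + 1) \<preceq> \<zeta> (s + real n + 1)"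
      by (rule part_step[OF sol_restrict[OF \<xi> sn] sol_restrict[OF \<zeta> sn] b\<xi> b\<zeta> \<delta> C \<theta>(1) \<theta>n Suc.IH]) auto
    then show ?case by (simp add: \<theta>_def \<kappa>_def algebra_simps)
  qed
  have sn: "s \<le> s + real n" by simp
  have "\<theta> n *\<^sub>R \<xi> t \<preceq> \<zeta> t"
    by (rule part_preserved[OF sol_restrict[OF \<xi> sn] sol_restrict[OF \<zeta> sn] nn\<xi> _ _ it t])
      (use \<theta>n[of n] \<theta> in auto)
  moreover have "(1 - (1 - \<kappa>) ^ n) *\<^sub>R \<xi> t \<preceq> \<theta> n *\<^sub>R \<xi> t"
  proof (rule h10_le_scale)
    show "0 \<preceq> \<xi> t" using t by (intro nn\<xi>) auto
    have "(1 - \<theta>0) * (1 - \<kappa>) ^ n \<le> 1 * (1 - \<kappa>) ^ n" using pw[of n] \<theta> by (intro mult_right_mono) auto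
    then show "1 - (1 - \<kappa>) ^ n \<le> \<theta> n" by (simp add: \<theta>_def)
  qed
  ultimately show ?thesis unfolding \<kappa>_def by (rule h10_le_trans[rotated])
qed

text \<open>The contraction bounds the uniform distance by \<open>(1 - \<kappa>)^n M\<close> on the
  window from \<open>t - 1\<close> to \<open>t\<close>, and \<open>smoothing\<close> lifts this to
  the norm at its end; the window costs one extra unit in \<open>s + n + 1 \<le> t\<close>.\<close>

lemma part_converge:
  assumes \<xi>: "sol lam \<beta> s \<xi>" and \<zeta>: "sol lam \<beta> s \<zeta>"
    and b\<xi>: "\<And>r. s \<le> r \<Longrightarrow> below (\<xi> r) M" and b\<zeta>: "\<And>r. s \<le> r \<Longrightarrow> below (\<zeta> r) M"
    and \<delta>: "0 < \<delta>" "\<And>r. s \<le> r \<Longrightarrow> \<delta> *\<^sub>R sine_mode 1 \<preceq> \<xi> r"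
    and C: "0 < C" "\<And>r. s \<le> r \<Longrightarrow> \<xi> r \<preceq> C *\<^sub>R sine_mode 1"
    and \<theta>: "0 < \<theta>0" "\<theta>0 \<le> 1" and le: "\<theta>0 *\<^sub>R \<xi> s \<preceq> \<zeta> s" and up: "\<And>r. s \<le> r \<Longrightarrow> \<zeta> r \<preceq> \<xi> r"
  shows "((\<lambda>t. \<zeta> t - \<xi> t) \<longlongrightarrow> 0) at_top"
proof -
  define \<kappa> where "\<kappa> = part_rate M \<theta>0 \<delta> C"
  have \<kappa>: "0 < \<kappa>" "\<kappa> \<le> 1" using part_rate_bounds[OF \<theta>(1) \<delta>(1) C(1)] by (auto simp: \<kappa>_def)
  have est: "norm (\<zeta> t - \<xi> t) \<le> smoothing_const M * ((1 - \<kappa>) ^ n * M)" if t: "s + real n + 1 \<le> t" for n t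
  proof -
    have "norm (\<zeta> (t - 1 + 1) - \<xi> (t - 1 + 1)) \<le> smoothing_const M * ((1 - \<kappa>) ^ n * M)"
    proof (rule smoothing[OF sol_restrict[OF \<zeta>] sol_restrict[OF \<xi>]])
      fix r x assume r: "r \<in> {t - 1..t - 1 + 1}"
      then have sr: "s \<le> r" and nr: "s + real n \<le> r" using t by auto
      show "\<bar>h10_fun (\<zeta> r) x\<bar> \<le> M" "\<bar>h10_fun (\<xi> r) x\<bar> \<le> M"
        using b\<xi>[OF sr] b\<zeta>[OF sr] by (auto intro: below_abs)
      have "h10_fun (\<zeta> r) x \<le> h10_fun (\<xi> r) x" by (rule h10_leD[OF up[OF sr]])
      moreover have "(1 - (1 - \<kappa>) ^ n) * h10_fun (\<xi> r) x \<le> h10_fun (\<zeta> r) x"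
        using h10_leD[OF part_iterate[OF \<xi> \<zeta> b\<xi> b\<zeta> \<delta> C \<theta> le nr], of x] by (simp add: \<kappa>_def)
      moreover have "(1 - \<kappa>) ^ n * h10_fun (\<xi> r) x \<le> (1 - \<kappa>) ^ n * M"
        using \<kappa> b\<xi>[OF sr] by (intro mult_left_mono) (auto simp: below_def)
      ultimately show "\<bar>h10_fun (\<zeta> r - \<xi> r) x\<bar> \<le> (1 - \<kappa>) ^ n * M"
        by (simp add: left_diff_distrib)
    qed (use t in auto)
    then show ?thesis by simp
  qed
  have "(\<lambda>n. smoothing_const M * ((1 - \<kappa>) ^ n * M)) \<longlonglongrightarrow> smoothing_const M * (0 * M)"
    using \<kappa> by (intro tendsto_mult tendsto_const LIMSEQ_power_zero) auto
  then have l: "(\<lambda>n. smoothing_const M * ((1 - \<kappa>) ^ n * M)) \<longlonglongrightarrow> 0" by simp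
  show ?thesis
  proof (rule tendstoI)
    fix e :: real assume "0 < e"
    then have "\<forall>\<^sub>F n in sequentially. smoothing_const M * ((1 - \<kappa>) ^ n * M) < e"
      using l by (rule order_tendstoD(2)[rotated])
    then obtain n where n: "smoothing_const M * ((1 - \<kappa>) ^ n * M) < e"
      using eventually_happens trivial_limit_sequentially by blast
    have "dist (\<zeta> t - \<xi> t) 0 < e" if "s + real n + 1 \<le> t" for t
      using est[OF that] n by simp
    then show "\<forall>\<^sub>F t in at_top. dist (\<zeta> t - \<xi> t) 0 < e" by (auto simp: eventually_at_top_linorder)
  qed
qed

text \<open>The barrier is the logistic solution of \<open>a' = (lam - 1) a - (lam - 1) c a\<^sup>3\<close>.\<close>

lemma connection:
  assumes \<phi>: "\<And>n. (real n)\<^sup>2 * sc n \<phi> = sc n (reac lam b1 \<phi>)"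
    and \<delta>0: "0 < \<delta>0" "\<delta>0 *\<^sub>R sine_mode 1 \<preceq> \<phi>" and C: "0 < C" "\<phi> \<preceq> C *\<^sub>R sine_mode 1"
  obtains \<xi> \<zeta> where "\<And>s. sol lam \<beta> s \<xi>" "\<And>s. sol lam \<beta> s \<zeta>"
    "\<And>t. ((\<lambda>s. E t s \<phi>) \<longlongrightarrow> \<xi> t) at_bot" "(\<zeta> \<longlongrightarrow> 0) at_bot" "((\<lambda>t. \<zeta> t - \<xi> t) \<longlongrightarrow> 0) at_top"
proof -
  let ?e = "sine_mode 1"
  define \<mu> where "\<mu> = lam - 1"
  have \<mu>: "0 < \<mu>" using lam by (simp add: \<mu>_def)
  \<comment> \<open>The first bound makes the cubic coefficient of the logistic equation at least
    \<open>b2\<close>, as \<open>barrier_sub\<close> demands; the second keeps the saturation level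
    \<open>1 / sqrt c\<close> at most \<open>\<delta>0\<close>, so the barrier lies under
    \<open>\<phi>\<close>.\<close>
  define c where "c = max (b2 / \<mu>) (1 / \<delta>0\<^sup>2)"
  have c: "0 < c" "b2 / \<mu> \<le> c" "1 / \<delta>0\<^sup>2 \<le> c"
    using b2_pos \<mu> by (auto simp: c_def less_max_iff_disj)
  have c\<mu>: "b2 \<le> \<mu> * c" using c(2) \<mu> by (simp add: field_simps)
  define \<delta> where "\<delta> = 1 / sqrt c"
  have \<delta>: "0 < \<delta>" using c by (simp add: \<delta>_def)
  have \<delta>\<delta>0: "\<delta> \<le> \<delta>0"
  proof -
    have "sqrt (1 / \<delta>0\<^sup>2) \<le> sqrt c" using c(3) by (rule real_sqrt_le_mono)
    then have "1 / \<delta>0 \<le> sqrt c" using \<delta>0(1) by (simp add: real_sqrt_divide)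
    then show ?thesis using \<delta>0(1) c(1) by (simp add: \<delta>_def field_simps)
  qed
  have \<delta>2: "b2 * \<delta>\<^sup>2 \<le> \<mu>"
    using c c\<mu> by (simp add: \<delta>_def power_divide field_simps)
  have e0: "0 \<preceq> ?e" by (rule sine_mode_1_nonneg)
  have scale0: "0 \<preceq> k *\<^sub>R ?e" if "0 \<le> k" for k using h10_le_scale[OF e0 that] by simp
  have nn: "0 \<preceq> \<phi>" using h10_le_trans[OF scale0 \<delta>0(2)] \<delta>0(1) by simp
  obtain M where M: "cap M" "below \<phi> M" using below_cap[OF nn] by blast
  have below_le: "below u M" if "0 \<preceq> u" "u \<preceq> \<phi>" for u
    using that M(2) unfolding below_def h10_le_def by (meson order_trans)
  have \<delta>\<phi>: "k *\<^sub>R ?e \<preceq> \<phi>" if "k \<le> \<delta>" for k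
    using h10_le_trans[OF h10_le_scale[OF e0] \<delta>0(2)] that \<delta>\<delta>0 by auto
  obtain \<xi> where \<xi>: "\<And>s. sol lam \<beta> s \<xi>" "\<And>t. ((\<lambda>s. E t s \<phi>) \<longlongrightarrow> \<xi> t) at_bot" "\<And>t. below (\<xi> t) M"
    using pullback_limit[OF M(1), of "\<lambda>_. \<phi>"] M(2) stationary_super[OF \<phi> nn] by metis
  \<comment> \<open>The explicit Bernoulli solution: it behaves like \<open>exp (\<mu> t)\<close> at
    \<open>-\<infinity>\<close> and saturates at \<open>\<delta>\<close>.\<close>
  define a where "a t = 1 / sqrt (exp (- 2 * \<mu> * t) + c)" for t
  define a' where "a' t = \<mu> * a t - \<mu> * c * a t ^ 3" for t
  have pos: "0 < exp (- 2 * \<mu> * t) + c" for t using c(1) by (simp add: add_pos_pos)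
  have a0: "0 < a t" for t using pos[of t] by (simp add: a_def)
  have a\<delta>: "a t \<le> \<delta>" for t
    unfolding a_def \<delta>_def using c(1) pos[of t] by (intro divide_left_mono) auto
  have aexp: "a t \<le> exp (\<mu> * t)" for t
  proof -
    have "exp (- \<mu> * t) = sqrt (exp (- 2 * \<mu> * t))"
      by (rule real_sqrt_unique[symmetric]) (auto simp: exp_add[symmetric] power2_eq_square)
    also have "\<dots> \<le> sqrt (exp (- 2 * \<mu> * t) + c)" using c(1) by simp
    finally have "1 / sqrt (exp (- 2 * \<mu> * t) + c) \<le> 1 / exp (- \<mu> * t)"
      using pos[of t] by (intro divide_left_mono) auto
    then show ?thesis by (simp add: a_def exp_minus inverse_eq_divide)
  qed
  have da: "(a has_real_derivative a' t) (at t within S)" for t S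
  proof -
    let ?R = "sqrt (exp (- 2 * \<mu> * t) + c)"
    have R: "0 < ?R" "?R * ?R = exp (- 2 * \<mu> * t) + c" using pos[of t] by auto
    have "(a has_real_derivative (- (exp (- 2 * \<mu> * t) * (- 2 * \<mu>) * (inverse ?R / 2)) / (?R * ?R))) (at t within S)"
      unfolding a_def[abs_def] using pos[of t] by (auto intro!: derivative_eq_intros)
    also have "- (exp (- 2 * \<mu> * t) * (- 2 * \<mu>) * (inverse ?R / 2)) / (?R * ?R) = \<mu> * (?R * ?R - c) / (?R * ?R * ?R)"
      unfolding R(2) using R(1) by (simp add: divide_simps)
    also have "\<dots> = a' t"
    proof -
      have "\<mu> * (R * R - c) / (R * R * R) = \<mu> * (1 / R) - \<mu> * c * (1 / R) ^ 3" if "0 < R" for R :: real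
        using that by (simp add: field_simps power3_eq_cube)
      from this[OF R(1)] show ?thesis unfolding a'_def a_def .
    qed
    finally show ?thesis .
  qed
  have ca': "continuous_on S a'" for S
    unfolding a'_def[abs_def] using da by (intro continuous_intros DERIV_continuous_on[where f = a]) auto
  have ale: "a' t \<le> (lam - 1) * a t - b2 * a t ^ 3" for t
    using mult_right_mono[OF c\<mu>, of "a t ^ 3"] a0[of t] by (simp add: a'_def \<mu>_def)
  have ab: "below (a t *\<^sub>R ?e) M" for t
    using a0[of t] a\<delta>[of t] by (intro below_le scale0 \<delta>\<phi>) auto
  have a_sub: "a t *\<^sub>R ?e \<preceq> E t s (a s *\<^sub>R ?e)" if "s \<le> t" for s t
    using barrier_sub[OF da ca' _ ale E_sol _ that, of "a s *\<^sub>R ?e"] a0 scale0[of "a s"]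
    by (simp add: E_self less_imp_le)
  obtain \<zeta> where \<zeta>: "\<And>s. sol lam \<beta> s \<zeta>" "\<And>t. ((\<lambda>s. E t s (a s *\<^sub>R ?e)) \<longlongrightarrow> \<zeta> t) at_bot" "\<And>t. below (\<zeta> t) M"
    using pullback_limit[OF M(1), of "\<lambda>s. a s *\<^sub>R ?e"] ab a_sub by metis
  have ev: "\<forall>\<^sub>F s in at_bot. s \<le> t" for t :: real by (rule eventually_le_at_bot)
  have low: "a t *\<^sub>R ?e \<preceq> \<zeta> t" for t
    by (rule tendsto_h10_le[OF tendsto_const \<zeta>(2) eventually_mono[OF ev[of t] a_sub]]) auto
  \<comment> \<open>The exponential lies above \<open>a\<close>, so it dominates the data at every
    starting time, and the resulting bound is independent of \<open>s\<close>.\<close>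
  have up: "\<zeta> t \<preceq> exp (\<mu> * t) *\<^sub>R ?e" for t
  proof (rule tendsto_h10_le[OF \<zeta>(2) tendsto_const])
    have "E t s (a s *\<^sub>R ?e) \<preceq> exp (\<mu> * t) *\<^sub>R ?e" if st: "s \<le> t" for s
    proof (rule barrier_super[OF _ _ _ _ E_sol _ st])
      show z: "0 \<preceq> a s *\<^sub>R ?e" using a0[of s] by (intro scale0) simp
      show "((\<lambda>t. exp (\<mu> * t)) has_real_derivative \<mu> * exp (\<mu> * r)) (at r within {s..})" for r
        by (auto intro!: derivative_eq_intros)
      show "E s s (a s *\<^sub>R ?e) \<preceq> exp (\<mu> * s) *\<^sub>R ?e"
        unfolding E_self[OF z] by (rule h10_le_scale[OF e0 aexp])
    qed (auto intro!: continuous_intros simp: \<mu>_def)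
    then show "\<forall>\<^sub>F s in at_bot. E t s (a s *\<^sub>R ?e) \<preceq> exp (\<mu> * t) *\<^sub>R ?e"
      by (auto intro: eventually_mono[OF ev[of t]])
  qed auto
  have \<zeta>\<xi>: "\<zeta> t \<preceq> \<xi> t" for t
  proof (rule tendsto_h10_le[OF \<zeta>(2) \<xi>(2)])
    have "E t s (a s *\<^sub>R ?e) \<preceq> E t s \<phi>" if "s \<le> t" for s
      using a0[of s] a\<delta>[of s] that by (intro E_mono scale0 \<delta>\<phi>) auto
    then show "\<forall>\<^sub>F s in at_bot. E t s (a s *\<^sub>R ?e) \<preceq> E t s \<phi>"
      by (auto intro: eventually_mono[OF ev[of t]])
  qed auto
  \<comment> \<open>The constant amplitude \<open>\<delta>\<close> satisfies the logistic inequality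
    too; this lower bound, uniform in time, is what keeps the contraction rate away from 0.\<close>
  have \<xi>low: "\<delta> *\<^sub>R ?e \<preceq> \<xi> t" for t
  proof (rule tendsto_h10_le[OF tendsto_const \<xi>(2)])
    have "\<delta> *\<^sub>R ?e \<preceq> E t s \<phi>" if st: "s \<le> t" for s
    proof (rule barrier_sub[of s "\<lambda>_. \<delta>" "\<lambda>_. 0", OF _ _ _ _ E_sol[OF nn] _ st])
      show "\<delta> *\<^sub>R ?e \<preceq> E s s \<phi>" using \<delta>\<phi>[of \<delta>] by (simp add: E_self nn)
      show "0 \<le> (lam - 1) * \<delta> - b2 * \<delta> ^ 3"
        using mult_right_mono[OF \<delta>2, of \<delta>] \<delta> by (simp add: \<mu>_def power2_eq_square power3_eq_cube mult.assoc)
    qed (use \<delta> in auto)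
    then show "\<forall>\<^sub>F s in at_bot. \<delta> *\<^sub>R ?e \<preceq> E t s \<phi>"
      by (auto intro: eventually_mono[OF ev[of t]])
  qed auto
  have \<xi>up: "\<xi> t \<preceq> C *\<^sub>R ?e" for t
  proof (rule tendsto_h10_le[OF \<xi>(2) tendsto_const])
    have "E t s \<phi> \<preceq> C *\<^sub>R ?e" if st: "s \<le> t" for s
      by (rule h10_le_trans[OF stationary_super[OF \<phi> nn st] C(2)])
    then show "\<forall>\<^sub>F s in at_bot. E t s \<phi> \<preceq> C *\<^sub>R ?e"
      by (auto intro: eventually_mono[OF ev[of t]])
  qed auto
  \<comment> \<open>Both functions are compared with the sine at time 0: \<open>\<xi> 0\<close> lies
    below \<open>C sin x\<close> and \<open>\<zeta> 0\<close> above
    \<open>a 0 sin x\<close>.\<close>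
  define \<theta>0 where "\<theta>0 = min 1 (a 0 / C)"
  have \<theta>0: "0 < \<theta>0" "\<theta>0 \<le> 1" "\<theta>0 * C \<le> a 0"
    using a0[of 0] C(1) by (auto simp: \<theta>0_def min_def field_simps)
  have init: "\<theta>0 *\<^sub>R \<xi> 0 \<preceq> \<zeta> 0"
  proof (rule h10_le_trans[OF _ low])
    have 1: "\<theta>0 *\<^sub>R \<xi> 0 \<preceq> (\<theta>0 * C) *\<^sub>R ?e"
      using \<xi>up[of 0] \<theta>0(1) by (auto simp: h10_le_def mult.assoc)
    have 2: "(\<theta>0 * C) *\<^sub>R ?e \<preceq> a 0 *\<^sub>R ?e" by (rule h10_le_scale[OF e0 \<theta>0(3)])
    show "\<theta>0 *\<^sub>R \<xi> 0 \<preceq> a 0 *\<^sub>R ?e" by (rule h10_le_trans[OF 1 2])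
  qed
  have fwd: "((\<lambda>t. \<zeta> t - \<xi> t) \<longlongrightarrow> 0) at_top"
    by (rule part_converge[OF \<xi>(1)[of 0] \<zeta>(1)[of 0] \<xi>(3) \<zeta>(3) \<delta> \<xi>low C(1) \<xi>up \<theta>0(1,2) init \<zeta>\<xi>])
  have bwd: "(\<zeta> \<longlongrightarrow> 0) at_bot"
  proof (rule Lim_null_comparison)
    \<comment> \<open>Taking the zero solution as the second one in \<open>smoothing\<close> turns
      uniform decay of \<open>\<zeta>\<close> into decay in the norm.\<close>
    have zero: "sol lam \<beta> s (\<lambda>_. 0)" for s
      unfolding sol_def by (rule lin_sol_cong[of s "\<lambda>_. 0" "\<lambda>_. 0"]) (auto simp: lin_sol_def reac_def cube_def intro!: h10_eqI)
    have "norm (\<zeta> t) \<le> smoothing_const M * exp (\<mu> * t)" for t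
    proof -
      have "norm (\<zeta> (t - 1 + 1) - 0) \<le> smoothing_const M * exp (\<mu> * t)"
      proof (rule smoothing[OF \<zeta>(1) zero])
        fix r x assume r: "r \<in> {t - 1..t - 1 + 1}"
        show "\<bar>h10_fun (\<zeta> r) x\<bar> \<le> M" by (rule below_abs[OF \<zeta>(3)])
        show "\<bar>h10_fun 0 x\<bar> \<le> M" using M(1) by (simp add: cap_def)
        have "h10_fun (\<zeta> r) x \<le> exp (\<mu> * r) * h10_fun ?e x" using h10_leD[OF up[of r], of x] by simp
        also have "\<dots> \<le> exp (\<mu> * t) * 1"
          using r \<mu> h10_leD[OF e0, of x]
          by (intro mult_mono) (auto simp: sine_mode.rep_eq)
        finally show "\<bar>h10_fun (\<zeta> r - 0) x\<bar> \<le> exp (\<mu> * t)"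
          using \<zeta>(3)[of r] by (simp add: below_def h10_le_def)
      qed
      then show ?thesis by simp
    qed
    then show "\<forall>\<^sub>F t in at_bot. norm (\<zeta> t) \<le> smoothing_const M * exp (\<mu> * t)" by simp
    have "filterlim (\<lambda>t. \<mu> * t) at_bot at_bot"
      using \<mu> by (intro filterlim_tendsto_pos_mult_at_bot[OF tendsto_const]) (auto simp: filterlim_ident)
    then have "((\<lambda>t. exp (\<mu> * t)) \<longlongrightarrow> 0) at_bot"
      by (rule filterlim_compose[OF exp_at_bot])
    from tendsto_mult_right_zero[OF this] show "((\<lambda>t. smoothing_const M * exp (\<mu> * t)) \<longlongrightarrow> 0) at_bot" .
  qed
  show ?thesis by (rule that[OF \<xi>(1) \<zeta>(1) \<xi>(2) bwd fwd])
qed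

end

section \<open>Stationary solutions\<close>

text \<open>The weak form of \<open>- \<phi>'' = lam \<phi> - b \<phi>^3\<close> in sine
  coefficients; in this shape a stationary solution is the same as a constant
  \<open>sol\<close>.\<close>

definition steady :: "real \<Rightarrow> real \<Rightarrow> h10 \<Rightarrow> bool" where
  "steady lam b \<phi> \<longleftrightarrow> (\<forall>n. (real n)\<^sup>2 * sc n \<phi> = sc n (reac lam b \<phi>))"

text \<open>Two integrations by parts on the open interval. The derivative \<open>g\<close> is not
  assumed to extend to the endpoints, but it is bounded because its own derivative is, and it is
  multiplied by a sine that vanishes there.\<close>

lemma sc_second_deriv:
  assumes d1: "\<And>x. x \<in> {0<..<pi} \<Longrightarrow> (h10_fun u has_real_derivative g x) (at x)"
    and d2: "\<And>x. x \<in> {0<..<pi} \<Longrightarrow> (g has_real_derivative - h10_fun F x) (at x)"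
  shows "(real n)\<^sup>2 * sc n u = sc n F"
proof -
  define B where "B = \<bar>g (pi / 2)\<bar> + 3 * norm F * pi"
  define k where "k x = (if x \<in> {0<..<pi} then g x else 0)" for x
  have B: "\<bar>k x\<bar> \<le> B" for x
  proof (cases "x \<in> {0<..<pi}")
    case True
    have "norm (g x - g (pi / 2)) \<le> 3 * norm F * norm (x - pi / 2)"
    proof (rule field_differentiable_bound[of "{0<..<pi}" g "\<lambda>x. - h10_fun F x"])
      show "(g has_real_derivative - h10_fun F y) (at y within {0<..<pi})" if "y \<in> {0<..<pi}" for y
        by (rule DERIV_subset[OF d2[OF that]]) simp
    qed (use True h10_fun_bound[of F] in auto)
    also have "\<dots> \<le> 3 * norm F * pi"
      using True by (intro mult_left_mono) (auto simp: abs_le_iff)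
    finally show ?thesis using True by (simp add: B_def k_def)
  next
    case False
    then show ?thesis by (auto simp: B_def k_def)
  qed
  let ?W = "\<lambda>x. k x * sin (real n * x) - real n * h10_fun u x * cos (real n * x)"
  have ck: "continuous_on {0..pi} (\<lambda>x. k x * sin (real n * x))"
    unfolding continuous_on_def
  proof
    fix c :: real assume c: "c \<in> {0..pi}"
    show "((\<lambda>x. k x * sin (real n * x)) \<longlongrightarrow> k c * sin (real n * c)) (at c within {0..pi})"
    proof (cases "c \<in> {0<..<pi}")
      case True
      have "(k has_real_derivative - h10_fun F c) (at c)"
        using True by (intro has_field_derivative_transform_within_open[OF d2[OF True], of "{0<..<pi}"]) (auto simp: k_def)
      then have "isCont k c" by (rule DERIV_isCont)
      then have "isCont (\<lambda>x. k x * sin (real n * x)) c" by (intro continuous_intros)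
      then show ?thesis unfolding isCont_def by (rule tendsto_within_subset) simp
    next
      case False
      then have z: "sin (real n * c) = 0" using c by (cases "c = 0") auto
      have "((\<lambda>x. k x * sin (real n * x)) \<longlongrightarrow> 0) (at c within {0..pi})"
      proof (rule Lim_null_comparison)
        show "\<forall>\<^sub>F x in at c within {0..pi}. norm (k x * sin (real n * x)) \<le> B * \<bar>sin (real n * x)\<bar>"
          using B by (simp add: abs_mult mult_right_mono)
        have "((\<lambda>x. B * \<bar>sin (real n * x)\<bar>) \<longlongrightarrow> B * \<bar>sin (real n * c)\<bar>) (at c within {0..pi})"
          by (intro tendsto_intros)
        then show "((\<lambda>x. B * \<bar>sin (real n * x)\<bar>) \<longlongrightarrow> 0) (at c within {0..pi})" by (simp add: z)
      qed
      then show ?thesis by (simp add: z)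
    qed
  qed
  have "((\<lambda>x. ((real n)\<^sup>2 * h10_fun u x - h10_fun F x) * sin (real n * x)) has_integral (?W pi - ?W 0)) {0..pi}"
  proof (rule fundamental_theorem_of_calculus_interior)
    show "continuous_on {0..pi} ?W" by (intro continuous_intros ck continuous_on_h10_fun)
    fix x :: real assume x: "x \<in> {0<..<pi}"
    have k: "(k has_real_derivative - h10_fun F x) (at x)"
      using x by (intro has_field_derivative_transform_within_open[OF d2[OF x], of "{0<..<pi}"]) (auto simp: k_def)
    have u: "(h10_fun u has_real_derivative k x) (at x)" using d1[OF x] x by (simp add: k_def)
    show "(?W has_vector_derivative ((real n)\<^sup>2 * h10_fun u x - h10_fun F x) * sin (real n * x)) (at x)"
      unfolding has_real_derivative_iff_has_vector_derivative[symmetric]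
      by (rule derivative_eq_intros k u refl)+ (simp add: algebra_simps power2_eq_square)
  qed simp
  then have 0: "((\<lambda>x. ((real n)\<^sup>2 * h10_fun u x - h10_fun F x) * sin (real n * x)) has_integral 0) {0..pi}"
    by (simp add: k_def)
  have "integral {0..pi} (\<lambda>x. h10_fun ((real n)\<^sup>2 *\<^sub>R u - F) x * sin (real n * x)) = 0"
    using integral_unique[OF 0] by simp
  then have "sc n ((real n)\<^sup>2 *\<^sub>R u - F) = 0"
    by (simp only: sc_eq_integral mult_zero_right)
  then show ?thesis by simp
qed

text \<open>Integrating \<open>F\<close> twice and adjusting the linear term gives an element
  \<open>v\<close> of \<open>h10\<close>; its sine coefficients agree with those of
  \<open>u\<close>, so \<open>v = u\<close>. This recovers classical regularity up to the
  endpoints.\<close>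

lemma second_deriv_of_sc:
  assumes "\<And>n. (real n)\<^sup>2 * sc n u = sc n F"
  obtains g where "\<And>x. x \<in> {0..pi} \<Longrightarrow> (h10_fun u has_real_derivative g x) (at x within {0..pi})"
    "\<And>x. x \<in> {0..pi} \<Longrightarrow> (g has_real_derivative - h10_fun F x) (at x within {0..pi})"
proof -
  define I where "I x = integral {0..x} (h10_fun F)" for x
  define J where "J x = integral {0..x} I" for x
  \<comment> \<open>\<open>J pi / pi\<close> is the initial slope that makes the double primitive
    vanish at \<open>pi\<close>.\<close>
  define g where "g x = J pi / pi - I x" for x
  have dI: "(I has_real_derivative h10_fun F x) (at x within {0..pi})" if "x \<in> {0..pi}" for x
    unfolding I_def[abs_def] by (rule integral_has_real_derivative[OF continuous_on_h10_fun that])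
  have cI: "continuous_on {0..pi} I" by (rule DERIV_continuous_on[OF dI])
  have dJ: "(J has_real_derivative I x) (at x within {0..pi})" if "x \<in> {0..pi}" for x
    unfolding J_def[abs_def] by (rule integral_has_real_derivative[OF cI that])
  have dg: "(g has_real_derivative - h10_fun F x) (at x within {0..pi})" if "x \<in> {0..pi}" for x
    unfolding g_def[abs_def] using dI[OF that] by (auto intro!: derivative_eq_intros)
  have d: "((\<lambda>x. J pi / pi * x - J x) has_real_derivative g x) (at x within {0..pi})" if "x \<in> {0..pi}" for x
    unfolding g_def using dJ[OF that] by (auto intro!: derivative_eq_intros)
  obtain v where v: "\<And>x. x \<in> {0..pi} \<Longrightarrow> h10_fun v x = J pi / pi * x - J x"
    using C1_h10[OF d DERIV_continuous_on[OF dg]] by (auto simp: J_def)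
  have dv: "(h10_fun v has_real_derivative g x) (at x within {0..pi})" if "x \<in> {0..pi}" for x
    by (rule has_field_derivative_transform_within[OF d[OF that] zero_less_one]) (use that v in auto)
  have "(real n)\<^sup>2 * sc n v = sc n F" for n
  proof (rule sc_second_deriv[of v g])
    fix x :: real assume x: "x \<in> {0<..<pi}"
    show "(h10_fun v has_real_derivative g x) (at x)" "(g has_real_derivative - h10_fun F x) (at x)"
      using dv[of x] dg[of x] x by (auto simp: at_within_Icc_at)
  qed
  then have "(real n)\<^sup>2 * sc n v = (real n)\<^sup>2 * sc n u" for n using assms by simp
  then have "sc n v = sc n u" for n by (cases "n = 0") (simp, metis mult_left_cancel of_nat_eq_0_iff power_not_zero)
  then have "v = u" by (simp add: h10_eq_iff_sc)
  then show ?thesis using that dv dg by blast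
qed

lemma steady_deriv:
  assumes "steady lam b \<phi>"
  obtains g where "\<And>x. x \<in> {0..pi} \<Longrightarrow> (h10_fun \<phi> has_real_derivative g x) (at x within {0..pi})"
    "\<And>x. x \<in> {0..pi} \<Longrightarrow> (g has_real_derivative - (lam * h10_fun \<phi> x - b * h10_fun \<phi> x ^ 3)) (at x within {0..pi})"
  using second_deriv_of_sc[of \<phi> "reac lam b \<phi>"] assms unfolding steady_def h10_fun_reac by blast

lemma steady_deriv_interior:
  assumes "steady lam b \<phi>"
  obtains g where "\<And>x. x \<in> {0<..<pi} \<Longrightarrow> (h10_fun \<phi> has_real_derivative g x) (at x)"
    "\<And>x. x \<in> {0<..<pi} \<Longrightarrow> (g has_real_derivative - (lam * h10_fun \<phi> x - b * h10_fun \<phi> x ^ 3)) (at x)"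
proof -
  obtain g where g: "\<And>x. x \<in> {0..pi} \<Longrightarrow> (h10_fun \<phi> has_real_derivative g x) (at x within {0..pi})"
    "\<And>x. x \<in> {0..pi} \<Longrightarrow> (g has_real_derivative - (lam * h10_fun \<phi> x - b * h10_fun \<phi> x ^ 3)) (at x within {0..pi})"
    using steady_deriv[OF assms] by blast
  show ?thesis
  proof (rule that)
    fix x :: real assume x: "x \<in> {0<..<pi}"
    show "(h10_fun \<phi> has_real_derivative g x) (at x)"
      "(g has_real_derivative - (lam * h10_fun \<phi> x - b * h10_fun \<phi> x ^ 3)) (at x)"
      using g[of x] x by (auto simp: at_within_Icc_at)
  qed
qed

lemma stationary_solution_iff: "stationary_solution lam b \<phi> \<longleftrightarrow> steady lam b \<phi>"
proof
  assume "stationary_solution lam b \<phi>"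
  then obtain p q where pq: "\<And>x. x \<in> {0<..<pi} \<Longrightarrow> (h10_fun \<phi> has_real_derivative p x) (at x)"
    "\<And>x. x \<in> {0<..<pi} \<Longrightarrow> (p has_real_derivative q x) (at x)"
    "\<And>x. x \<in> {0<..<pi} \<Longrightarrow> q x + lam * h10_fun \<phi> x - b * h10_fun \<phi> x ^ 3 = 0"
    unfolding stationary_solution_def by blast
  have "(p has_real_derivative - h10_fun (reac lam b \<phi>) x) (at x)" if "x \<in> {0<..<pi}" for x
  proof -
    have "q x = - h10_fun (reac lam b \<phi>) x" using pq(3)[OF that] by (simp add: h10_fun_reac)
    then show ?thesis using pq(2)[OF that] by simp
  qed
  with pq(1) show "steady lam b \<phi>" unfolding steady_def by (blast intro: sc_second_deriv)
next
  assume "steady lam b \<phi>"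
  then show "stationary_solution lam b \<phi>"
    unfolding stationary_solution_def
    by (elim steady_deriv_interior) (intro exI ballI conjI, assumption+, simp)
qed

text \<open>Uniqueness for the second-order ODE: the energy \<open>w^2 + k^2\<close> of the
  difference, weighted with \<open>exp (- L x)\<close>, is nonincreasing and vanishes at a point
  where the solutions agree to first order.\<close>

lemma steady_continuation:
  assumes u: "steady lam b u" and v: "steady lam b v" and c: "0 < c" "c \<le> pi"
    and eq: "\<And>x. x \<in> {0<..<c} \<Longrightarrow> h10_fun u x = h10_fun v x"
  shows "u = v"
proof (rule h10_eqI)
  obtain g where g: "\<And>x. x \<in> {0<..<pi} \<Longrightarrow> (h10_fun u has_real_derivative g x) (at x)"
    "\<And>x. x \<in> {0<..<pi} \<Longrightarrow> (g has_real_derivative - (lam * h10_fun u x - b * h10_fun u x ^ 3)) (at x)"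
    using steady_deriv_interior[OF u] by blast
  obtain h where h: "\<And>x. x \<in> {0<..<pi} \<Longrightarrow> (h10_fun v has_real_derivative h x) (at x)"
    "\<And>x. x \<in> {0<..<pi} \<Longrightarrow> (h has_real_derivative - (lam * h10_fun v x - b * h10_fun v x ^ 3)) (at x)"
    using steady_deriv_interior[OF v] by blast
  define w where "w x = h10_fun u x - h10_fun v x" for x
  define k where "k x = g x - h x" for x
  define q where "q x = - h10_fun (reac lam b u - reac lam b v) x" for x
  have dw: "(w has_real_derivative k x) (at x)" and dk: "(k has_real_derivative q x) (at x)" if "x \<in> {0<..<pi}" for x
    unfolding w_def[abs_def] k_def[abs_def] q_def
    using DERIV_diff[OF g(1)[OF that] h(1)[OF that]] DERIV_diff[OF g(2)[OF that] h(2)[OF that]]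
    by (simp_all add: h10_fun_reac algebra_simps)
  define B where "B = max (3 * norm u) (3 * norm v)"
  define L where "L = 1 + (\<bar>lam\<bar> + 3 * \<bar>b\<bar> * B\<^sup>2)"
  have q: "\<bar>q x\<bar> \<le> (L - 1) * \<bar>w x\<bar>" for x
    using reac_lipschitz[of u x B v b "\<bar>b\<bar>" lam] h10_fun_bound[of u x] h10_fun_bound[of v x]
    by (auto simp: q_def L_def B_def w_def abs_minus_commute)
  let ?f = "\<lambda>x. exp (- L * x) * ((w x)\<^sup>2 + (k x)\<^sup>2)"
  \<comment> \<open>An interior point of the interval of agreement, so that the derivatives coincide
    there as well.\<close>
  define a where "a = c / 2"
  have a: "0 < a" "a < c" "a < pi" using c by (auto simp: a_def)
  have wa: "w x = 0" if "x \<in> {0<..<c}" for x using eq[OF that] by (simp add: w_def)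
  have "((\<lambda>_. 0) has_real_derivative k a) (at a)"
    by (rule has_field_derivative_transform_within_open[OF dw, of _ "{0<..<c}"]) (use a wa in auto)
  then have ka: "k a = 0" using DERIV_unique DERIV_const by blast
  fix x :: real assume x: "x \<in> {0<..<pi}"
  show "h10_fun u x = h10_fun v x"
  proof (cases "x < c")
    case False
    have "?f x \<le> ?f a"
    proof (rule DERIV_nonpos_imp_nonincreasing[where f = "?f" and a = a and b = x])
      fix y assume y: "a \<le> y" "y \<le> x"
      then have yi: "y \<in> {0<..<pi}" using a x by auto
      let ?D = "exp (- L * y) * (2 * w y * k y + 2 * k y * q y - L * ((w y)\<^sup>2 + (k y)\<^sup>2))"
      have "(?f has_real_derivative ?D) (at y)"
        by (rule derivative_eq_intros dw dk yi refl)+ (simp add: algebra_simps)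
      moreover have "?D \<le> 0"
      proof -
        have L1: "1 \<le> L" by (simp add: L_def)
        have 2: "2 * (\<bar>w y\<bar> * \<bar>k y\<bar>) \<le> (w y)\<^sup>2 + (k y)\<^sup>2"
          using sum_squares_bound[of "\<bar>w y\<bar>" "\<bar>k y\<bar>"] by (simp add: mult.assoc)
        have "w y * k y \<le> \<bar>w y\<bar> * \<bar>k y\<bar>" by (simp add: abs_mult[symmetric])
        moreover have "k y * q y \<le> (L - 1) * (\<bar>w y\<bar> * \<bar>k y\<bar>)"
        proof -
          have "k y * q y \<le> \<bar>k y\<bar> * \<bar>q y\<bar>" by (simp add: abs_mult[symmetric])
          also have "\<dots> \<le> \<bar>k y\<bar> * ((L - 1) * \<bar>w y\<bar>)" by (intro mult_left_mono q) auto
          finally show ?thesis by (simp add: mult_ac)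
        qed
        ultimately have "2 * w y * k y + 2 * k y * q y \<le> L * (2 * (\<bar>w y\<bar> * \<bar>k y\<bar>))"
          by (simp add: algebra_simps)
        also have "\<dots> \<le> L * ((w y)\<^sup>2 + (k y)\<^sup>2)" using L1 2 by (intro mult_left_mono) auto
        finally show ?thesis by (simp add: mult_nonneg_nonpos)
      qed
      ultimately show "\<exists>D. (?f has_real_derivative D) (at y) \<and> D \<le> 0" by blast
    qed (use False a in auto)
    also have "?f a = 0" using wa[of a] a ka by simp
    finally have "(w x)\<^sup>2 + (k x)\<^sup>2 \<le> 0" by (simp add: mult_le_0_iff)
    then have "w x = 0" using sum_power2_le_zero_iff by blast
    then show ?thesis by (simp add: w_def)
  qed (use eq x in auto)
qed

section \<open>Stationary solutions between multiples of the sine\<close>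

text \<open>The mean slopes to the left and to the right of \<open>x\<close> are values of the
  nonincreasing derivative \<open>g\<close>.\<close>

lemma concave_chord:
  fixes f g h :: "real \<Rightarrow> real"
  assumes f: "continuous_on {0..a} f" "f 0 = 0"
    and d1: "\<And>x. x \<in> {0<..<a} \<Longrightarrow> (f has_real_derivative g x) (at x)"
    and d2: "\<And>x. x \<in> {0<..<a} \<Longrightarrow> (g has_real_derivative h x) (at x)"
    and h: "\<And>x. x \<in> {0<..<a} \<Longrightarrow> h x \<le> 0" and x: "x \<in> {0..a}"
  shows "x * f a \<le> a * f x"
proof (cases "x = 0 \<or> x = a")
  case False
  then have x: "0 < x" "x < a" using x by auto
  have mvt: "\<exists>y. p < y \<and> y < q \<and> f q - f p = (q - p) * g y" if pq: "0 \<le> p" "p < q" "q \<le> a" for p q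
  proof -
    have "f differentiable (at y)" if "p < y" "y < q" for y
      using d1[of y] that pq by (auto simp: real_differentiable_def)
    with MVT[OF pq(2) continuous_on_subset[OF f(1)]] pq
    obtain l y where "p < y" "y < q" "(f has_real_derivative l) (at y)" "f q - f p = (q - p) * l"
      by auto
    moreover from this have "l = g y" using pq by (intro DERIV_unique[OF _ d1]) auto
    ultimately show ?thesis by blast
  qed
  obtain y where y: "0 < y" "y < x" "f x - f 0 = (x - 0) * g y" using mvt[of 0 x] x by auto
  obtain z where z: "x < z" "z < a" "f a - f x = (a - x) * g z" using mvt[of x a] x by auto
  have "g z \<le> g y"
    by (rule DERIV_nonpos_imp_nonincreasing) (use y z x d2 h in force)+
  then have "(x * (a - x)) * g z \<le> (x * (a - x)) * g y" using x by (intro mult_left_mono) auto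
  then have "x * (f a - f x) \<le> (a - x) * (f x - f 0)" unfolding y(3) z(3) by (simp add: mult_ac)
  then show ?thesis using f(2) by (simp add: algebra_simps)
qed (use f in auto)

text \<open>The chord from an endpoint to the value at \<open>pi / 2\<close>, on each half of the
  interval; the right half is reflected.\<close>

lemma concave_lower_bound:
  fixes f g h :: "real \<Rightarrow> real"
  assumes f: "continuous_on {0..pi} f" "f 0 = 0" "f pi = 0"
    and d1: "\<And>x. x \<in> {0<..<pi} \<Longrightarrow> (f has_real_derivative g x) (at x)"
    and d2: "\<And>x. x \<in> {0<..<pi} \<Longrightarrow> (g has_real_derivative h x) (at x)"
    and h: "\<And>x. x \<in> {0<..<pi} \<Longrightarrow> h x \<le> 0" and x: "x \<in> {0..pi}"
  shows "2 / pi * f (pi / 2) * min x (pi - x) \<le> f x"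
proof (cases "x \<le> pi / 2")
  case True
  have "x * f (pi / 2) \<le> pi / 2 * f x"
    by (rule concave_chord[of _ f g h]) (use f d1 d2 h x True in \<open>auto intro: continuous_on_subset\<close>)
  then show ?thesis using True by (simp add: min_def field_simps)
next
  case False
  have r: "((\<lambda>y. p (pi - y)) has_real_derivative - q (pi - y)) (at y)"
    if "\<And>x. x \<in> {0<..<pi} \<Longrightarrow> (p has_real_derivative q x) (at x)" "y \<in> {0<..<pi / 2}" for p q :: "real \<Rightarrow> real" and y
  proof -
    have "pi - y \<in> {0<..<pi}" using that(2) by auto
    from DERIV_chain'[OF DERIV_diff[OF DERIV_const DERIV_ident] that(1)[OF this]] show ?thesis by simp
  qed
  have c: "continuous_on {0..pi / 2} (\<lambda>y. f (pi - y))"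
    by (rule continuous_on_compose2[OF f(1)]) (auto intro!: continuous_intros)
  have "(pi - x) * f (pi - pi / 2) \<le> pi / 2 * f (pi - (pi - x))"
    by (rule concave_chord[of _ "\<lambda>y. f (pi - y)" "\<lambda>y. - g (pi - y)" "\<lambda>y. h (pi - y)"])
      (use f r[OF d1] DERIV_minus[OF r[OF d2]] c h x False in \<open>auto intro: continuous_on_subset\<close>)
  then show ?thesis using False by (simp add: min_def field_simps)
qed

lemma sin_lower_bound: "x \<in> {0..pi} \<Longrightarrow> 2 / pi * min x (pi - x) \<le> sin x"
  using concave_lower_bound[of sin cos "\<lambda>x. - sin x" x]
  by (simp add: continuous_on_sin DERIV_sin DERIV_cos sin_ge_zero)

lemma sin_le_min: "x \<in> {0..pi} \<Longrightarrow> sin x \<le> min x (pi - x)"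
  using sin_x_le_x[of x] sin_x_le_x[of "pi - x"] by auto

text \<open>The derivative is bounded up to the endpoints, so \<open>\<phi>\<close> is at most
  \<open>B\<close> times the tent \<open>min x (pi - x)\<close>, which is at most
  \<open>pi / 2\<close> times the sine.\<close>

lemma steady_le_sine:
  assumes "steady lam b \<phi>"
  obtains C where "0 < C" "\<phi> \<preceq> C *\<^sub>R sine_mode 1"
proof -
  obtain g where g: "\<And>x. x \<in> {0..pi} \<Longrightarrow> (h10_fun \<phi> has_real_derivative g x) (at x within {0..pi})"
    "\<And>x. x \<in> {0..pi} \<Longrightarrow> (g has_real_derivative - (lam * h10_fun \<phi> x - b * h10_fun \<phi> x ^ 3)) (at x within {0..pi})"
    using steady_deriv[OF assms] by blast
  have "bounded (g ` {0..pi})"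
    by (intro compact_imp_bounded compact_continuous_image DERIV_continuous_on[OF g(2)]) auto
  then obtain B where B: "0 < B" "\<And>x. x \<in> {0..pi} \<Longrightarrow> \<bar>g x\<bar> \<le> B"
    unfolding bounded_pos by auto
  have lip: "\<bar>h10_fun \<phi> x - h10_fun \<phi> y\<bar> \<le> B * \<bar>x - y\<bar>" if "x \<in> {0..pi}" "y \<in> {0..pi}" for x y
    using field_differentiable_bound[OF _ g(1) _ that, of B] B by simp
  show ?thesis
  proof (rule that)
    show "0 < B * (pi / 2)" using B by simp
    show "\<phi> \<preceq> (B * (pi / 2)) *\<^sub>R sine_mode 1"
    proof (rule h10_leI)
      fix x :: real assume x: "x \<in> {0<..<pi}"
      have "h10_fun \<phi> x \<le> B * min x (pi - x)"
        using lip[of x 0] lip[of x pi] x by (auto simp: min_def)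
      also have "\<dots> = B * (pi / 2) * (2 / pi * min x (pi - x))" by simp
      also have "\<dots> \<le> B * (pi / 2) * sin x"
        using sin_lower_bound[of x] x B by (intro mult_left_mono) auto
      finally show "h10_fun \<phi> x \<le> h10_fun ((B * (pi / 2)) *\<^sub>R sine_mode 1) x"
        using x by (simp add: h10_fun_sine_mode)
    qed
  qed
qed

text \<open>At an interior maximum the second derivative is nonpositive. The bound makes nonnegative
  stationary solutions concave.\<close>

lemma steady_max_principle:
  assumes st: "steady lam b \<phi>" and nn: "0 \<preceq> \<phi>" and lam: "0 \<le> lam" and b: "0 \<le> b"
  shows "b * (h10_fun \<phi> x)\<^sup>2 \<le> lam"
proof -
  obtain g where g: "\<And>x. x \<in> {0<..<pi} \<Longrightarrow> (h10_fun \<phi> has_real_derivative g x) (at x)"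
    "\<And>x. x \<in> {0<..<pi} \<Longrightarrow> (g has_real_derivative - (lam * h10_fun \<phi> x - b * h10_fun \<phi> x ^ 3)) (at x)"
    using steady_deriv_interior[OF st] by blast
  obtain m where m: "m \<in> {0..pi}" "\<And>x. x \<in> {0..pi} \<Longrightarrow> h10_fun \<phi> x \<le> h10_fun \<phi> m"
    using continuous_attains_sup[OF compact_Icc _ continuous_on_h10_fun[of \<phi>]] by auto
  have nnx: "0 \<le> h10_fun \<phi> x" for x using h10_leD[OF nn, of x] by simp
  have le: "h10_fun \<phi> x \<le> h10_fun \<phi> m"
    using m(2)[of x] nnx[of m] h10_fun_outside[of x \<phi>] by (cases "x \<in> {0..pi}") auto
  show ?thesis
  proof (cases "h10_fun \<phi> m = 0")
    case True
    then have "h10_fun \<phi> x = 0" using le nnx[of x] by simp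
    then show ?thesis using lam by simp
  next
    case False
    then have pos: "0 < h10_fun \<phi> m" using nnx[of m] by simp
    have "m \<noteq> 0" "m \<noteq> pi" using False by auto
    then have mi: "m \<in> {0<..<pi}" using m(1) by auto
    define d where "d = min m (pi - m)"
    have d: "y \<in> {0<..<pi}" if "\<bar>m - y\<bar> < d" for y
      using that by (auto simp: d_def)
    have "0 \<le> lam * h10_fun \<phi> m - b * h10_fun \<phi> m ^ 3"
    proof (rule DERIV_second_local_min[of m d "\<lambda>x. - h10_fun \<phi> x" "\<lambda>x. - g x"])
      show "((\<lambda>x. - g x) has_real_derivative lam * h10_fun \<phi> m - b * h10_fun \<phi> m ^ 3) (at m)"
        using DERIV_minus[OF g(2)[OF mi]] by simp
      show "0 < d" using mi by (simp add: d_def)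
      fix x assume "\<bar>m - x\<bar> < d"
      then have "x \<in> {0<..<pi}" by (rule d)
      then show "((\<lambda>x. - h10_fun \<phi> x) has_real_derivative - g x) (at x)" "- h10_fun \<phi> m \<le> - h10_fun \<phi> x"
        using g(1) m(2)[of x] by (auto intro: DERIV_minus)
    qed
    then have "h10_fun \<phi> m * (b * (h10_fun \<phi> m)\<^sup>2) \<le> h10_fun \<phi> m * lam"
      by (simp add: power2_eq_square power3_eq_cube mult_ac)
    then have "b * (h10_fun \<phi> m)\<^sup>2 \<le> lam" using pos by simp
    moreover have "b * (h10_fun \<phi> x)\<^sup>2 \<le> b * (h10_fun \<phi> m)\<^sup>2"
      using le nnx[of x] b by (intro mult_left_mono power_mono) auto
    ultimately show ?thesis by simp
  qed
qed

text \<open>Concavity puts \<open>\<phi>\<close> above the tent through its value at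
  \<open>pi / 2\<close>, and the tent lies above a multiple of the sine; this takes the place of a
  boundary lemma of Hopf type.\<close>

lemma steady_ge_sine:
  assumes st: "steady lam b \<phi>" and pos: "\<And>x. x \<in> {0<..<pi} \<Longrightarrow> 0 < h10_fun \<phi> x" and lam: "0 \<le> lam" and b: "0 \<le> b"
  obtains \<delta> where "0 < \<delta>" "\<delta> *\<^sub>R sine_mode 1 \<preceq> \<phi>"
proof -
  obtain g where g: "\<And>x. x \<in> {0<..<pi} \<Longrightarrow> (h10_fun \<phi> has_real_derivative g x) (at x)"
    "\<And>x. x \<in> {0<..<pi} \<Longrightarrow> (g has_real_derivative - (lam * h10_fun \<phi> x - b * h10_fun \<phi> x ^ 3)) (at x)"
    using steady_deriv_interior[OF st] by blast
  have nn: "0 \<preceq> \<phi>" by (rule h10_leI) (use pos in \<open>auto intro: less_imp_le\<close>)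
  have neg: "- (lam * h10_fun \<phi> x - b * h10_fun \<phi> x ^ 3) \<le> 0" if "x \<in> {0<..<pi}" for x
    using mult_right_mono[OF steady_max_principle[OF st nn lam b, of x], of "h10_fun \<phi> x"] pos[OF that]
    by (simp add: power2_eq_square power3_eq_cube mult_ac)
  let ?c = "2 / pi * h10_fun \<phi> (pi / 2)"
  have c: "0 < ?c" using pos[of "pi / 2"] by simp
  moreover have "?c *\<^sub>R sine_mode 1 \<preceq> \<phi>"
  proof (rule h10_leI)
    fix x :: real assume x: "x \<in> {0<..<pi}"
    have "?c * sin x \<le> ?c * min x (pi - x)"
      using sin_le_min[of x] c x by (intro mult_left_mono) auto
    also have "\<dots> \<le> h10_fun \<phi> x"
      using concave_lower_bound[OF continuous_on_h10_fun _ _ g neg] x by simp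
    finally show "h10_fun (?c *\<^sub>R sine_mode 1) x \<le> h10_fun \<phi> x" using x by (simp add: h10_fun_sine_mode)
  qed
  ultimately show ?thesis by (rule that)
qed

section \<open>Odd periodic extension and dilation\<close>

text \<open>The sine series of \<open>u\<close> evaluated at \<open>j x\<close>, that is the odd \<open>2\<pi>\<close>-periodic extension of \<open>u\<close> dilated by \<open>j\<close>.\<close>

definition stretch :: "nat \<Rightarrow> h10 \<Rightarrow> h10" where
  "stretch j u = (\<Sum>m. (if j dvd m then sc (m div j) u else 0) *\<^sub>R sine_mode m)"

lemma sums_multiples:
  fixes f :: "nat \<Rightarrow> 'a::real_normed_vector"
  assumes "0 < j" "\<And>m. \<not> j dvd m \<Longrightarrow> f m = 0"
  shows "(\<lambda>k. f (j * k)) sums c \<longleftrightarrow> f sums c"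
  by (rule sums_mono_reindex) (use assms in \<open>auto intro!: strict_monoI simp: image_iff dvd_def\<close>)

lemma stretch_coeff_sums:
  assumes "0 < j"
  shows "(\<lambda>m. pi / 2 * (real m * (if j dvd m then sc (m div j) u else 0))\<^sup>2) sums ((real j)\<^sup>2 * (norm u)\<^sup>2)"
proof -
  have "(\<lambda>k. (real j)\<^sup>2 * (pi / 2 * (real k * sc k u)\<^sup>2)) sums ((real j)\<^sup>2 * (norm u)\<^sup>2)"
    by (rule sums_mult[OF parseval])
  moreover have "(real j)\<^sup>2 * (pi / 2 * (real k * sc k u)\<^sup>2) =
      pi / 2 * (real (j * k) * (if j dvd j * k then sc (j * k div j) u else 0))\<^sup>2" for k
    using assms by (simp add: power_mult_distrib)
  ultimately show ?thesis
    by (subst sums_multiples[OF assms, symmetric]) (simp_all only:, simp)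
qed

lemma stretch_coeff_summable:
  assumes "0 < j"
  shows "summable (\<lambda>m. (real m * (if j dvd m then sc (m div j) u else 0))\<^sup>2)"
proof -
  have "summable (\<lambda>m. pi / 2 * (real m * (if j dvd m then sc (m div j) u else 0))\<^sup>2)"
    using stretch_coeff_sums[OF assms] by (rule sums_summable)
  then show ?thesis by (subst (asm) summable_cmult_iff) auto
qed

lemma sc_stretch:
  assumes "0 < j"
  shows "sc n (stretch j u) = (if j dvd n then sc (n div j) u else 0)"
  using sc_sine_series[OF stretch_coeff_summable[OF assms], of n u]
  by (cases "n = 0") (simp_all add: stretch_def)

lemma norm_stretch:
  assumes "0 < j"
  shows "norm (stretch j u) = real j * norm u"
proof -
  have "(norm (stretch j u))\<^sup>2 = (real j * norm u)\<^sup>2"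
    using sums_unique2[OF parseval[of "stretch j u"]] stretch_coeff_sums[OF assms, of u]
    by (simp only: sc_stretch[OF assms] power_mult_distrib[of "real j"])
  then show ?thesis by simp
qed

lemma bounded_linear_stretch:
  assumes "0 < j" shows "bounded_linear (stretch j)"
  by (rule bounded_linear_intro[where K = "real j"])
    (use assms in \<open>auto simp: h10_eq_iff_sc sc_stretch norm_stretch\<close>)

lemma stretch_1 [simp]: "stretch (Suc 0) u = u"
  by (simp add: h10_eq_iff_sc sc_stretch)

lemma stretch_sums:
  assumes j: "0 < j" and x: "x \<in> {0..pi}"
  shows "(\<lambda>k. sc k u * sin (real k * (real j * x))) sums h10_fun (stretch j u) x"
proof -
  let ?c = "\<lambda>m. if j dvd m then sc (m div j) u else 0"
  have "(\<lambda>m. ?c m *\<^sub>R sine_mode m) sums stretch j u"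
    unfolding stretch_def by (intro summable_sums summable_sine_series stretch_coeff_summable j)
  from bounded_linear.sums[OF bounded_linear_h10_fun this, of x]
  have "(\<lambda>m. ?c m * sin (real m * x)) sums h10_fun (stretch j u) x"
    using x by (simp add: h10_fun_sine_mode)
  then have "(\<lambda>k. ?c (j * k) * sin (real (j * k) * x)) sums h10_fun (stretch j u) x"
    by (subst sums_multiples[OF j]) auto
  then show ?thesis using j by (simp add: mult_ac)
qed

text \<open>Every angle is folded into \<open>{0..pi}\<close> by reflection and translation by
  multiples of \<open>2 pi\<close>; the point is that one sign \<open>\<sigma>\<close> serves all
  frequencies \<open>k\<close>.\<close>

lemma sin_reduce:
  obtains \<sigma> y' :: real where "\<sigma> = 1 \<or> \<sigma> = -1" "y' \<in> {0..pi}" "\<And>k. sin (real k * y) = \<sigma> * sin (real k * y')"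
proof -
  define y' where "y' = arccos (cos y)"
  have y': "y' \<in> {0..pi}" "cos y = cos y'"
    unfolding y'_def using arccos_bounded[of "cos y"] by auto
  obtain n where n: "n \<in> \<int>" "y = y' + 2 * n * pi \<or> y = - y' + 2 * n * pi"
    using y'(2) unfolding cos_eq by blast
  from n(1) obtain m where m: "n = of_int m" by (elim Ints_cases)
  have p: "sin (real k * (z + 2 * n * pi)) = sin (real k * z)" for k z
  proof -
    have "real k * (z + 2 * n * pi) = real k * z + 2 * pi * of_int (int k * m)"
      by (simp add: m algebra_simps)
    then show ?thesis by (simp add: sin_add sin_int_2pin cos_int_2pin del: of_int_mult)
  qed
  from n(2) show ?thesis
  proof
    assume "y = y' + 2 * n * pi"
    then show ?thesis using p[of _ y'] y' by (intro that[of 1 y']) auto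
  next
    assume "y = - y' + 2 * n * pi"
    then show ?thesis using p[of _ "- y'"] y' by (intro that[of "-1" y']) auto
  qed
qed

lemma h10_fun_sums:
  assumes "x \<in> {0..pi}" shows "(\<lambda>k. sc k u * sin (real k * x)) sums h10_fun u x"
  using stretch_sums[of 1 x u] assms by simp

text \<open>The point \<open>y\<close> and the sign \<open>\<sigma>\<close> depend on
  \<open>x\<close> and \<open>j\<close> but not on \<open>u\<close>; thus odd pointwise operations
  commute with \<open>stretch\<close>.\<close>

lemma h10_fun_stretch:
  assumes j: "0 < j" and x: "x \<in> {0..pi}"
  obtains \<sigma> y where "\<sigma> = 1 \<or> \<sigma> = -1" "y \<in> {0..pi}" "sin (real j * x) = \<sigma> * sin y"
    "\<And>u. h10_fun (stretch j u) x = \<sigma> * h10_fun u y"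
proof -
  obtain \<sigma> y where y: "\<sigma> = 1 \<or> \<sigma> = -1" "y \<in> {0..pi}"
    "\<And>k. sin (real k * (real j * x)) = \<sigma> * sin (real k * y)"
    using sin_reduce[of "real j * x"] by blast
  have "h10_fun (stretch j u) x = \<sigma> * h10_fun u y" for u
  proof (rule sums_unique2[OF stretch_sums[OF j x]])
    show "(\<lambda>k. sc k u * sin (real k * (real j * x))) sums (\<sigma> * h10_fun u y)"
      using sums_mult[OF h10_fun_sums[OF y(2)], of \<sigma> u] by (simp only: y(3) mult.left_commute)
  qed
  with y(1,2) y(3)[of 1] show ?thesis by (intro that[of \<sigma> y]) auto
qed

lemma h10_fun_stretch_first:
  assumes j: "0 < j" and x: "x \<in> {0..pi / real j}"
  shows "h10_fun (stretch j u) x = h10_fun u (real j * x)"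
proof -
  have jx: "real j * x \<le> pi" using x j by (simp add: pos_le_divide_eq mult.commute)
  have "x \<le> real j * x" using x j mult_right_mono[of 1 "real j" x] by simp
  then show ?thesis
    using sums_unique2[OF stretch_sums[OF j, of x] h10_fun_sums[of "real j * x"]] x jx by auto
qed

lemma stretch_cube:
  assumes j: "0 < j" shows "stretch j (cube u) = cube (stretch j u)"
proof (rule h10_eqI)
  fix x :: real assume "x \<in> {0<..<pi}"
  then have x: "x \<in> {0..pi}" by simp
  obtain \<sigma> y where y: "\<sigma> = 1 \<or> \<sigma> = -1" "\<And>u. h10_fun (stretch j u) x = \<sigma> * h10_fun u y"
    using h10_fun_stretch[OF j x] by metis
  then show "h10_fun (stretch j (cube u)) x = h10_fun (cube (stretch j u)) x"
    by (auto simp: power_mult_distrib)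
qed

lemma stretch_linear:
  assumes j: "0 < j"
  shows "stretch j (a *\<^sub>R u) = a *\<^sub>R stretch j u" "stretch j (u - v) = stretch j u - stretch j v" "stretch j 0 = 0"
  using linear_scale[OF bounded_linear.linear[OF bounded_linear_stretch[OF j]]]
    linear_diff[OF bounded_linear.linear[OF bounded_linear_stretch[OF j]]]
    linear_0[OF bounded_linear.linear[OF bounded_linear_stretch[OF j]]] by auto

lemma stretch_reac:
  assumes j: "0 < j"
  shows "reac lam b (stretch j u) = (real j)\<^sup>2 *\<^sub>R stretch j (reac (lam / (real j)\<^sup>2) (b / (real j)\<^sup>2) u)"
  using j by (simp add: reac_def stretch_linear stretch_cube scaleR_diff_right)

text \<open>Coefficient \<open>j k\<close> of the stretched function is coefficient \<open>k\<close>
  of the original, and \<open>(j k)^2 = j^2 k^2\<close> supplies the factor of the new time scale.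
  For \<open>j = 1\<close> the offset \<open>d\<close> yields translation in time.\<close>

lemma lin_sol_stretch:
  assumes j: "0 < j" and v: "lin_sol ((real j)\<^sup>2 * s + d) v G"
  shows "lin_sol s (\<lambda>t. stretch j (v ((real j)\<^sup>2 * t + d))) (\<lambda>t. (real j)\<^sup>2 *\<^sub>R stretch j (G ((real j)\<^sup>2 * t + d)))"
  unfolding lin_sol_def
proof (intro conjI allI impI)
  let ?\<tau> = "\<lambda>t. (real j)\<^sup>2 * t + d"
  have sub: "?\<tau> ` {s..} \<subseteq> {?\<tau> s..}" by (auto intro!: mult_left_mono)
  have c\<tau>: "continuous_on {s..} ?\<tau>" by (intro continuous_intros)
  note cs = bounded_linear.continuous_on[OF bounded_linear_stretch[OF j]]
  show "continuous_on {s..} (\<lambda>t. stretch j (v (?\<tau> t)))"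
    by (rule cs[OF continuous_on_compose2[OF lin_solD(1)[OF v] c\<tau> sub]])
  show "continuous_on {s..} (\<lambda>t. (real j)\<^sup>2 *\<^sub>R stretch j (G (?\<tau> t)))"
    by (intro continuous_on_scaleR continuous_on_const cs[OF continuous_on_compose2[OF lin_solD(2)[OF v] c\<tau> sub]])
  fix n t assume t: "s \<le> t"
  show "((\<lambda>t. sc n (stretch j (v (?\<tau> t)))) has_real_derivative
      sc n ((real j)\<^sup>2 *\<^sub>R stretch j (G (?\<tau> t))) - (real n)\<^sup>2 * sc n (stretch j (v (?\<tau> t)))) (at t within {s..})"
  proof (cases "j dvd n")
    case True
    then obtain k where k: "n = j * k" by blast
    have \<tau>: "?\<tau> s \<le> ?\<tau> t" using t by (simp add: mult_left_mono)
    have "((\<lambda>t. sc k (v (?\<tau> t))) has_real_derivative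
        (sc k (G (?\<tau> t)) - (real k)\<^sup>2 * sc k (v (?\<tau> t))) * (real j)\<^sup>2) (at t within {s..})"
    proof (rule DERIV_image_chain[unfolded o_def, of "\<lambda>r. sc k (v r)"])
      show "((\<lambda>r. sc k (v r)) has_real_derivative sc k (G (?\<tau> t)) - (real k)\<^sup>2 * sc k (v (?\<tau> t))) (at (?\<tau> t) within ?\<tau> ` {s..})"
        by (rule DERIV_subset[OF lin_solD(3)[OF v \<tau>] sub])
      show "(?\<tau> has_real_derivative (real j)\<^sup>2) (at t within {s..})"
        by (auto intro!: derivative_eq_intros)
    qed
    then show ?thesis using j by (simp add: sc_stretch k power_mult_distrib algebra_simps)
  qed (simp add: sc_stretch[OF j])
qed

lemma sol_stretch:
  assumes j: "0 < j" and v: "sol (lam / (real j)\<^sup>2) \<beta>' ((real j)\<^sup>2 * s + d) v"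
    and \<beta>: "\<And>t. \<beta> t = (real j)\<^sup>2 * \<beta>' ((real j)\<^sup>2 * t + d)"
  shows "sol lam \<beta> s (\<lambda>t. stretch j (v ((real j)\<^sup>2 * t + d)))"
  unfolding sol_def
proof (rule lin_sol_cong[OF lin_sol_stretch[OF j sol_lin_sol[OF v]]])
  fix t
  have "\<beta> t / (real j)\<^sup>2 = \<beta>' ((real j)\<^sup>2 * t + d)" using j \<beta> by simp
  then show "reac lam (\<beta> t) (stretch j (v ((real j)\<^sup>2 * t + d))) = (real j)\<^sup>2 *\<^sub>R stretch j
      (reac (lam / (real j)\<^sup>2) (\<beta>' ((real j)\<^sup>2 * t + d)) (v ((real j)\<^sup>2 * t + d)))"
    by (simp only: stretch_reac[OF j])
qed simp

lemma steady_stretch: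
  assumes j: "0 < j" and \<phi>: "steady (lam / (real j)\<^sup>2) (b / (real j)\<^sup>2) \<phi>"
  shows "steady lam b (stretch j \<phi>)"
  unfolding steady_def
proof
  fix n
  have "(real k)\<^sup>2 * sc k \<phi> = sc k (reac (lam / (real j)\<^sup>2) (b / (real j)\<^sup>2) \<phi>)" for k
    using \<phi> by (simp add: steady_def)
  from this[of "n div j"] show "(real n)\<^sup>2 * sc n (stretch j \<phi>) = sc n (reac lam b (stretch j \<phi>))"
    using j by (auto simp: stretch_reac sc_stretch power_mult_distrib mult_ac elim!: dvdE)
qed

section \<open>The positive stationary solution\<close>

lemma sol_steady: "steady lam b \<phi> \<Longrightarrow> sol lam (\<lambda>_. b) s (\<lambda>_. \<phi>)"
  by (simp add: sol_def steady_def lin_sol_def)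

lemma steady_of_sol: "sol lam (\<lambda>_. b) s (\<lambda>_. \<phi>) \<Longrightarrow> steady lam b \<phi>"
proof -
  assume s: "sol lam (\<lambda>_. b) s (\<lambda>_. \<phi>)"
  have "sc n (reac lam b \<phi>) - (real n)\<^sup>2 * sc n \<phi> = 0" for n
  proof (rule DERIV_unique)
    have "((\<lambda>t. sc n \<phi>) has_real_derivative sc n (reac lam b \<phi>) - (real n)\<^sup>2 * sc n \<phi>) (at (s + 1) within {s..})"
      by (rule lin_solD(3)[OF sol_lin_sol[OF s]]) simp
    moreover have "at (s + 1) within {s..} = at (s + 1)"
      by (rule at_within_interior) (simp add: interior_real_atLeast)
    ultimately show "((\<lambda>t. sc n \<phi>) has_real_derivative sc n (reac lam b \<phi>) - (real n)\<^sup>2 * sc n \<phi>) (at (s + 1))"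
      by simp
  qed (rule DERIV_const)
  then show ?thesis by (simp add: steady_def)
qed

text \<open>For a constant coefficient the evolution depends on \<open>t - s\<close> only, so the
  pullback limit from \<open>\<delta> sin x\<close> is constant in time and hence stationary. Any
  stationary solution above \<open>\<delta> sin x\<close> dominates this limit, and the contraction
  between two constant curves forces equality.\<close>

lemma steady_above_sine:
  assumes lam: "1 < lam" and b: "0 < b" and \<delta>: "0 < \<delta>" "b * \<delta>\<^sup>2 \<le> lam - 1"
  obtains \<phi> where "steady lam b \<phi>" "\<delta> *\<^sub>R sine_mode 1 \<preceq> \<phi>"
    "\<And>\<psi>. steady lam b \<psi> \<Longrightarrow> \<delta> *\<^sub>R sine_mode 1 \<preceq> \<psi> \<Longrightarrow> \<psi> = \<phi>"
proof -
  interpret chafee_infante lam b b "\<lambda>_. b" by unfold_locales (use lam b in auto)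
  let ?A = "\<delta> *\<^sub>R sine_mode 1"
  have A0: "0 \<preceq> ?A" using h10_le_scale[OF sine_mode_1_nonneg, of 0 \<delta>] \<delta> by simp
  obtain M where M: "cap M" "below ?A M" using below_cap[OF A0] by blast
  have sub: "?A \<preceq> E t s ?A" if st: "s \<le> t" for s t
  proof (rule barrier_sub[of s "\<lambda>_. \<delta>" "\<lambda>_. 0", OF _ _ _ _ E_sol[OF A0] _ st])
    show "0 \<le> (lam - 1) * \<delta> - b * \<delta> ^ 3"
      using mult_right_mono[OF \<delta>(2), of \<delta>] \<delta> by (simp add: power2_eq_square power3_eq_cube mult.assoc)
    show "?A \<preceq> E s s ?A" unfolding E_self[OF A0] by (rule h10_le_refl)
  qed (use \<delta> in auto)
  obtain \<xi> where \<xi>: "\<And>s. sol lam (\<lambda>_. b) s \<xi>" "\<And>t. ((\<lambda>s. E t s ?A) \<longlongrightarrow> \<xi> t) at_bot" "\<And>t. below (\<xi> t) M"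
    using pullback_limit[OF M(1), of "\<lambda>_. ?A"] M(2) sub by metis
  \<comment> \<open>Translation invariance, obtained from \<open>sol_stretch\<close> with
    \<open>j = 1\<close> and offset \<open>- t\<close>.\<close>
  have shift: "E t s ?A = E 0 (s - t) ?A" if st: "s \<le> t" for s t
  proof -
    have "sol lam (\<lambda>_. b) s (\<lambda>r. stretch 1 (E ((real 1)\<^sup>2 * r + - t) (s - t) ?A))"
      by (rule sol_stretch[where \<beta>' = "\<lambda>_. b"]) (use E_sol[OF A0, of "s - t"] in simp_all)
    then have "sol lam (\<lambda>_. b) s (\<lambda>r. E (r - t) (s - t) ?A)" by simp
    from evolution_eq[OF beta_cont this st] show ?thesis unfolding E_self[OF A0] by simp
  qed
  have const: "\<xi> t = \<xi> 0" for t
  proof (rule tendsto_unique[OF _ \<xi>(2)])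
    have "filterlim (\<lambda>s. s - t) at_bot at_bot"
      unfolding filterlim_at_bot
      by (intro allI eventually_mono[OF eventually_le_at_bot]) (simp only: diff_le_eq)
    then have "((\<lambda>s. E 0 (s - t) ?A) \<longlongrightarrow> \<xi> 0) at_bot"
      using filterlim_compose[OF \<xi>(2)[of 0]] by simp
    then show "((\<lambda>s. E t s ?A) \<longlongrightarrow> \<xi> 0) at_bot"
      by (rule Lim_transform_eventually[OF _ eventually_mono[OF eventually_le_at_bot[of t] shift[symmetric]]])
  qed simp
  have "sol lam (\<lambda>_. b) 0 (\<lambda>_. \<xi> 0)"
    unfolding sol_def by (rule lin_sol_cong[OF sol_lin_sol[OF \<xi>(1)]]) (metis const)+
  then have st: "steady lam b (\<xi> 0)" by (rule steady_of_sol)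
  have low: "?A \<preceq> \<xi> 0"
    by (rule tendsto_h10_le[OF tendsto_const \<xi>(2) eventually_mono[OF eventually_le_at_bot[of 0] sub]]) auto
  show ?thesis
  proof (rule that[OF st low])
    fix \<psi> assume \<psi>: "steady lam b \<psi>" and A\<psi>: "?A \<preceq> \<psi>"
    have \<psi>0: "0 \<preceq> \<psi>" by (rule h10_le_trans[OF A0 A\<psi>])
    have E\<psi>: "E t s \<psi> = \<psi>" if "s \<le> t" for s t
      using evolution_eq[OF beta_cont sol_steady[OF \<psi>] that] .
    have le: "\<xi> 0 \<preceq> \<psi>"
    proof (rule tendsto_h10_le[OF \<xi>(2) tendsto_const])
      show "\<forall>\<^sub>F s in at_bot. E 0 s ?A \<preceq> \<psi>"
        by (rule eventually_mono[OF eventually_le_at_bot[of 0]]) (use E_mono[OF A0 A\<psi>] E\<psi> in metis)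
    qed simp
    obtain C where C: "0 < C" "\<psi> \<preceq> C *\<^sub>R sine_mode 1" using steady_le_sine[OF \<psi>] by blast
    obtain M' where M': "cap M'" "below \<psi> M'" using below_cap[OF \<psi>0] by blast
    have "below (\<xi> 0) M'"
      using M'(2) le h10_le_trans[OF A0 low] unfolding below_def h10_le_def by (meson order_trans)
    define \<theta> where "\<theta> = min 1 (\<delta> / C)"
    have \<theta>: "0 < \<theta>" "\<theta> \<le> 1" "\<theta> * C \<le> \<delta>"
      using \<delta> C(1) by (auto simp: \<theta>_def min_def field_simps)
    have "\<theta> *\<^sub>R \<psi> \<preceq> (\<theta> * C) *\<^sub>R sine_mode 1"
      using C(2) \<theta>(1) by (auto simp: h10_le_def mult.assoc)
    moreover have "(\<theta> * C) *\<^sub>R sine_mode 1 \<preceq> ?A"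
      by (rule h10_le_scale[OF sine_mode_1_nonneg \<theta>(3)])
    ultimately have init: "\<theta> *\<^sub>R \<psi> \<preceq> \<xi> 0" using low by (blast intro: h10_le_trans)
    have "((\<lambda>t::real. \<xi> 0 - \<psi>) \<longlongrightarrow> 0) at_top"
      by (rule part_converge[OF sol_steady[OF \<psi>] sol_steady[OF st] M'(2) \<open>below (\<xi> 0) M'\<close> \<delta>(1) A\<psi> C \<theta>(1,2) init le])
    then show "\<psi> = \<xi> 0" by (simp add: tendsto_const_iff)
  qed
qed

lemma positive_of_sine_le:
  assumes "0 < \<delta>" "\<delta> *\<^sub>R sine_mode 1 \<preceq> \<phi>" "x \<in> {0<..<pi}"
  shows "0 < h10_fun \<phi> x"
proof -
  have "0 < \<delta> * sin x" using assms by (simp add: sin_gt_zero)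
  then show ?thesis using h10_leD[OF assms(2), of x] assms(3) by (simp add: h10_fun_sine_mode)
qed

lemma positive_steady_exists:
  assumes "1 < lam" "0 < b"
  obtains \<phi> \<delta> where "steady lam b \<phi>" "0 < \<delta>" "\<delta> *\<^sub>R sine_mode 1 \<preceq> \<phi>"
proof -
  have "0 < sqrt ((lam - 1) / b)" "b * (sqrt ((lam - 1) / b))\<^sup>2 \<le> lam - 1" using assms by simp_all
  with steady_above_sine[OF assms] that show ?thesis by blast
qed

text \<open>Both solutions lie above multiples of the sine; a common multiple that also satisfies
  the barrier condition makes \<open>steady_above_sine\<close> applicable to both.\<close>

lemma positive_steady_unique:
  assumes lam: "1 < lam" and b: "0 < b" and \<phi>: "steady lam b \<phi>" and \<psi>: "steady lam b \<psi>"
    and pos: "\<And>x. x \<in> {0<..<pi} \<Longrightarrow> 0 < h10_fun \<phi> x" "\<And>x. x \<in> {0<..<pi} \<Longrightarrow> 0 < h10_fun \<psi> x"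
  shows "\<phi> = \<psi>"
proof -
  obtain d where d: "0 < d" "d *\<^sub>R sine_mode 1 \<preceq> \<phi>" using steady_ge_sine[OF \<phi> pos(1)] lam b by auto
  obtain e where e: "0 < e" "e *\<^sub>R sine_mode 1 \<preceq> \<psi>" using steady_ge_sine[OF \<psi> pos(2)] lam b by auto
  define \<delta> where "\<delta> = min (min d e) (sqrt ((lam - 1) / b))"
  have \<delta>: "0 < \<delta>" "\<delta> \<le> d" "\<delta> \<le> e" using d e lam b by (auto simp: \<delta>_def)
  have "\<delta>\<^sup>2 \<le> (sqrt ((lam - 1) / b))\<^sup>2"
    using \<delta>(1) by (intro power_mono) (auto simp: \<delta>_def)
  then have "b * \<delta>\<^sup>2 \<le> lam - 1" using lam b by (simp add: field_simps)
  moreover have "\<delta> *\<^sub>R sine_mode 1 \<preceq> \<phi>" "\<delta> *\<^sub>R sine_mode 1 \<preceq> \<psi>"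
    using h10_le_trans[OF h10_le_scale[OF sine_mode_1_nonneg \<delta>(2)] d(2)]
      h10_le_trans[OF h10_le_scale[OF sine_mode_1_nonneg \<delta>(3)] e(2)] by auto
  ultimately show ?thesis using steady_above_sine[OF lam b \<delta>(1)] \<phi> \<psi> by metis
qed

section \<open>Identification of \<open>phi_plus\<close>\<close>

text \<open>The first arch is stretched to the whole interval; the zero at \<open>pi / j\<close>
  supplies the right boundary value, and the chain rule the factors \<open>1 / j^2\<close>.\<close>

lemma steady_first_arch:
  assumes j: "0 < j" and \<psi>': "steady lam b \<psi>'" and z: "h10_fun \<psi>' (pi / real j) = 0"
  obtains \<psi> where "steady (lam / (real j)\<^sup>2) (b / (real j)\<^sup>2) \<psi>"
    "\<And>x. x \<in> {0..pi} \<Longrightarrow> h10_fun \<psi> x = h10_fun \<psi>' (x / real j)"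
proof -
  obtain g where g: "\<And>x. x \<in> {0..pi} \<Longrightarrow> (h10_fun \<psi>' has_real_derivative g x) (at x within {0..pi})"
    "\<And>x. x \<in> {0..pi} \<Longrightarrow> (g has_real_derivative - (lam * h10_fun \<psi>' x - b * h10_fun \<psi>' x ^ 3)) (at x within {0..pi})"
    using steady_deriv[OF \<psi>'] by blast
  have in_pi: "x / real j \<in> {0..pi}" if "x \<in> {0..pi}" for x
  proof -
    have "x / real j \<le> x / 1" using that j by (intro divide_left_mono) auto
    then show ?thesis using that by auto
  qed
  have dil: "((\<lambda>x. f (x / real j)) has_real_derivative f' (x / real j) / real j) (at x within {0..pi})"
    if "\<And>x. x \<in> {0..pi} \<Longrightarrow> (f has_real_derivative f' x) (at x within {0..pi})" "x \<in> {0..pi}" for f f' x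
  proof -
    have "((\<lambda>x. f (x / real j)) has_real_derivative f' (x / real j) * (1 / real j)) (at x within {0..pi})"
    proof (rule DERIV_image_chain[unfolded o_def, of f])
      show "(f has_real_derivative f' (x / real j)) (at (x / real j) within (\<lambda>x. x / real j) ` {0..pi})"
        by (rule DERIV_subset[OF that(1)[OF in_pi[OF that(2)]]]) (use in_pi in auto)
    qed (use j in \<open>auto intro!: derivative_eq_intros\<close>)
    then show ?thesis by simp
  qed
  have d2: "((\<lambda>x. g (x / real j) / real j) has_real_derivative
      - (lam * h10_fun \<psi>' (x / real j) - b * h10_fun \<psi>' (x / real j) ^ 3) / real j / real j) (at x within {0..pi})"
    if "x \<in> {0..pi}" for x
    by (rule DERIV_cdivide[OF dil[OF g(2) that]])
  obtain \<psi> where \<psi>: "\<And>x. x \<in> {0..pi} \<Longrightarrow> h10_fun \<psi> x = h10_fun \<psi>' (x / real j)"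
    using C1_h10[OF dil[OF g(1)] DERIV_continuous_on[OF d2]] z by auto
  have "steady (lam / (real j)\<^sup>2) (b / (real j)\<^sup>2) \<psi>"
    unfolding steady_def
  proof (intro allI sc_second_deriv)
    fix x :: real assume x: "x \<in> {0<..<pi}"
    then have xx: "x \<in> {0..pi}" "at x within {0..pi} = at x" by (auto simp: at_within_Icc_at)
    show "(h10_fun \<psi> has_real_derivative g (x / real j) / real j) (at x)"
      by (rule has_field_derivative_transform_within_open[OF dil[OF g(1) xx(1), unfolded xx(2)], of "{0<..<pi}"])
        (use x \<psi> in auto)
    have "- (lam * h10_fun \<psi>' (x / real j) - b * h10_fun \<psi>' (x / real j) ^ 3) / real j / real j =
        - h10_fun (reac (lam / (real j)\<^sup>2) (b / (real j)\<^sup>2) \<psi>) x"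
      using j by (simp add: h10_fun_reac \<psi>[OF xx(1)] field_simps power2_eq_square)
    then show "((\<lambda>x. g (x / real j) / real j) has_real_derivative
        - h10_fun (reac (lam / (real j)\<^sup>2) (b / (real j)\<^sup>2) \<psi>) x) (at x)"
      using d2[OF xx(1)] unfolding xx(2) by simp
  qed
  with \<psi> that show ?thesis by blast
qed

lemma sin_multiple_zeros:
  assumes j: "0 < j"
  shows "{x \<in> {0..pi}. sin (real j * x) = 0} = {real i * pi / real j |i. i \<le> j}"
proof (intro equalityI subsetI)
  fix x assume "x \<in> {x \<in> {0..pi}. sin (real j * x) = 0}"
  then have x: "0 \<le> x" "x \<le> pi" and s: "sin (real j * x) = 0" by auto
  obtain i :: int where i: "real j * x = of_int i * pi" using s by (auto simp: sin_zero_iff_int2)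
  have "0 \<le> of_int i * pi" using i x by (metis mult_nonneg_nonneg of_nat_0_le_iff)
  then have i0: "0 \<le> i" using pi_gt_zero by (auto simp: zero_le_mult_iff)
  have "of_int i * pi \<le> real j * pi" using i x j by (metis mult_left_mono of_nat_0_le_iff)
  then have "nat i \<le> j" by (simp add: mult_le_cancel_right)
  moreover have "x = real (nat i) * pi / real j" using i i0 j by (simp add: field_simps)
  ultimately show "x \<in> {real i * pi / real j |i. i \<le> j}" by blast
next
  fix x assume "x \<in> {real i * pi / real j |i. i \<le> j}"
  then obtain i where i: "i \<le> j" "x = real i * pi / real j" by blast
  have "real i * pi \<le> pi * real j" using i(1) by simp
  then have "x \<le> pi" "0 \<le> x" using j unfolding i(2) by (simp_all add: pos_divide_le_eq)
  moreover have "real j * x = real i * pi" using i j by simp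
  ultimately show "x \<in> {x \<in> {0..pi}. sin (real j * x) = 0}" by simp
qed

text \<open>The definite description is resolved by uniqueness on the first arch, where the solution
  is positive, followed by ODE uniqueness on the rest of the interval.\<close>

lemma phi_plus_eq_stretch:
  assumes j: "0 < j" and lam: "(real j)\<^sup>2 < lam" and b: "0 < b"
    and \<phi>: "steady (lam / (real j)\<^sup>2) (b / (real j)\<^sup>2) \<phi>" and pos: "\<And>x. x \<in> {0<..<pi} \<Longrightarrow> 0 < h10_fun \<phi> x"
  shows "phi_plus lam b j = stretch j \<phi>"
  unfolding phi_plus_def stationary_solution_iff
proof (rule the_equality, intro conjI ballI)
  have st: "steady lam b (stretch j \<phi>)" by (rule steady_stretch[OF j \<phi>])
  then show "steady lam b (stretch j \<phi>)" .
  have zero: "h10_fun \<phi> y = 0 \<longleftrightarrow> sin y = 0" if "y \<in> {0..pi}" for y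
    using pos[of y] sin_gt_zero[of y] that by (cases "y = 0 \<or> y = pi") auto
  have "h10_fun (stretch j \<phi>) x = 0 \<longleftrightarrow> sin (real j * x) = 0" if x: "x \<in> {0..pi}" for x
  proof -
    obtain \<sigma> y where y: "\<sigma> = 1 \<or> \<sigma> = -1" "y \<in> {0..pi}" "sin (real j * x) = \<sigma> * sin y"
      "\<And>u. h10_fun (stretch j u) x = \<sigma> * h10_fun u y"
      using h10_fun_stretch[OF j x] by metis
    then show ?thesis using zero[OF y(2)] by auto
  qed
  then show "{x \<in> {0..pi}. h10_fun (stretch j \<phi>) x = 0} = {real i * pi / real j |i. i \<le> j}"
    using sin_multiple_zeros[OF j] by auto
  show "0 < h10_fun (stretch j \<phi>) x" if "x \<in> {0<..<pi / real j}" for x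
    using that j h10_fun_stretch_first[OF j, of x \<phi>] pos[of "real j * x"]
    by (auto simp: field_simps)
next
  fix \<psi>' assume \<psi>': "steady lam b \<psi>' \<and>
     {x \<in> {0..pi}. h10_fun \<psi>' x = 0} = {real i * pi / real j |i. i \<le> j} \<and>
     (\<forall>x\<in>{0<..<pi / real j}. 0 < h10_fun \<psi>' x)"
  have "pi / real j \<in> {real i * pi / real j |i. i \<le> j}" using j by (intro CollectI exI[of _ 1]) auto
  then have z: "h10_fun \<psi>' (pi / real j) = 0" using \<psi>' by blast
  obtain \<psi> where \<psi>: "steady (lam / (real j)\<^sup>2) (b / (real j)\<^sup>2) \<psi>"
    "\<And>x. x \<in> {0..pi} \<Longrightarrow> h10_fun \<psi> x = h10_fun \<psi>' (x / real j)"
    using steady_first_arch[OF j _ z, of lam b] \<psi>' by blast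
  have "0 < h10_fun \<psi> x" if "x \<in> {0<..<pi}" for x
    using \<psi>' \<psi>(2)[of x] that j by (auto simp: divide_strict_right_mono)
  then have eq: "\<psi> = \<phi>"
    using positive_steady_unique[OF _ _ \<psi>(1) \<phi>] pos lam b j by auto
  show "\<psi>' = stretch j \<phi>"
  proof (rule steady_continuation[of lam b _ _ "pi / real j"])
    show "steady lam b \<psi>'" "steady lam b (stretch j \<phi>)" using \<psi>' steady_stretch[OF j \<phi>] by auto
    show "0 < pi / real j" "pi / real j \<le> pi" using j by (auto simp: field_simps)
    fix x assume x: "x \<in> {0<..<pi / real j}"
    then have "real j * x \<in> {0..pi}" using j by (auto simp: field_simps)
    then show "h10_fun \<psi>' x = h10_fun (stretch j \<phi>) x"
      using h10_fun_stretch_first[OF j, of x \<phi>] \<psi>(2)[of "real j * x"] eq x j by auto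
  qed
qed

section \<open>Transfer to higher modes\<close>

lemma sol_minus: "sol lam \<beta> s u \<Longrightarrow> sol lam \<beta> s (\<lambda>t. - u t)"
proof -
  assume "sol lam \<beta> s u"
  from lin_sol_scale[OF sol_lin_sol[OF this], of "-1"] show ?thesis
    unfolding sol_def by (rule lin_sol_cong) (auto intro!: h10_eqI simp: h10_fun_reac)
qed

text \<open>One pair for the first mode serves both signs: the equation is odd, so negation maps
  solutions to solutions and pullback limits to pullback limits. The factor \<open>j^2\<close> in
  time is positive and preserves all limits at infinity.\<close>

lemma higher_mode_connection:
  assumes j: "0 < j" and jlam: "(real j)\<^sup>2 < lam" and \<beta>: "continuous_on UNIV \<beta>"
    and b1_pos: "0 < b1" and ge: "\<And>t. b1 \<le> \<beta> t" and le: "\<And>t. \<beta> t \<le> b2"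
  obtains \<xi> \<zeta> where "\<And>s. sol lam \<beta> s \<zeta>" "(\<zeta> \<longlongrightarrow> 0) at_bot" "((\<lambda>t. \<zeta> t - \<xi> t) \<longlongrightarrow> 0) at_top"
    "\<And>t. ((\<lambda>s. evolution lam \<beta> t s (phi_plus lam b1 j)) \<longlongrightarrow> \<xi> t) at_bot"
    "\<And>t. ((\<lambda>s. evolution lam \<beta> t s (phi_minus lam b1 j)) \<longlongrightarrow> - \<xi> t) at_bot"
proof -
  let ?J = "(real j)\<^sup>2"
  have J: "0 < ?J" using j by simp
  define \<beta>' where "\<beta>' t = \<beta> (t / ?J) / ?J" for t
  have \<beta>\<beta>': "\<beta> t = ?J * \<beta>' (?J * t + 0)" for t using J by (simp add: \<beta>'_def)
  interpret chafee_infante "lam / ?J" "b1 / ?J" "b2 / ?J" \<beta>'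
  proof
    have "continuous_on UNIV (\<lambda>t. \<beta> (t / ?J))"
      by (rule continuous_on_compose2[OF \<beta>]) (use j in \<open>auto intro!: continuous_intros\<close>)
    then show "continuous_on UNIV \<beta>'"
      unfolding \<beta>'_def[abs_def] using J by (intro continuous_intros) auto
  qed (use j jlam b1_pos ge le in \<open>auto simp: \<beta>'_def divide_right_mono\<close>)
  obtain \<phi> \<delta> where \<phi>: "steady (lam / ?J) (b1 / ?J) \<phi>" "0 < \<delta>" "\<delta> *\<^sub>R sine_mode 1 \<preceq> \<phi>"
    using positive_steady_exists[OF lam b1] by blast
  obtain C where C: "0 < C" "\<phi> \<preceq> C *\<^sub>R sine_mode 1" using steady_le_sine[OF \<phi>(1)] by blast
  have nn: "0 \<preceq> \<phi>"
    using h10_le_trans[OF h10_le_scale[OF sine_mode_1_nonneg less_imp_le[OF \<phi>(2)]] \<phi>(3)] by simp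
  have eq: "(real n)\<^sup>2 * sc n \<phi> = sc n (reac (lam / ?J) (b1 / ?J) \<phi>)" for n
    using \<phi>(1) by (simp add: steady_def)
  obtain \<xi> \<zeta> where \<xi>: "\<And>t. ((\<lambda>s. E t s \<phi>) \<longlongrightarrow> \<xi> t) at_bot" and \<zeta>: "\<And>s. sol (lam / ?J) \<beta>' s \<zeta>"
    "(\<zeta> \<longlongrightarrow> 0) at_bot" "((\<lambda>t. \<zeta> t - \<xi> t) \<longlongrightarrow> 0) at_top"
    by (rule connection[OF eq \<phi>(2,3) C]) (rule that)
  have phi: "phi_plus lam b1 j = stretch j \<phi>"
    by (rule phi_plus_eq_stretch[OF j jlam b1_pos \<phi>(1) positive_of_sine_le[OF \<phi>(2,3)]])
  note S = bounded_linear.tendsto[OF bounded_linear_stretch[OF j]]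
  have top: "filterlim (\<lambda>t. ?J * t) at_top at_top"
    by (rule filterlim_tendsto_pos_mult_at_top[OF tendsto_const J filterlim_ident])
  have bot: "filterlim (\<lambda>t. ?J * t) at_bot at_bot"
    by (rule filterlim_tendsto_pos_mult_at_bot[OF tendsto_const J filterlim_ident])
  have sol_E: "sol lam \<beta> s (\<lambda>r. stretch j (E (?J * r) (?J * s) \<phi>))" for s
    using sol_stretch[where d = 0 and \<beta>' = \<beta>' and s = s and v = "\<lambda>r. E r (?J * s) \<phi>", OF j _ \<beta>\<beta>']
      E_sol[OF nn, of "?J * s"]
    by simp
  \<comment> \<open>The stretched curve is a known solution, so \<open>evolution_eq\<close>
    evaluates \<open>evolution\<close> on sign-changing data.\<close>
  have ev: "evolution lam \<beta> t s (stretch j \<phi>) = stretch j (E (?J * t) (?J * s) \<phi>)"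
    "evolution lam \<beta> t s (- stretch j \<phi>) = - stretch j (E (?J * t) (?J * s) \<phi>)" if "s \<le> t" for s t
    using evolution_eq[OF \<beta> sol_E that] evolution_eq[OF \<beta> sol_minus[OF sol_E] that] unfolding E_self[OF nn] by auto
  have lim: "((\<lambda>s. stretch j (E (?J * t) (?J * s) \<phi>)) \<longlongrightarrow> stretch j (\<xi> (?J * t))) at_bot" for t
    by (rule S[OF filterlim_compose[OF \<xi> bot]])
  show ?thesis
  proof (rule that[of "\<lambda>t. stretch j (\<zeta> (?J * t))" "\<lambda>t. stretch j (\<xi> (?J * t))"])
    show "sol lam \<beta> s (\<lambda>t. stretch j (\<zeta> (?J * t)))" for s
      using sol_stretch[where d = 0 and \<beta>' = \<beta>', OF j \<zeta>(1) \<beta>\<beta>'] by simp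
    show "((\<lambda>t. stretch j (\<zeta> (?J * t))) \<longlongrightarrow> 0) at_bot"
      using S[OF filterlim_compose[OF \<zeta>(2) bot]] by (simp add: stretch_linear j)
    show "((\<lambda>t. stretch j (\<zeta> (?J * t)) - stretch j (\<xi> (?J * t))) \<longlongrightarrow> 0) at_top"
      using S[OF filterlim_compose[OF \<zeta>(3) top]] by (simp add: stretch_linear j)
    show "((\<lambda>s. evolution lam \<beta> t s (phi_plus lam b1 j)) \<longlongrightarrow> stretch j (\<xi> (?J * t))) at_bot" for t
      by (rule Lim_transform_eventually[OF lim])
        (auto simp: phi ev intro: eventually_mono[OF eventually_le_at_bot[of t]])
    show "((\<lambda>s. evolution lam \<beta> t s (phi_minus lam b1 j)) \<longlongrightarrow> - stretch j (\<xi> (?J * t))) at_bot" for t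
      by (rule Lim_transform_eventually[OF tendsto_minus[OF lim]])
        (auto simp: phi phi_minus_def ev intro: eventually_mono[OF eventually_le_at_bot[of t]])
  qed
qed

theorem theorem29:
  fixes N :: nat and lam \<beta>\<^sub>1 \<beta>\<^sub>2 :: real and \<beta> :: "real \<Rightarrow> real"
  assumes "1 \<le> N"
    and "(real N)\<^sup>2 < lam" and "lam < (real N + 1)\<^sup>2"
    and "\<beta> C1_differentiable_on UNIV"
    and "0 < \<beta>\<^sub>1" and "\<And>t. \<beta>\<^sub>1 \<le> \<beta> t" and "\<And>t. \<beta> t \<le> \<beta>\<^sub>2"
  shows "\<forall>j\<in>{1..N}. \<exists>\<zeta>\<^sub>p \<zeta>\<^sub>m.
    global_solution lam \<beta> \<zeta>\<^sub>p \<and> global_solution lam \<beta> \<zeta>\<^sub>m \<and>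
    (\<zeta>\<^sub>p \<longlongrightarrow> 0) at_bot \<and> (\<zeta>\<^sub>m \<longlongrightarrow> 0) at_bot \<and>
    ((\<lambda>t. \<zeta>\<^sub>p t - xi_plus lam \<beta> \<beta>\<^sub>1 j t) \<longlongrightarrow> 0) at_top \<and>
    ((\<lambda>t. \<zeta>\<^sub>m t - xi_minus lam \<beta> \<beta>\<^sub>1 j t) \<longlongrightarrow> 0) at_top"
proof
  fix j assume j: "j \<in> {1..N}"
  have "(real j)\<^sup>2 \<le> (real N)\<^sup>2" using j by (intro power_mono) auto
  then have lam: "(real j)\<^sup>2 < lam" using assms(2) by linarith
  have \<beta>: "continuous_on UNIV \<beta>"
    using C1_differentiable_imp_continuous_on[OF assms(4)] .
  obtain \<xi> \<zeta> where c: "\<And>s. sol lam \<beta> s \<zeta>" "(\<zeta> \<longlongrightarrow> 0) at_bot" "((\<lambda>t. \<zeta> t - \<xi> t) \<longlongrightarrow> 0) at_top"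
    "\<And>t. ((\<lambda>s. evolution lam \<beta> t s (phi_plus lam \<beta>\<^sub>1 j)) \<longlongrightarrow> \<xi> t) at_bot"
    "\<And>t. ((\<lambda>s. evolution lam \<beta> t s (phi_minus lam \<beta>\<^sub>1 j)) \<longlongrightarrow> - \<xi> t) at_bot"
    by (rule higher_mode_connection[OF _ lam \<beta> assms(5-7)]) (use j in auto)
  \<comment> \<open>The filter \<open>at_bot\<close> is nontrivial, so \<open>Lim\<close> is the
    limit just found.\<close>
  have xi: "xi_plus lam \<beta> \<beta>\<^sub>1 j t = \<xi> t" "xi_minus lam \<beta> \<beta>\<^sub>1 j t = - \<xi> t" for t
    using tendsto_Lim[OF _ c(4)] tendsto_Lim[OF _ c(5)] by (auto simp: xi_plus_def xi_minus_def)
  have "((\<lambda>t. - \<zeta> t) \<longlongrightarrow> 0) at_bot" "((\<lambda>t. - \<zeta> t - - \<xi> t) \<longlongrightarrow> 0) at_top"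
    using tendsto_minus[OF c(2)] tendsto_minus[OF c(3)] by (simp_all add: algebra_simps)
  then show "\<exists>\<zeta>\<^sub>p \<zeta>\<^sub>m.
    global_solution lam \<beta> \<zeta>\<^sub>p \<and> global_solution lam \<beta> \<zeta>\<^sub>m \<and>
    (\<zeta>\<^sub>p \<longlongrightarrow> 0) at_bot \<and> (\<zeta>\<^sub>m \<longlongrightarrow> 0) at_bot \<and>
    ((\<lambda>t. \<zeta>\<^sub>p t - xi_plus lam \<beta> \<beta>\<^sub>1 j t) \<longlongrightarrow> 0) at_top \<and>
    ((\<lambda>t. \<zeta>\<^sub>m t - xi_minus lam \<beta> \<beta>\<^sub>1 j t) \<longlongrightarrow> 0) at_top"
    using c(2,3) global_sol[OF c(1) \<beta>] global_sol[OF sol_minus[OF c(1)] \<beta>]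
    unfolding xi by blast
qed

end
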